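(* Let $\mathbf{k}$ be an algebraically closed field and let $\mathbf{K}$ be a finitely generated field over $\mathbf{k}$. Let $\mathcal{D}$ be a $\mathbf{K}$-central division algebra, finite dimensional over $\mathbf{K}$ and having degree prime to $\operatorname{char}\mathbf{k}$ (if positive). Choose a maximal $\mathcal{O}_X$-order $\Lambda$ in $\mathcal{D}$ over a proper normal variety $X$ with function field $\mathbf{K}$, and fix a Cartier divisor $D$ on $X$ such that $\mathrm{H}^0(X,\mathcal{O}_X(\ell D))\neq0$ for some $\ell>0$. Let $\mathbf{k}(\Lambda,D)$ be the division ring of degree zero fractions of $R(\Lambda,D)$ and let $\mathbf{k}(X,D)$ be the degree zero field of fractions of the section ring $R(D)=R(X,D)$. Then $$\operatorname{GKdim}R(D)-1=\operatorname{Ld}R(D)-1=\operatorname{trdeg}\mathbf{k}(X,D)=\operatorname{trdeg}\mathbf{k}(\Lambda,D)=\operatorname{Ld}\mathbf{k}(\Lambda,D).$$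
   Context: An $\mathcal{O}_X$-order in $\mathcal{D}$ is a coherent torsion free sheaf of $\mathcal{O}_X$-algebras $\Lambda$ with generic fibre $\mathcal{D}$; it is maximal if maximal under inclusion among orders in $\mathcal{D}$. The section ring of $D$ is $R(X,D)=\bigoplus_{\ell\ge0}\mathrm{H}^0(X,\mathcal{O}_X(\ell D))$, and the section ring of $\Lambda$ with respect to $D$ is the graded $\mathbf{k}$-algebra $R(\Lambda,D)=\bigoplus_{\ell\ge0}\mathrm{H}^0(X,\mathcal{O}_X(\ell D)\otimes_{\mathcal{O}_X}\Lambda)$, with multiplication induced from the sheaf of algebras $\operatorname{Sym}^\bullet(\mathcal{O}_X(D))\otimes\Lambda$. This is a domain satisfying the graded Ore conditions, and its degree zero division ring of fractions consists of all $s^{-1}a$ with $a,s$ homogeneous of the same degree, $s\ne0$. For a division algebra finite dimensional over its centre, $\operatorname{trdeg}$ means the transcendence degree of its centre over $\mathbf{k}$. For a $\mathbf{k}$-algebra $A$, $\operatorname{GKdim}A=\sup_V\limsup_{n\to\infty}\log_n\dim V^n$, with $V$ ranging over the finite dimensional subspaces of $A$. For a prime p.i. (polynomial identity) algebra $A$, the lower transcendence degree is $\operatorname{Ld}A=\sup_V\inf_b\limsup_{n\to\infty}\log_n\dim(\mathbf{k}+bV)^n$, with $V$ ranging over finite dimensional subspaces and $b$ over regular elements of $A$. Here $V^n$ and $(\mathbf{k}+bV)^n$ are the subspaces spanned by $n$-fold products. *)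

theory Defs
  imports
    "HOL-Library.Poly_Mapping"
    "HOL-Library.Extended_Real"
    "HOL-Library.Liminf_Limsup"
    "HOL-Computational_Algebra.Computational_Algebra"
begin

section \<open>Algebras over a field\<close>

text \<open>
  An algebra structure over a field on a ring type is given by its structure map \<open>j\<close>,
  a ring homomorphism with central image; scalars act by \<open>j c * a\<close>.  The algebras whose
  invariants are compared below are subsets of such ring types.
\<close>

definition algebra_map :: "('k::field \<Rightarrow> 'a::ring_1) \<Rightarrow> bool" where
  "algebra_map j \<longleftrightarrow> j 1 = 1 \<and> (\<forall>x y. j (x + y) = j x + j y) \<and> (\<forall>x y. j (x * y) = j x * j y)
     \<and> (\<forall>c a. j c * a = a * j c)"

definition scale_by :: "('k::field \<Rightarrow> 'a::ring_1) \<Rightarrow> 'k \<Rightarrow> 'a \<Rightarrow> 'a" where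
  "scale_by j c a = j c * a"

lemma vector_space_scale_by:
  assumes "algebra_map j"
  shows "vector_space (scale_by j)"
proof -
  have j: "j 1 = 1" "\<And>x y. j (x + y) = j x + j y" "\<And>x y. j (x * y) = j x * j y"
    using assms unfolding algebra_map_def by blast+
  show ?thesis
    by unfold_locales (simp_all add: scale_by_def j distrib_left distrib_right mult.assoc)
qed

definition span_over :: "('k::field \<Rightarrow> 'a::ring_1) \<Rightarrow> 'a set \<Rightarrow> 'a set" where
  "span_over j = module.span (scale_by j)"

definition dim_over :: "('k::field \<Rightarrow> 'a::ring_1) \<Rightarrow> 'a set \<Rightarrow> nat" where
  "dim_over j = vector_space.dim (scale_by j)"

definition fd_subspace :: "('k::field \<Rightarrow> 'a::ring_1) \<Rightarrow> 'a set \<Rightarrow> bool" where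
  "fd_subspace j V \<longleftrightarrow> (\<exists>B. finite B \<and> V = span_over j B)"

definition center_of :: "'a::ring_1 set \<Rightarrow> 'a set" where
  "center_of F = {z \<in> F. \<forall>x\<in>F. z * x = x * z}"

definition is_subring :: "'a::ring_1 set \<Rightarrow> bool" where
  "is_subring A \<longleftrightarrow> 1 \<in> A \<and> (\<forall>a\<in>A. \<forall>b\<in>A. a - b \<in> A \<and> a * b \<in> A)"

definition is_subfield :: "'a::field set \<Rightarrow> bool" where
  "is_subfield A \<longleftrightarrow> is_subring A \<and> (\<forall>a\<in>A. inverse a \<in> A)"

definition fg_field_over :: "('k::field \<Rightarrow> 'K::field) \<Rightarrow> bool" where
  "fg_field_over \<iota> \<longleftrightarrow> (\<exists>S. finite S \<and> is_subfield hull (range \<iota> \<union> S) = UNIV)"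

text \<open>
  \<open>\<kappa>\<close> exhibits the division ring \<open>'d\<close> as a central, finite dimensional division algebra over
  \<open>'K\<close>; its dimension is a square, whose root is the degree.
\<close>

definition central_division_algebra :: "('K::field \<Rightarrow> 'd::division_ring) \<Rightarrow> bool" where
  "central_division_algebra \<kappa> \<longleftrightarrow>
     algebra_map \<kappa> \<and> range \<kappa> = center_of UNIV \<and> fd_subspace \<kappa> UNIV"

definition algebra_degree :: "('K::field \<Rightarrow> 'd::division_ring) \<Rightarrow> nat" where
  "algebra_degree \<kappa> = (THE n. n\<^sup>2 = dim_over \<kappa> UNIV)"


section \<open>Gelfand-Kirillov, lower transcendence and transcendence degree\<close>

text \<open>\<open>log_dim n m\<close> is the base \<open>n\<close> logarithm of \<open>m\<close>, with logarithm \<open>-\<infinity>\<close> at \<open>0\<close>.\<close>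

definition log_dim :: "nat \<Rightarrow> nat \<Rightarrow> ereal" where
  "log_dim n m = (if m = 0 then -\<infinity> else ereal (log (real n) (real m)))"

definition power_span :: "('k::field \<Rightarrow> 'a::ring_1) \<Rightarrow> 'a set \<Rightarrow> nat \<Rightarrow> 'a set" where
  "power_span j V n = span_over j {prod_list vs | vs. set vs \<subseteq> V \<and> length vs = n}"

definition growth :: "('k::field \<Rightarrow> 'a::ring_1) \<Rightarrow> 'a set \<Rightarrow> ereal" where
  "growth j V = limsup (\<lambda>n. log_dim n (dim_over j (power_span j V n)))"

definition GKdim :: "('k::field \<Rightarrow> 'a::ring_1) \<Rightarrow> 'a set \<Rightarrow> ereal" where
  "GKdim j A = (SUP V\<in>{V. fd_subspace j V \<and> V \<subseteq> A}. growth j V)"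

definition regular_elements :: "'a::ring_1 set \<Rightarrow> 'a set" where
  "regular_elements A = {b \<in> A. \<forall>x\<in>A. (b * x = 0 \<longrightarrow> x = 0) \<and> (x * b = 0 \<longrightarrow> x = 0)}"

definition Ld :: "('k::field \<Rightarrow> 'a::ring_1) \<Rightarrow> 'a set \<Rightarrow> ereal" where
  "Ld j A = (SUP V\<in>{V. fd_subspace j V \<and> V \<subseteq> A}. INF b\<in>regular_elements A.
     growth j {j c + b * v | c v. v \<in> V})"

text \<open>
  Algebraic independence of a finite sequence of commuting elements: the monomials in it,
  indexed by exponent vectors, are linearly independent.  Products are taken in list order,
  because the ambient ring need not be commutative.
\<close>

definition monomial :: "'a::ring_1 list \<Rightarrow> nat list \<Rightarrow> 'a" where
  "monomial xs e = prod_list (map2 (^) xs e)"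

definition alg_independent :: "('k::field \<Rightarrow> 'a::ring_1) \<Rightarrow> 'a list \<Rightarrow> bool" where
  "alg_independent j xs \<longleftrightarrow>
     (\<forall>E c. finite E \<and> E \<subseteq> {e. length e = length xs} \<and> (\<Sum>e\<in>E. j (c e) * monomial xs e) = 0
        \<longrightarrow> (\<forall>e\<in>E. c e = 0))"

text \<open>
  The transcendence degree of the centre of a division ring \<open>F\<close>.  For commutative \<open>F\<close> this is
  the transcendence degree of \<open>F\<close>.
\<close>

definition trdeg :: "('k::field \<Rightarrow> 'a::division_ring) \<Rightarrow> 'a set \<Rightarrow> ereal" where
  "trdeg j F = (SUP xs\<in>{xs. set xs \<subseteq> center_of F \<and> alg_independent j xs}. ereal (real (length xs)))"


section \<open>Varieties with a given function field\<close>

text \<open>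
  Integral separated schemes of finite type over \<open>'k\<close> with function field \<open>'K\<close> are treated in
  the language of Zariski and Chevalley (EGA I, section 8; Zariski-Samuel, chapter VI, section 17):
  such a scheme is the set of its local rings, which are subrings of \<open>'K\<close>.  All scheme points
  are included; the generic point is the local ring \<open>UNIV\<close>.
\<close>

definition max_ideal :: "'K::field set \<Rightarrow> 'K set" where
  "max_ideal P = {a \<in> P. a = 0 \<or> inverse a \<notin> P}"

definition local_subring :: "'K::field set \<Rightarrow> bool" where
  "local_subring P \<longleftrightarrow> is_subring P \<and> (\<forall>a\<in>max_ideal P. \<forall>b\<in>max_ideal P. a + b \<in> max_ideal P)"

definition dominates :: "'K::field set \<Rightarrow> 'K set \<Rightarrow> bool" where
  "dominates R P \<longleftrightarrow> P \<subseteq> R \<and> max_ideal P \<subseteq> max_ideal R"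

definition prime_ideal_of :: "'K::field set \<Rightarrow> 'K set \<Rightarrow> bool" where
  "prime_ideal_of A I \<longleftrightarrow> I \<subseteq> A \<and> 0 \<in> I \<and> 1 \<notin> I \<and> (\<forall>a\<in>I. \<forall>b\<in>I. a + b \<in> I)
     \<and> (\<forall>a\<in>A. \<forall>b\<in>I. a * b \<in> I) \<and> (\<forall>a\<in>A. \<forall>b\<in>A. a * b \<in> I \<longrightarrow> a \<in> I \<or> b \<in> I)"

definition localization :: "'K::field set \<Rightarrow> 'K set \<Rightarrow> 'K set" where
  "localization A I = {a / s | a s. a \<in> A \<and> s \<in> A - I}"

definition Spec :: "'K::field set \<Rightarrow> 'K set set" where
  "Spec A = localization A ` {I. prime_ideal_of A I}"

definition fg_subalgebra :: "('k::field \<Rightarrow> 'K::field) \<Rightarrow> 'K set \<Rightarrow> bool" where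
  "fg_subalgebra \<iota> A \<longleftrightarrow> (\<exists>S. finite S \<and> A = is_subring hull (range \<iota> \<union> S))"

definition has_fraction_field_UNIV :: "'K::field set \<Rightarrow> bool" where
  "has_fraction_field_UNIV A \<longleftrightarrow> (\<forall>x. \<exists>a\<in>A. \<exists>b\<in>A. b \<noteq> 0 \<and> x = a / b)"

text \<open>
  Separatedness is Chevalley's condition: two local rings of the scheme that are dominated by
  a common local subring of the function field coincide.
\<close>

definition variety :: "('k::field \<Rightarrow> 'K::field) \<Rightarrow> 'K set set \<Rightarrow> bool" where
  "variety \<iota> X \<longleftrightarrow>
     (\<exists>\<A>. finite \<A> \<and> \<A> \<noteq> {} \<and> (\<forall>A\<in>\<A>. fg_subalgebra \<iota> A \<and> has_fraction_field_UNIV A)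
        \<and> X = \<Union> (Spec ` \<A>))
     \<and> (\<forall>P\<in>X. \<forall>Q\<in>X. \<forall>R. local_subring R \<and> dominates R P \<and> dominates R Q \<longrightarrow> P = Q)"

definition valuation_ring_over :: "('k::field \<Rightarrow> 'K::field) \<Rightarrow> 'K set \<Rightarrow> bool" where
  "valuation_ring_over \<iota> R \<longleftrightarrow>
     is_subring R \<and> range \<iota> \<subseteq> R \<and> (\<forall>x. x \<noteq> 0 \<longrightarrow> x \<in> R \<or> inverse x \<in> R)"

text \<open>
  A proper variety is a complete model in the sense of Zariski: every valuation ring of the
  function field over \<open>'k\<close> has a centre.
\<close>

definition proper_variety :: "('k::field \<Rightarrow> 'K::field) \<Rightarrow> 'K set set \<Rightarrow> bool" where
  "proper_variety \<iota> X \<longleftrightarrow>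
     variety \<iota> X \<and> (\<forall>R. valuation_ring_over \<iota> R \<longrightarrow> (\<exists>P\<in>X. dominates R P))"

definition integral_over :: "'K::field set \<Rightarrow> 'K \<Rightarrow> bool" where
  "integral_over P a \<longleftrightarrow> (\<exists>p. lead_coeff p = 1 \<and> (\<forall>i. coeff p i \<in> P) \<and> poly p a = 0)"

definition normal_scheme :: "'K::field set set \<Rightarrow> bool" where
  "normal_scheme X \<longleftrightarrow> (\<forall>P\<in>X. \<forall>a. integral_over P a \<longrightarrow> a \<in> P)"

text \<open>
  A base of the Zariski topology consists of the loci where finitely many rational functions
  are defined.  Any two nonempty open sets meet, so a subsheaf of a constant sheaf
  is determined by its sections over nonempty open sets, with inclusions as restrictions;
  only these are considered below.
\<close>

definition nonempty_open :: "'K::field set set \<Rightarrow> 'K set set \<Rightarrow> bool" where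
  "nonempty_open X U \<longleftrightarrow> U \<noteq> {} \<and> U \<subseteq> X
     \<and> (\<forall>P\<in>U. \<exists>E. finite E \<and> E \<subseteq> P \<and> {Q \<in> X. E \<subseteq> Q} \<subseteq> U)"

definition structure_sheaf :: "'K::field set set \<Rightarrow> 'K set" where
  "structure_sheaf U = \<Inter> U"


section \<open>Cartier divisors\<close>

text \<open>
  A Cartier divisor is a global section of the quotient of the sheaf of nonzero rational
  functions by the sheaf of invertible regular functions, given by a system of local
  equations \<open>(U, f)\<close>.
\<close>

definition cartier_divisor :: "'K::field set set \<Rightarrow> ('K set set \<times> 'K) set \<Rightarrow> bool" where
  "cartier_divisor X D \<longleftrightarrow>
     (\<forall>(U, f)\<in>D. nonempty_open X U \<and> f \<noteq> 0) \<and> \<Union> (fst ` D) = X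
     \<and> (\<forall>(U, f)\<in>D. \<forall>(V, g)\<in>D. f / g \<in> structure_sheaf (U \<inter> V))"

definition divisor_mult :: "nat \<Rightarrow> ('K::field set set \<times> 'K) set \<Rightarrow> ('K set set \<times> 'K) set" where
  "divisor_mult l D = (\<lambda>(U, f). (U, f ^ l)) ` D"

text \<open>The subsheaf of the constant sheaf \<open>'K\<close> generated over \<open>V\<close> by \<open>1 / f\<close>, for \<open>(V, f)\<close> in \<open>D\<close>.\<close>

definition divisor_sheaf :: "('K::field set set \<times> 'K) set \<Rightarrow> 'K set set \<Rightarrow> 'K set" where
  "divisor_sheaf D U = {s. \<forall>(V, f)\<in>D. s * f \<in> structure_sheaf (U \<inter> V)}"


section \<open>Orders\<close>

text \<open>
  Here \<open>X\<close> is a variety with function field \<open>'K\<close> and \<open>\<kappa> :: 'K \<Rightarrow> 'd\<close> a central division algebra.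
  A torsion free sheaf with generic fibre \<open>'d\<close> embeds into the constant sheaf \<open>'d\<close>, so orders are
  taken to be subsheaves of it.
\<close>

definition sheaf_of_algebras ::
  "'K::field set set \<Rightarrow> ('K \<Rightarrow> 'd::division_ring) \<Rightarrow> ('K set set \<Rightarrow> 'd set) \<Rightarrow> bool" where
  "sheaf_of_algebras X \<kappa> \<Lambda> \<longleftrightarrow>
     (\<forall>U. nonempty_open X U \<longrightarrow> is_subring (\<Lambda> U)
        \<and> (\<forall>f\<in>structure_sheaf U. \<forall>a\<in>\<Lambda> U. \<kappa> f * a \<in> \<Lambda> U))
     \<and> (\<forall>U V. nonempty_open X U \<and> nonempty_open X V \<and> V \<subseteq> U \<longrightarrow> \<Lambda> U \<subseteq> \<Lambda> V)
     \<and> (\<forall>\<U>. \<U> \<noteq> {} \<and> (\<forall>U\<in>\<U>. nonempty_open X U) \<longrightarrow> (\<Inter>U\<in>\<U>. \<Lambda> U) \<subseteq> \<Lambda> (\<Union> \<U>))"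

definition fg_module :: "('K::field \<Rightarrow> 'd::division_ring) \<Rightarrow> 'K set \<Rightarrow> 'd set \<Rightarrow> bool" where
  "fg_module \<kappa> A M \<longleftrightarrow>
     (\<exists>G. finite G \<and> M = {\<Sum>g\<in>G. \<kappa> (c g) * g | c. \<forall>g\<in>G. c g \<in> A})"

text \<open>
  Localization of an \<open>A\<close>-submodule of \<open>'d\<close> at the point \<open>P\<close> of \<open>Spec A\<close>: the elements of \<open>A\<close>
  outside the corresponding prime ideal are those that become invertible in \<open>P\<close>.
\<close>

definition localized_module ::
  "('K::field \<Rightarrow> 'd::division_ring) \<Rightarrow> 'K set \<Rightarrow> 'd set \<Rightarrow> 'K set \<Rightarrow> 'd set" where
  "localized_module \<kappa> A M P =
     {\<kappa> (inverse s) * m | s m. s \<in> A \<and> s \<noteq> 0 \<and> inverse s \<in> P \<and> m \<in> M}"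

text \<open>On an affine open cover, \<open>\<Lambda>\<close> is the sheaf associated to a finitely generated module.\<close>

definition coherent_sheaf ::
  "('k::field \<Rightarrow> 'K::field) \<Rightarrow> 'K set set \<Rightarrow> ('K \<Rightarrow> 'd::division_ring)
     \<Rightarrow> ('K set set \<Rightarrow> 'd set) \<Rightarrow> bool" where
  "coherent_sheaf \<iota> X \<kappa> \<Lambda> \<longleftrightarrow>
     (\<forall>P\<in>X. \<exists>A M. fg_subalgebra \<iota> A \<and> has_fraction_field_UNIV A \<and> P \<in> Spec A \<and> Spec A \<subseteq> X
        \<and> fg_module \<kappa> A M
        \<and> (\<forall>U. nonempty_open X U \<and> U \<subseteq> Spec A \<longrightarrow> \<Lambda> U = (\<Inter>Q\<in>U. localized_module \<kappa> A M Q)))"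

definition order_in ::
  "('k::field \<Rightarrow> 'K::field) \<Rightarrow> 'K set set \<Rightarrow> ('K \<Rightarrow> 'd::division_ring)
     \<Rightarrow> ('K set set \<Rightarrow> 'd set) \<Rightarrow> bool" where
  "order_in \<iota> X \<kappa> \<Lambda> \<longleftrightarrow> sheaf_of_algebras X \<kappa> \<Lambda> \<and> coherent_sheaf \<iota> X \<kappa> \<Lambda>
     \<and> (\<Union>U\<in>{U. nonempty_open X U}. \<Lambda> U) = UNIV"

definition maximal_order ::
  "('k::field \<Rightarrow> 'K::field) \<Rightarrow> 'K set set \<Rightarrow> ('K \<Rightarrow> 'd::division_ring)
     \<Rightarrow> ('K set set \<Rightarrow> 'd set) \<Rightarrow> bool" where
  "maximal_order \<iota> X \<kappa> \<Lambda> \<longleftrightarrow> order_in \<iota> X \<kappa> \<Lambda>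
     \<and> (\<forall>\<Gamma>. order_in \<iota> X \<kappa> \<Gamma> \<and> (\<forall>U. nonempty_open X U \<longrightarrow> \<Lambda> U \<subseteq> \<Gamma> U)
          \<longrightarrow> (\<forall>U. nonempty_open X U \<longrightarrow> \<Gamma> U = \<Lambda> U))"

text \<open>
  The tensor product of a divisorial invertible sheaf \<open>L\<close> with an order \<open>\<Lambda>\<close> over the structure
  sheaf.  Since \<open>L\<close> is flat, the tensor product embeds into \<open>'d\<close>, the tensor product of \<open>L\<close> with
  the constant sheaf \<open>'d\<close>; its image is the sheaf of elements that are locally sums of products.
\<close>

definition sums_of_products ::
  "('K::field \<Rightarrow> 'd::division_ring) \<Rightarrow> 'K set \<Rightarrow> 'd set \<Rightarrow> 'd set" where
  "sums_of_products \<kappa> S M = {sum_list (map (\<lambda>(s, a). \<kappa> s * a) ps) | ps. set ps \<subseteq> S \<times> M}"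

definition tensor_sheaf ::
  "'K::field set set \<Rightarrow> ('K \<Rightarrow> 'd::division_ring) \<Rightarrow> ('K set set \<Rightarrow> 'K set)
     \<Rightarrow> ('K set set \<Rightarrow> 'd set) \<Rightarrow> 'K set set \<Rightarrow> 'd set" where
  "tensor_sheaf X \<kappa> L \<Lambda> U =
     {d. \<forall>P\<in>U. \<exists>V. nonempty_open X V \<and> P \<in> V \<and> V \<subseteq> U \<and> d \<in> sums_of_products \<kappa> (L V) (\<Lambda> V)}"


section \<open>Section rings and their degree zero fractions\<close>

text \<open>
  Section rings are graded subrings of the polynomial rings in one central variable over
  \<open>'K\<close> and \<open>'d\<close>, represented by \<open>nat \<Rightarrow>\<^sub>0 'K\<close> and \<open>nat \<Rightarrow>\<^sub>0 'd\<close> with the convolution product.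
\<close>

definition section_ring ::
  "'K::field set set \<Rightarrow> ('K set set \<times> 'K) set \<Rightarrow> (nat \<Rightarrow>\<^sub>0 'K) set" where
  "section_ring X D = {p. \<forall>l. Poly_Mapping.lookup p l \<in> divisor_sheaf (divisor_mult l D) X}"

definition order_section_ring ::
  "'K::field set set \<Rightarrow> ('K \<Rightarrow> 'd::division_ring) \<Rightarrow> ('K set set \<Rightarrow> 'd set)
     \<Rightarrow> ('K set set \<times> 'K) set \<Rightarrow> (nat \<Rightarrow>\<^sub>0 'd) set" where
  "order_section_ring X \<kappa> \<Lambda> D =
     {p. \<forall>l. Poly_Mapping.lookup p l \<in> tensor_sheaf X \<kappa> (divisor_sheaf (divisor_mult l D)) \<Lambda> X}"

text \<open>
  The quotient of homogeneous elements \<open>single l s\<close> and \<open>single l a\<close> of the same degree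
  is the element \<open>inverse s * a\<close> of the division ring of coefficients.
\<close>

definition degree_zero_fractions :: "(nat \<Rightarrow>\<^sub>0 'a::division_ring) set \<Rightarrow> 'a set" where
  "degree_zero_fractions R =
     {inverse s * a | s a l. s \<noteq> 0 \<and> Poly_Mapping.single l s \<in> R \<and> Poly_Mapping.single l a \<in> R}"

definition const_map :: "('k \<Rightarrow> 'a::ring_1) \<Rightarrow> 'k \<Rightarrow> (nat \<Rightarrow>\<^sub>0 'a)" where
  "const_map j c = Poly_Mapping.single 0 (j c)"

end

theory Submission
  imports
    "HOL-Algebra.Algebraic_Closure_Type"
    "Jordan_Normal_Form.Char_Poly"
    Defs
begin

text \<open>
  Write \<open>R\<close> and \<open>S\<close> for the section rings of \<open>D\<close> and of \<open>\<Lambda>\<close>, and \<open>F\<close> and \<open>\<Delta>\<close> for their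
  degree zero fractions.  Choosing homogeneous elements whose degrees differ by the least possible
  \<open>e\<close> gives \<open>u\<close> such that \<open>R\<close> consists of polynomials in \<open>u t\<^sup>e\<close> over \<open>F\<close>, so its growth exceeds
  that of finite subsets of \<open>F\<close> by one.  By normality, the minimal polynomial over \<open>'K\<close> of a section
  of degree \<open>l\<close> of \<open>S\<close> has its coefficients in \<open>R\<close>, the \<open>i\<close>-th one in degree \<open>i l\<close>.  Hence the
  denominators in \<open>\<Delta>\<close> can be taken in \<open>R\<close>, and every element of \<open>\<Delta>\<close> is algebraic over
  the central subfield \<open>F\<close>.  As a division subring of \<open>'d\<close>, \<open>\<Delta>\<close> is finite over its centre, so a finite
  subset of \<open>\<Delta>\<close> grows no faster than the polynomials in a transcendence basis of \<open>F\<close>.  Conversely,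
  for algebraically independent central \<open>x\<^sub>1, \<dots>, x\<^sub>d\<close> in \<open>V\<close> and regular \<open>b\<close>, the power
  \<open>(k + b V)\<^sup>n\<close> contains \<open>b\<^sup>n\<close> times all monomials of degree at most \<open>n\<close>, so that \<open>Ld\<close> is
  bounded below by the transcendence degree of the centre.
\<close>

(* Otherwise a bare X is parsed as the indeterminate of HOL-Algebra polynomials. *)
no_notation var (\<open>X\<index>\<close>)

section \<open>Spans over commuting subsets of a ring\<close>

text \<open>Taking b = 1 gives Ld \<le> GKdim, so the estimates close up: trdeg F \<le> trdeg
  \<Delta> \<le> Ld \<Delta> \<le> GKdim \<Delta> \<le> trdeg F, and trdeg F + 1 \<le> Ld R \<le>
  GKdim R \<le> trdeg F + 1. A transcendence basis is an independent list of greatest length; if the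
  lengths are unbounded, the upper bounds are trivial. Algebraicity over \<open>F\<close> is
  obtained element by element, and the coefficient fields are mere subsets of a noncommutative
  division ring. Linear algebra over them is therefore phrased through \<open>lspan G W\<close>, the
  sums of c * w with c in an arbitrary set \<open>G\<close>: a finite set acts on finitely many
  generators with finitely many coefficients, and only these have to be adjoined to the smaller
  field. The centre of \<Delta> may exceed the image of \<open>F\<close>, whence two descents.
  Minimal polynomials act as a substitute for reduced norms: a nonzero homogeneous \<open>s\<close>
  divides the constant term of its minimal polynomial, a nonzero scalar, and the quotient is
  homogeneous.\<close>

inductive_set lspan :: "'a::ring_1 set \<Rightarrow> 'a set \<Rightarrow> 'a set" for G W where
  zero: "0 \<in> lspan G W"
| step: "c \<in> G \<Longrightarrow> w \<in> W \<Longrightarrow> x \<in> lspan G W \<Longrightarrow> c * w + x \<in> lspan G W"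

lemma lspan_mono: "x \<in> lspan G W \<Longrightarrow> G \<subseteq> G' \<Longrightarrow> W \<subseteq> W' \<Longrightarrow> x \<in> lspan G' W'"
  by (induction rule: lspan.induct) (auto intro: lspan.intros)

lemma lspan_scaled: "c \<in> G \<Longrightarrow> w \<in> W \<Longrightarrow> c * w \<in> lspan G W"
  using lspan.step[OF _ _ lspan.zero] by fastforce

lemma lspan_base: "1 \<in> G \<Longrightarrow> w \<in> W \<Longrightarrow> w \<in> lspan G W"
  using lspan_scaled[of 1 G w W] by simp

lemma lspan_add: "x \<in> lspan G W \<Longrightarrow> y \<in> lspan G W \<Longrightarrow> x + y \<in> lspan G W"
  by (induction rule: lspan.induct) (auto simp: add.assoc intro: lspan.intros)

lemma lspan_sum: "(\<And>i. i \<in> I \<Longrightarrow> f i \<in> lspan G W) \<Longrightarrow> sum f I \<in> lspan G W"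
  by (induction I rule: infinite_finite_induct) (auto intro: lspan.zero lspan_add)

lemma lspan_mult_left:
  assumes "x \<in> lspan G W" "\<And>g w. g \<in> G \<Longrightarrow> w \<in> W \<Longrightarrow> v * (g * w) \<in> lspan G' W'"
  shows "v * x \<in> lspan G' W'"
  using assms(1) by induction (auto simp: distrib_left intro: lspan.zero lspan_add assms(2))

lemma lspan_mult_right:
  assumes "x \<in> lspan G W" "\<And>g w. g \<in> G \<Longrightarrow> w \<in> W \<Longrightarrow> g * w * v \<in> lspan G' W'"
  shows "x * v \<in> lspan G' W'"
  using assms(1) by induction (auto simp: distrib_right intro: lspan.zero lspan_add assms(2))

lemma lspan_scale:
  assumes "x \<in> lspan G W" "\<forall>a\<in>G. \<forall>b\<in>G. a * b \<in> G" "g \<in> G"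
  shows "g * x \<in> lspan G W"
  by (rule lspan_mult_left[OF assms(1)])
    (use assms in \<open>auto simp: mult.assoc[symmetric] intro!: lspan_scaled\<close>)

text \<open>Descent to a smaller coefficient set rests on this finiteness: the coefficients that
  occur can be adjoined one at a time.\<close>

lemma lspan_finite_coeffs:
  assumes "x \<in> lspan G W"
  shows "\<exists>S. finite S \<and> S \<subseteq> G \<and> x \<in> lspan S W"
  using assms
proof induction
  case zero
  show ?case by (rule exI[of _ "{}"]) (auto intro: lspan.zero)
next
  case (step c w x)
  then obtain S where "finite S" "S \<subseteq> G" "x \<in> lspan S W" by blast
  with step show ?case
    by (intro exI[of _ "insert c S"])
      (auto intro: lspan.step lspan_mono[of x S W "insert c S" W])
qed

text \<open>Grouping the terms by \<open>w\<close> adds coefficients, hence the closure of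
  \<open>G\<close> under addition. The outcome is a matrix row over \<open>G\<close>, as the
  determinant trick needs it.\<close>

lemma lspan_coeffs:
  assumes "x \<in> lspan G W" "finite W" "0 \<in> G" "\<forall>a\<in>G. \<forall>b\<in>G. a + b \<in> G"
  shows "\<exists>c. (\<forall>w. c w \<in> G) \<and> x = (\<Sum>w\<in>W. c w * w)"
  using assms(1)
proof induction
  case zero
  show ?case by (rule exI[of _ "\<lambda>_. 0"]) (use assms in auto)
next
  case (step a w x)
  then obtain c where c: "\<forall>w. c w \<in> G" "x = (\<Sum>w\<in>W. c w * w)" by blast
  have "a * w + x = (\<Sum>u\<in>W. (if u = w then a * u else 0) + c u * u)"
    using step assms(2) unfolding c sum.distrib by (simp add: sum.delta)
  also have "\<dots> = (\<Sum>u\<in>W. ((if u = w then a else 0) + c u) * u)"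
    by (intro sum.cong) (auto simp: distrib_right)
  finally show ?case
    using step c(1) assms(3,4) by (intro exI[of _ "\<lambda>u. (if u = w then a else 0) + c u"]) auto
qed

lemma finite_union_cover:
  assumes "finite I" "\<And>i. i \<in> I \<Longrightarrow> \<exists>S. finite S \<and> S \<subseteq> G \<and> P i S"
    "\<And>i S S'. P i S \<Longrightarrow> S \<subseteq> S' \<Longrightarrow> P i S'"
  shows "\<exists>S. finite S \<and> S \<subseteq> G \<and> (\<forall>i\<in>I. P i S)"
proof -
  obtain S where "\<And>i. i \<in> I \<Longrightarrow> finite (S i) \<and> S i \<subseteq> G \<and> P i (S i)"
    using assms(2) by metis
  then have S: "\<And>i. i \<in> I \<Longrightarrow> finite (S i)" "\<And>i. i \<in> I \<Longrightarrow> S i \<subseteq> G" "\<And>i. i \<in> I \<Longrightarrow> P i (S i)"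
    by auto
  have "P i (\<Union>(S ` I))" if "i \<in> I" for i
    by (rule assms(3)[OF S(3)[OF that]]) (use that in blast)
  with assms(1) S(1,2) show ?thesis
    by (intro exI[of _ "\<Union>(S ` I)"]) auto
qed


section \<open>Algebraic elements\<close>

definition algebraic_on :: "'a::ring_1 set \<Rightarrow> 'a \<Rightarrow> bool" where
  "algebraic_on Q y \<longleftrightarrow> (\<exists>h q. (\<forall>i<h. q i \<in> Q) \<and> y ^ h = (\<Sum>i<h. q i * y ^ i))"

text \<open>Here \<open>lspan Q A\<close> plays the role of Q[S]. Adjoining \<open>s\<close> with a
  relation of degree \<open>h\<close> multiplies \<open>A\<close> by the powers of \<open>s\<close>
  below \<open>h\<close>; the only product leaving this range has exponent \<open>h\<close>, and the
  relation brings it back. Commutativity of \<open>G\<close> moves the coefficients to the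
  left.\<close>

lemma finite_extension:
  fixes G :: "'a::ring_1 set"
  assumes "finite S" "S \<subseteq> G" "1 \<in> G" "\<forall>a\<in>G. \<forall>b\<in>G. a * b \<in> G \<and> a * b = b * a"
    and "Q \<subseteq> G" "1 \<in> Q" "\<forall>a\<in>Q. \<forall>b\<in>Q. a * b \<in> Q" "\<And>s. s \<in> S \<Longrightarrow> algebraic_on Q s"
  shows "\<exists>A. finite A \<and> A \<subseteq> G \<and> 1 \<in> A \<and> (\<forall>s\<in>S. \<forall>a\<in>A. s * a \<in> lspan Q A)"
  using assms(1,2,8)
proof (induction S)
  case empty
  show ?case by (rule exI[of _ "{1}"]) (use assms(3) in auto)
next
  case (insert s S)
  then obtain A where A: "finite A" "A \<subseteq> G" "1 \<in> A" "\<forall>t\<in>S. \<forall>a\<in>A. t * a \<in> lspan Q A" by auto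
  obtain h q where q: "\<forall>i<h. q i \<in> Q" and h: "s ^ h = (\<Sum>i<h. q i * s ^ i)"
    using insert.prems unfolding algebraic_on_def by blast
  have comm: "a * b = b * a" if "a \<in> G" "b \<in> G" for a b using that assms(4) by blast
  have pw: "s ^ i \<in> G" for i
    by (induction i) (use insert.prems assms(3,4) in auto)
  define A' where "A' = (\<lambda>(a, i). a * s ^ i) ` (A \<times> {..<h})"
  have in_A': "a * s ^ i \<in> lspan Q A'" if "a \<in> A" "i < h" for a i
    using that unfolding A'_def by (intro lspan_base assms(6)) auto
  have old: "t * b \<in> lspan Q A'" if t: "t \<in> S" and b: "b \<in> A'" for t b
  proof -
    obtain a i where b': "b = a * s ^ i" "a \<in> A" "i < h" using b unfolding A'_def by auto
    have "t * a * s ^ i \<in> lspan Q A'"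
      by (rule lspan_mult_right[of _ Q A])
        (use t A(4) b' in \<open>auto simp: mult.assoc A'_def intro!: lspan_scaled\<close>)
    then show ?thesis using b' by (simp add: mult.assoc)
  qed
  have new: "s * b \<in> lspan Q A'" if b: "b \<in> A'" for b
  proof -
    obtain a i where b': "b = a * s ^ i" "a \<in> A" "i < h" using b unfolding A'_def by auto
    have aG: "a \<in> G" using b' A(2) by auto
    have eq: "s * b = a * s ^ Suc i"
      using comm[of s a] aG insert.prems(1) by (simp add: b' mult.assoc[symmetric])
    show ?thesis
    proof (cases "Suc i < h")
      case True
      then show ?thesis using in_A'[OF b'(2) True] eq by simp
    next
      case False
      then have "s * b = (\<Sum>j<h. a * (q j * s ^ j))"
        using b'(3) eq h by (metis Suc_lessI sum_distrib_left)
      also have "\<dots> = (\<Sum>j<h. q j * (a * s ^ j))"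
      proof (intro sum.cong refl)
        fix j assume "j \<in> {..<h}"
        then have "a * q j = q j * a" using q aG assms(5) by (intro comm) auto
        then show "a * (q j * s ^ j) = q j * (a * s ^ j)" by (simp add: mult.assoc[symmetric])
      qed
      also have "\<dots> \<in> lspan Q A'"
        using q b'(2) by (intro lspan_sum lspan_scaled) (auto simp: A'_def)
      finally show ?thesis .
    qed
  qed
  have one: "1 \<in> A' \<or> h = 0" using A(3) unfolding A'_def by force
  show ?case
  proof (cases "h = 0")
    case True
    \<comment> \<open>A relation of degree 0 reads 1 = 0, so the ring is trivial; \<open>A'\<close>
      is empty in this case and {1} replaces it.\<close>
    then have z: "(x::'a) = 0" for x using h by (metis lessThan_0 mult_1 mult_zero_left power_0 sum.empty)
    show ?thesis
      by (rule exI[of _ "{1}"]) (use z assms(3) lspan.zero in \<open>metis finite.intros insertI1 insert_subset empty_subsetI\<close>)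
  next
    case False
    have "a * b \<in> G" if "a \<in> G" "b \<in> G" for a b using that assms(4) by blast
    then have "A' \<subseteq> G"
      using A(2) pw unfolding A'_def by auto
    moreover have "finite A'" unfolding A'_def using A(1) by simp
    ultimately show ?thesis using one False old new by (intro exI[of _ A']) blast
  qed
qed

text \<open>Tower argument: the products b * w involve finitely many coefficients \<open>S\<close>,
  a finite set \<open>A\<close> absorbs these over \<open>Q\<close>, and the products of
  \<open>A\<close> with \<open>W\<close> generate the new module. As \<open>b\<close> commutes with
  \<open>A\<close>, b (a w) = a (b w).\<close>

lemma finite_module_descent:
  fixes G :: "'a::ring_1 set"
  assumes G: "1 \<in> G" "\<forall>a\<in>G. \<forall>b\<in>G. a * b \<in> G \<and> a * b = b * a"
    and Q: "Q \<subseteq> G" "1 \<in> Q" "\<forall>a\<in>Q. \<forall>b\<in>Q. a * b \<in> Q"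
    and alg: "\<And>y. y \<in> G \<Longrightarrow> algebraic_on Q y"
    and B: "finite B" "\<forall>b\<in>B. \<forall>g\<in>G. b * g = g * b"
    and W: "finite W" "1 \<in> W" "\<forall>b\<in>B. \<forall>w\<in>W. b * w \<in> lspan G W"
  shows "\<exists>W'. finite W' \<and> 1 \<in> W' \<and> (\<forall>b\<in>B. \<forall>w\<in>W'. b * w \<in> lspan Q W')"
proof -
  have "\<exists>S. finite S \<and> S \<subseteq> G \<and> (\<forall>p\<in>B\<times>W. fst p * snd p \<in> lspan S W)"
  proof (rule finite_union_cover)
    show "finite (B \<times> W)" using B(1) W(1) by simp
    show "\<exists>S. finite S \<and> S \<subseteq> G \<and> fst p * snd p \<in> lspan S W" if "p \<in> B \<times> W" for p
      by (rule lspan_finite_coeffs) (use that W(3) in auto)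
  qed (auto intro: lspan_mono)
  then obtain S where S: "finite S" "S \<subseteq> G" "\<And>b w. b \<in> B \<Longrightarrow> w \<in> W \<Longrightarrow> b * w \<in> lspan S W" by auto
  obtain A where A: "finite A" "A \<subseteq> G" "1 \<in> A" "\<forall>s\<in>S. \<forall>a\<in>A. s * a \<in> lspan Q A"
    using finite_extension[OF S(1,2) G Q] alg S(2) by blast
  define W' where "W' = (\<lambda>(a, w). a * w) ` (A \<times> W)"
  have "b * v \<in> lspan Q W'" if b: "b \<in> B" and v: "v \<in> W'" for b v
  proof -
    obtain a w where v': "v = a * w" "a \<in> A" "w \<in> W" using v unfolding W'_def by auto
    have "a * (b * w) \<in> lspan Q W'"
    proof (rule lspan_mult_left[OF S(3)[OF b v'(3)]])
      fix s u assume su: "s \<in> S" "u \<in> W"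
      have "s * a * u \<in> lspan Q W'"
        by (rule lspan_mult_right[of _ Q A])
          (use su v' A(4) in \<open>auto simp: mult.assoc W'_def intro!: lspan_scaled\<close>)
      moreover have "s * a = a * s" using su v' A(2) S(2) G by blast
      ultimately show "a * (s * u) \<in> lspan Q W'" by (simp add: mult.assoc)
    qed
    moreover have "b * a = a * b" using b v' A(2) B(2) by blast
    ultimately show ?thesis using v' by (metis mult.assoc)
  qed
  moreover have "1 \<in> W'" using A(3) W(2) unfolding W'_def by force
  ultimately show ?thesis using A(1) W(1) by (intro exI[of _ W']) (auto simp: W'_def)
qed

section \<open>Growth of subspaces\<close>

locale k_algebra =
  fixes j :: "'k::field \<Rightarrow> 'a::ring_1"
  assumes algebra_map: "algebra_map j"
begin

sublocale vector_space "scale_by j"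
  by (rule vector_space_scale_by[OF algebra_map])

lemma j_1: "j 1 = 1" and j_add: "j (x + y) = j x + j y" and j_mult: "j (x * y) = j x * j y"
  and j_central: "j c * a = a * j c"
  using algebra_map unfolding algebra_map_def by blast+

lemma j_0: "j 0 = 0"
  using j_add[of 0 0] by simp

lemma j_uminus: "j (- x) = - j x"
  using j_add[of x "- x"] j_0 by (simp add: eq_neg_iff_add_eq_0 add.commute)

lemma j_sum: "j (sum f I) = (\<Sum>i\<in>I. j (f i))"
  by (induction I rule: infinite_finite_induct) (auto simp: j_0 j_add)

lemma j_eq_0_iff: "(0::'a) \<noteq> 1 \<Longrightarrow> j c = 0 \<longleftrightarrow> c = 0"
  by (metis j_0 j_1 j_mult mult_zero_left right_inverse)

lemma span_over_eq: "span_over j = span" and dim_over_eq: "dim_over j = dim"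
  by (simp_all add: span_over_def dim_over_def)

lemma span_eq_lspan: "span S = lspan (range j) S"
proof
  show "span S \<subseteq> lspan (range j) S"
  proof
    fix x assume "x \<in> span S"
    then show "x \<in> lspan (range j) S"
    proof (induction rule: span_induct_alt)
      case base
      show ?case by (rule lspan.zero)
    next
      case (step c x y)
      then show ?case by (auto simp: scale_by_def intro: lspan.step)
    qed
  qed
  show "lspan (range j) S \<subseteq> span S"
  proof
    fix x assume "x \<in> lspan (range j) S"
    then show "x \<in> span S"
    proof induction
      case zero
      show ?case by (rule span_zero)
    next
      case (step c w x)
      then obtain a where a: "c = j a" by auto
      have "scale_by j a w + x \<in> span S"
        by (rule span_add[OF span_scale[OF span_base[OF step(2)]] step.IH])
      moreover have "scale_by j a w + x = c * w + x" by (simp add: a scale_by_def)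
      ultimately show ?case by metis
    qed
  qed
qed

lemma span_mult:
  assumes "x \<in> span S" "y \<in> span T" "\<And>s t. s \<in> S \<Longrightarrow> t \<in> T \<Longrightarrow> s * t \<in> span U"
  shows "x * y \<in> span U"
proof -
  have "s * y \<in> span U" if s: "s \<in> S" for s
    using assms(2)
  proof (induction rule: span_induct_alt)
    case base
    show ?case by (simp add: span_zero)
  next
    case (step c t z)
    have "s * (scale_by j c t + z) = scale_by j c (s * t) + s * z"
      unfolding scale_by_def distrib_left by (metis mult.assoc j_central)
    then show ?case using step assms(3)[OF s] by (simp add: span_add span_scale)
  qed
  with assms(1) show ?thesis
  proof (induction rule: span_induct_alt)
    case base
    show ?case by (simp add: span_zero)
  next
    case (step c t z)
    have "(scale_by j c t + z) * y = scale_by j c (t * y) + z * y"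
      by (simp add: scale_by_def distrib_right mult.assoc)
    then show ?case using step by (simp add: span_add span_scale)
  qed
qed

section \<open>Spans of n-fold products and the asymptotics of their dimensions\<close>

definition products :: "'a set \<Rightarrow> nat \<Rightarrow> 'a set" where
  "products V n = {prod_list vs | vs. set vs \<subseteq> V \<and> length vs = n}"

lemma products_0: "products V 0 = {1}"
  by (auto simp: products_def)

lemma products_Suc: "products V (Suc n) = {v * x | v x. v \<in> V \<and> x \<in> products V n}" (is "?L = ?R")
proof
  show "?L \<subseteq> ?R" by (fastforce simp: products_def length_Suc_conv)
  show "?R \<subseteq> ?L"
  proof
    fix y assume "y \<in> ?R"
    then obtain v vs where "v \<in> V" "set vs \<subseteq> V" "length vs = n" "y = v * prod_list vs"
      by (auto simp: products_def)
    then show "y \<in> ?L" unfolding products_def by (intro CollectI exI[of _ "v # vs"]) auto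
  qed
qed

lemma finite_products: "finite V \<Longrightarrow> finite (products V n)"
  by (induction n) (auto simp: products_0 products_Suc intro: finite_image_set2)

lemma power_span_eq: "power_span j V n = span (products V n)"
  by (simp add: power_span_def products_def span_over_eq)

lemma products_subset_span: "V \<subseteq> span B \<Longrightarrow> products V n \<subseteq> span (products B n)"
proof (induction n)
  case 0
  show ?case by (simp add: products_0 span_base)
next
  case (Suc n)
  show ?case
  proof
    fix y assume "y \<in> products V (Suc n)"
    then obtain v x where vx: "y = v * x" "v \<in> V" "x \<in> products V n"
      unfolding products_Suc by blast
    have "v * x \<in> span (products B (Suc n))"
    proof (rule span_mult)
      show "v \<in> span B" "x \<in> span (products B n)" using vx Suc by auto
      show "s * t \<in> span (products B (Suc n))" if "s \<in> B" "t \<in> products B n" for s t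
        by (rule span_base) (use that in \<open>auto simp: products_Suc\<close>)
    qed
    then show "y \<in> span (products B (Suc n))" using vx by simp
  qed
qed

lemma power_span_mono: "V \<subseteq> span B \<Longrightarrow> power_span j V n \<subseteq> power_span j B n"
  unfolding power_span_eq
  by (rule span_minimal[OF products_subset_span subspace_span])

lemma dim_power_span_le:
  assumes "power_span j V n \<subseteq> span T" "finite T"
  shows "dim_over j (power_span j V n) \<le> card T"
  unfolding dim_over_eq using assms by (rule dim_le_card)

text \<open>The dimension is the cardinality of a basis, which is 0 for an infinite set. The finite
  \<open>B\<close> guarantees a finite basis, so that cardinalities compare.\<close>

lemma card_le_dim_power_span:
  assumes "V \<subseteq> span B" "finite B" "T \<subseteq> power_span j V n" "independent T"
  shows "card T \<le> dim_over j (power_span j V n)"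
proof -
  let ?U = "power_span j V n"
  obtain C where C: "C \<subseteq> ?U" "independent C" "?U \<subseteq> span C" "card C = dim ?U"
    by (rule basis_exists)
  have "C \<subseteq> span (products B n)"
    using C(1) power_span_mono[OF assms(1)] power_span_eq by blast
  then have "finite C"
    using independent_span_bound[OF finite_products[OF assms(2)] C(2)] by blast
  then show ?thesis
    using independent_span_bound[of C T] assms(3,4) C(3,4) by (auto simp: dim_over_eq)
qed

lemma growth_le:
  assumes "\<And>n. \<exists>T. finite T \<and> card T \<le> C * (n + 1) ^ d \<and> power_span j V n \<subseteq> span T"
  shows "growth j V \<le> ereal (real d)"
proof -
  let ?a = "\<lambda>n. dim_over j (power_span j V n)"
  have bound: "?a n \<le> C * (n + 1) ^ d" for n
    using assms[of n] dim_power_span_le by (metis le_trans)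
  \<comment> \<open>The factor 2 ^ d comes from n + 1 \<le> 2 n, and \<open>C + 1\<close> keeps the
    constant positive when \<open>C\<close> = 0, so that its logarithm makes sense.\<close>
  let ?C = "real (C + 1) * 2 ^ d"
  have "log_dim n (?a n) \<le> ereal (ln ?C / ln (real n) + real d)" if n: "n \<ge> 2" for n
  proof (cases "?a n = 0")
    case True
    then show ?thesis by (simp add: log_dim_def)
  next
    case False
    have "real (?a n) \<le> real (C + 1) * (2 * real n) ^ d"
    proof -
      have "real (?a n) \<le> real (C * (n + 1) ^ d)" using bound of_nat_le_iff by blast
      also have "\<dots> = real C * (1 + real n) ^ d" by simp
      also have "\<dots> \<le> real (C + 1) * (2 * real n) ^ d"
        using n by (intro mult_mono power_mono) auto
      finally show ?thesis .
    qed
    then have "real (?a n) \<le> ?C * real n ^ d" by (simp add: power_mult_distrib mult.assoc)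
    then have "ln (real (?a n)) \<le> ln (?C * real n ^ d)"
      using False n by (subst ln_le_cancel_iff) auto
    also have "\<dots> = ln ?C + real d * ln (real n)"
      using n by (subst ln_mult) (auto simp: ln_realpow)
    finally have "ln (real (?a n)) / ln (real n) \<le> (ln ?C + real d * ln (real n)) / ln (real n)"
      using n by (intro divide_right_mono) auto
    also have "\<dots> = ln ?C / ln (real n) + real d"
      using n by (simp add: add_divide_distrib)
    finally show ?thesis using False by (simp add: log_dim_def log_def)
  qed
  then have ev: "eventually (\<lambda>n. log_dim n (?a n) \<le> ereal (ln ?C / ln (real n) + real d)) sequentially"
    unfolding eventually_sequentially by blast
  have "filterlim (\<lambda>n. ln (real n)) at_top sequentially"
    by (rule filterlim_compose[OF ln_at_top filterlim_real_sequentially])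
  then have "(\<lambda>n. ln ?C / ln (real n)) \<longlonglongrightarrow> 0"
    by (intro real_tendsto_divide_at_top[OF tendsto_const])
  then have "(\<lambda>n. ln ?C / ln (real n) + real d) \<longlonglongrightarrow> 0 + real d"
    by (intro tendsto_intros)
  then have "limsup (\<lambda>n. ereal (ln ?C / ln (real n) + real d)) = ereal (real d)"
    by (intro lim_imp_Limsup) auto
  then show ?thesis
    unfolding growth_def using Limsup_mono[OF ev] by simp
qed

lemma growth_ge:
  assumes "c > 0" "\<And>n. n \<ge> N \<Longrightarrow> c * real n ^ d \<le> real (dim_over j (power_span j V n))"
  shows "growth j V \<ge> ereal (real d)"
proof -
  let ?a = "\<lambda>n. dim_over j (power_span j V n)"
  have "log_dim n (?a n) \<ge> ereal (ln c / ln (real n) + real d)" if n: "n \<ge> max 2 N" for n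
  proof -
    have le: "c * real n ^ d \<le> real (?a n)" using n assms(2) by auto
    have pos: "0 < c * real n ^ d" using n assms(1) by auto
    \<comment> \<open>A positive lower bound excludes dimension 0, where \<open>log_dim\<close>
      takes the value -\<infinity>.\<close>
    then have nz: "?a n \<noteq> 0" using le by (metis not_le of_nat_0)
    have "ln c + real d * ln (real n) = ln (c * real n ^ d)"
      using n assms(1) by (subst ln_mult) (auto simp: ln_realpow)
    also have "\<dots> \<le> ln (real (?a n))"
      using pos le by (subst ln_le_cancel_iff) auto
    finally have "(ln c + real d * ln (real n)) / ln (real n) \<le> ln (real (?a n)) / ln (real n)"
      using n by (intro divide_right_mono) auto
    moreover have "(ln c + real d * ln (real n)) / ln (real n) = ln c / ln (real n) + real d"
      using n by (simp add: add_divide_distrib)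
    ultimately show ?thesis using nz by (simp add: log_dim_def log_def)
  qed
  then have ev: "eventually (\<lambda>n. ereal (ln c / ln (real n) + real d) \<le> log_dim n (?a n)) sequentially"
    unfolding eventually_sequentially by blast
  have "filterlim (\<lambda>n. ln (real n)) at_top sequentially"
    by (rule filterlim_compose[OF ln_at_top filterlim_real_sequentially])
  then have "(\<lambda>n. ln c / ln (real n)) \<longlonglongrightarrow> 0"
    by (intro real_tendsto_divide_at_top[OF tendsto_const])
  then have "(\<lambda>n. ln c / ln (real n) + real d) \<longlonglongrightarrow> 0 + real d"
    by (intro tendsto_intros)
  then have "limsup (\<lambda>n. ereal (ln c / ln (real n) + real d)) = ereal (real d)"
    by (intro lim_imp_Limsup) auto
  then show ?thesis
    unfolding growth_def using Limsup_mono[OF ev] by simp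
qed

end

section \<open>Monomials and the upper bound for growth\<close>

text \<open>Each exponent is bounded separately, not the total degree: a box has exactly (m + 1) ^ d
  elements, and the bounds add under multiplication of monomials.\<close>

definition exponent_box :: "nat \<Rightarrow> nat \<Rightarrow> nat list set" where
  "exponent_box d m = {e. set e \<subseteq> {..m} \<and> length e = d}"

lemma finite_exponent_box: "finite (exponent_box d m)"
  and card_exponent_box: "card (exponent_box d m) = (m + 1) ^ d"
  using finite_lists_length_eq[of "{..m}" d] card_lists_length_eq[of "{..m}" d]
  by (simp_all add: exponent_box_def)

lemma exponent_box_mono: "m \<le> m' \<Longrightarrow> exponent_box d m \<subseteq> exponent_box d m'"
  by (auto simp: exponent_box_def)

lemma exponent_box_add:
  "e \<in> exponent_box d m \<Longrightarrow> f \<in> exponent_box d m' \<Longrightarrow> map2 (+) e f \<in> exponent_box d (m + m')"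
proof -
  assume e: "e \<in> exponent_box d m" and f: "f \<in> exponent_box d m'"
  have "e ! i + f ! i \<le> m + m'" if "i < d" for i
  proof (rule add_mono)
    have "e ! i \<in> set e" "f ! i \<in> set f" using e f that by (auto simp: exponent_box_def)
    then show "e ! i \<le> m" "f ! i \<le> m'" using e f by (auto simp: exponent_box_def)
  qed
  then show "map2 (+) e f \<in> exponent_box d (m + m')"
    using e f by (auto simp: exponent_box_def set_zip)
qed

lemma monomial_Nil [simp]: "monomial [] e = 1" "monomial xs [] = 1"
  by (simp_all add: monomial_def)

lemma monomial_Cons [simp]: "monomial (x # xs) (n # e) = x ^ n * monomial xs e"
  by (simp add: monomial_def)

lemma monomial_snoc: "length e = length xs \<Longrightarrow> monomial (xs @ [y]) (e @ [i]) = monomial xs e * y ^ i"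
  by (simp add: monomial_def)

lemma monomial_replicate_0: "monomial xs (replicate (length xs) 0) = 1"
  by (induction xs) auto

text \<open>A commutative submonoid is the setting in which monomials multiply by adding exponents,
  even inside a noncommutative ring; subfields and centres are instances.\<close>

definition commuting_set :: "'a::ring_1 set \<Rightarrow> bool" where
  "commuting_set G \<longleftrightarrow> 1 \<in> G \<and> (\<forall>a\<in>G. \<forall>b\<in>G. a * b \<in> G \<and> a * b = b * a)"

lemma commuting_set_power: "commuting_set G \<Longrightarrow> x \<in> G \<Longrightarrow> x ^ n \<in> G"
  by (induction n) (auto simp: commuting_set_def)

lemma monomial_in:
  assumes "commuting_set G"
  shows "set xs \<subseteq> G \<Longrightarrow> monomial xs e \<in> G"
proof (induction xs arbitrary: e)
  case Nil
  then show ?case using assms by (simp add: commuting_set_def)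
next
  case (Cons x xs)
  show ?case
  proof (cases e)
    case Nil
    then show ?thesis using assms by (simp add: commuting_set_def)
  next
    case (Cons n f)
    have "x ^ n \<in> G" "monomial xs f \<in> G"
      using Cons.prems Cons.IH commuting_set_power[OF assms] by auto
    then show ?thesis using assms Cons by (auto simp: commuting_set_def)
  qed
qed

lemma monomial_mult:
  assumes "commuting_set G"
  shows "set xs \<subseteq> G \<Longrightarrow> length e = length xs \<Longrightarrow> length f = length xs \<Longrightarrow>
    monomial xs e * monomial xs f = monomial xs (map2 (+) e f)"
proof (induction xs arbitrary: e f)
  case Nil
  then show ?case by simp
next
  case (Cons x xs)
  obtain n e' m f' where ef: "e = n # e'" "f = m # f'"
    using Cons.prems by (metis length_Suc_conv length_Cons)
  have "monomial xs e' * x ^ m = x ^ m * monomial xs e'"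
    using monomial_in[OF assms] commuting_set_power[OF assms] Cons.prems(1) assms
    unfolding commuting_set_def by (metis list.set_intros(1) set_subset_Cons subset_iff)
  then have "x ^ n * monomial xs e' * (x ^ m * monomial xs f')
      = x ^ n * x ^ m * (monomial xs e' * monomial xs f')"
    by (metis mult.assoc)
  with Cons ef show ?case by (simp add: power_add)
qed

context k_algebra
begin

text \<open>The multiplicative filtration of k[xs] by the largest exponent of a single
  variable.\<close>

definition box_span :: "'a list \<Rightarrow> nat \<Rightarrow> 'a set" where
  "box_span xs m = span (monomial xs ` exponent_box (length xs) m)"

lemma box_span_mono: "m \<le> m' \<Longrightarrow> box_span xs m \<subseteq> box_span xs m'"
  unfolding box_span_def by (intro span_mono image_mono exponent_box_mono)

lemma one_in_box_span: "1 \<in> box_span xs m"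
proof -
  have "replicate (length xs) 0 \<in> exponent_box (length xs) m"
    by (auto simp: exponent_box_def)
  then have "monomial xs (replicate (length xs) 0) \<in> box_span xs m"
    unfolding box_span_def by (intro span_base imageI)
  then show ?thesis by (simp only: monomial_replicate_0)
qed

lemma box_span_mult:
  assumes G: "commuting_set G" "set xs \<subseteq> G" and ab: "a \<in> box_span xs m" "b \<in> box_span xs m'"
  shows "a * b \<in> box_span xs (m + m')"
  unfolding box_span_def
proof (rule span_mult[OF ab[unfolded box_span_def]])
  fix s t assume "s \<in> monomial xs ` exponent_box (length xs) m"
    "t \<in> monomial xs ` exponent_box (length xs) m'"
  then obtain e f where e: "e \<in> exponent_box (length xs) m" "s = monomial xs e"
    and f: "f \<in> exponent_box (length xs) m'" "t = monomial xs f" by auto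
  then have "s * t = monomial xs (map2 (+) e f)"
    using monomial_mult[OF G] by (simp add: exponent_box_def)
  then show "s * t \<in> span (monomial xs ` exponent_box (length xs) (m + m'))"
    using exponent_box_add[OF e(1) f(1)] by (metis span_base imageI)
qed

lemma box_span_subset:
  assumes "commuting_set G" "set xs \<subseteq> G" "range j \<subseteq> G" "\<forall>a\<in>G. \<forall>b\<in>G. a + b \<in> G"
  shows "box_span xs m \<subseteq> G"
proof
  fix x assume "x \<in> box_span xs m"
  then show "x \<in> G" unfolding box_span_def
  proof (induction rule: span_induct_alt)
    case base
    show ?case using assms(3) j_0 by (metis range_subsetD)
  next
    case (step c x y)
    have "j c * x \<in> G"
      using step assms monomial_in[OF assms(1,2)] unfolding commuting_set_def by blast
    then show ?case using step assms(4) by (simp add: scale_by_def)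
  qed
qed

end

section \<open>Growth of modules over rational function fields\<close>

locale division_k_algebra = k_algebra j for j :: "'k::field \<Rightarrow> 'a::division_ring" +
  fixes G :: "'a set" and xs :: "'a list"
  assumes commuting: "commuting_set G"
    and add_closed: "\<forall>a\<in>G. \<forall>b\<in>G. a + b \<in> G"
    and inverse_closed: "\<forall>a\<in>G. inverse a \<in> G"
    and range_subset: "range j \<subseteq> G"
    and xs_subset: "set xs \<subseteq> G"
begin

lemma G_comm: "a \<in> G \<Longrightarrow> b \<in> G \<Longrightarrow> a * b = b * a"
  and G_mult: "a \<in> G \<Longrightarrow> b \<in> G \<Longrightarrow> a * b \<in> G"
  using commuting unfolding commuting_set_def by simp_all

lemma G_uminus: "a \<in> G \<Longrightarrow> - a \<in> G"
proof -
  assume "a \<in> G"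
  moreover have "j (- 1) \<in> G" using range_subset by blast
  ultimately have "j (- 1) * a \<in> G" by (intro G_mult)
  then show "- a \<in> G" by (simp add: j_uminus j_1)
qed

text \<open>Together with \<open>fractions\<close> below: k[xs] and k(xs) inside the commutative
  subfield \<open>G\<close>. Writing k[xs] as a union over \<open>m\<close> provides each polynomial
  with the degree bound that the growth estimate turns into a dimension.\<close>

definition polys :: "'a set" where
  "polys = (\<Union>m. box_span xs m)"

definition fractions :: "'a set" where
  "fractions = {p * inverse q | p q. p \<in> polys \<and> q \<in> polys \<and> q \<noteq> 0}"

lemma polys_subset: "polys \<subseteq> G"
  unfolding polys_def
  using box_span_subset[OF commuting xs_subset range_subset add_closed] by blast

lemma polys_mult: "a \<in> polys \<Longrightarrow> b \<in> polys \<Longrightarrow> a * b \<in> polys"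
  unfolding polys_def using box_span_mult[OF commuting xs_subset] by blast

lemma polys_1: "1 \<in> polys"
  unfolding polys_def using one_in_box_span by blast

lemma polys_uminus: "a \<in> polys \<Longrightarrow> - a \<in> polys"
  unfolding polys_def box_span_def using span_neg by blast

lemma fractions_subset: "fractions \<subseteq> G"
  using polys_subset inverse_closed by (auto simp: fractions_def intro!: G_mult)

lemma fractions_1: "1 \<in> fractions"
  unfolding fractions_def using polys_1 by force

lemma fractions_mult: "a \<in> fractions \<Longrightarrow> b \<in> fractions \<Longrightarrow> a * b \<in> fractions"
proof -
  assume "a \<in> fractions" "b \<in> fractions"
  then obtain p q r s where *: "a = p * inverse q" "b = r * inverse s"
    "p \<in> polys" "q \<in> polys" "q \<noteq> 0" "r \<in> polys" "s \<in> polys" "s \<noteq> 0"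
    unfolding fractions_def by blast
  have "inverse q * r = r * inverse q"
    using * polys_subset inverse_closed by (intro G_comm) auto
  then have "a * b = (p * r) * (inverse q * inverse s)"
    by (simp only: *(1,2)) (metis mult.assoc)
  also have "inverse q * inverse s = inverse (s * q)"
    using * by (simp add: nonzero_inverse_mult_distrib)
  finally show ?thesis
    unfolding fractions_def using * polys_mult 
    by (intro CollectI exI[of _ "p * r"] exI[of _ "s * q"]) auto
qed

lemma polys_finite_sum:
  assumes "finite E" "\<And>e. e \<in> E \<Longrightarrow> length e = length xs"
  shows "(\<Sum>e\<in>E. j (c e) * monomial xs e) \<in> polys"
proof -
  define m where "m = Max (insert 0 (\<Union>e\<in>E. set e))"
  have "E \<subseteq> exponent_box (length xs) m"
    using assms by (auto simp: exponent_box_def m_def intro!: Max_ge)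
  then have "(\<Sum>e\<in>E. scale_by j (c e) (monomial xs e)) \<in> box_span xs m"
    unfolding box_span_def by (intro span_sum span_scale span_base imageI) auto
  then have "(\<Sum>e\<in>E. j (c e) * monomial xs e) \<in> box_span xs m"
    by (simp add: scale_by_def)
  then show ?thesis unfolding polys_def by blast
qed

text \<open>Sorting a dependence of \<open>xs\<close> and \<open>y\<close> by the exponent of
  \<open>y\<close> gives a polynomial in \<open>y\<close> over k[xs]. Independence of
  \<open>xs\<close> keeps one of its coefficients nonzero, and dividing by the highest nonzero one
  makes the relation monic.\<close>

lemma algebraic_over_fractions:
  assumes ind: "alg_independent j xs" and dep: "\<not> alg_independent j (xs @ [y])" and y: "y \<in> G"
  shows "algebraic_on fractions y"
proof -
  let ?d = "length xs"
  obtain E c e0 where E: "finite E" "E \<subseteq> {e. length e = Suc ?d}"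
    "(\<Sum>e\<in>E. j (c e) * monomial (xs @ [y]) e) = 0" "e0 \<in> E" "c e0 \<noteq> 0"
    using dep unfolding alg_independent_def by auto
  \<comment> \<open>The coefficient of y ^ i. Summing over truncated exponent vectors gives it the
    shape in which independence of \<open>xs\<close> is stated.\<close>
  define p where "p i = (\<Sum>e\<in>butlast ` {e\<in>E. last e = i}. j (c (e @ [i])) * monomial xs e)" for i
  have split: "e = butlast e @ [last e]" "length (butlast e) = ?d" if "e \<in> E" for e
  proof -
    have "length e = Suc ?d" using that E(2) by blast
    then show "e = butlast e @ [last e]" "length (butlast e) = ?d"
      by (auto simp: append_butlast_last_id length_0_conv[symmetric] simp del: length_0_conv)
  qed
  have inj: "inj_on butlast {e\<in>E. last e = i}" for i
    by (rule inj_onI) (metis (mono_tags, lifting) mem_Collect_eq split(1))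
  have p_eq: "p i = (\<Sum>e\<in>{e\<in>E. last e = i}. j (c e) * monomial xs (butlast e))" for i
    unfolding p_def sum.reindex[OF inj] o_def
    by (intro sum.cong refl) (metis (mono_tags, lifting) mem_Collect_eq split(1))
  have p_poly: "p i \<in> polys" for i
    unfolding p_def by (rule polys_finite_sum) (use E(1) split in auto)
  have p_nz: "p (last e0) \<noteq> 0"
  proof
    let ?E = "butlast ` {e\<in>E. last e = last e0}"
    assume "p (last e0) = 0"
    moreover have "finite ?E" "?E \<subseteq> {e. length e = ?d}" using E(1) split(2) by auto
    ultimately have "\<forall>e\<in>?E. c (e @ [last e0]) = 0"
      using ind unfolding alg_independent_def p_def by (elim allE[of _ ?E] allE[of _ "\<lambda>e. c (e @ [last e0])"]) blast
    moreover have "butlast e0 \<in> ?E" using E(4) by auto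
    ultimately show False using E(4,5) split(1) by metis
  qed
  define H where "H = Suc (Max (last ` E))"
  have last_H: "last e < H" if "e \<in> E" for e
    using that E(1) by (simp add: H_def less_Suc_eq_le)
  have "0 = (\<Sum>e\<in>E. j (c e) * monomial xs (butlast e) * y ^ last e)"
    unfolding E(3)[symmetric]
  proof (intro sum.cong refl)
    fix e assume "e \<in> E"
    then show "j (c e) * monomial (xs @ [y]) e = j (c e) * monomial xs (butlast e) * y ^ last e"
      using split[of e] monomial_snoc[of "butlast e" xs y "last e"] by (simp add: mult.assoc)
  qed
  also have "\<dots> = (\<Sum>i<H. \<Sum>e\<in>{e\<in>E. last e = i}. j (c e) * monomial xs (butlast e) * y ^ last e)"
    by (rule sum.group[symmetric]) (use E(1) last_H in auto)
  also have "\<dots> = (\<Sum>i<H. p i * y ^ i)"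
    unfolding p_eq sum_distrib_right by (intro sum.cong) auto
  finally have rel: "(\<Sum>i<H. p i * y ^ i) = 0" ..
  define I where "I = {i. i < H \<and> p i \<noteq> 0}"
  define h where "h = Max I"
  have I: "finite I" "last e0 \<in> I" unfolding I_def using p_nz last_H[OF E(4)] by auto
  then have hI: "h \<in> I" unfolding h_def by (intro Max_in) auto
  then have h: "h < H" "p h \<noteq> 0" by (auto simp: I_def)
  have above: "p i = 0" if "h < i" "i < H" for i
    using Max_ge[OF I(1), of i] that unfolding h_def[symmetric] by (auto simp: I_def)
  have "(\<Sum>i<H. p i * y ^ i) = (\<Sum>i<Suc h. p i * y ^ i)"
    by (rule sum.mono_neutral_right) (use h above in auto)
  with rel have "p h * y ^ h = - (\<Sum>i<h. p i * y ^ i)"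
    by (simp add: eq_neg_iff_add_eq_0 add.commute)
  then have "y ^ h = inverse (p h) * - (\<Sum>i<h. p i * y ^ i)"
    using h(2) by (metis left_inverse mult.assoc mult_1)
  also have "\<dots> = (\<Sum>i<h. (- p i * inverse (p h)) * y ^ i)"
    unfolding sum_negf[symmetric] sum_distrib_left
  proof (intro sum.cong refl)
    fix i
    have "inverse (p h) * - p i = - p i * inverse (p h)"
      using p_poly polys_subset inverse_closed G_uminus by (intro G_comm) auto
    then show "inverse (p h) * - (p i * y ^ i) = (- p i * inverse (p h)) * y ^ i"
      by (metis mult.assoc mult_minus_left)
  qed
  finally have "y ^ h = (\<Sum>i<h. (- p i * inverse (p h)) * y ^ i)" .
  moreover have "- p i * inverse (p h) \<in> fractions" for i
    unfolding fractions_def using p_poly polys_uminus h(2) by blast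
  ultimately show ?thesis
    unfolding algebraic_on_def by (intro exI[of _ h] exI[of _ "\<lambda>i. - p i * inverse (p h)"]) simp
qed

lemma lspan_box_scale:
  assumes "x \<in> lspan (box_span xs m) W" "a \<in> box_span xs m'"
  shows "a * x \<in> lspan (box_span xs (m' + m)) W"
  by (rule lspan_mult_left[OF assms(1)])
    (use assms(2) box_span_mult[OF commuting xs_subset] in
      \<open>auto simp: mult.assoc[symmetric] intro!: lspan_scaled\<close>)

text \<open>The denominators of the terms are multiplied up one by one; all scalars lie in the
  commutative \<open>G\<close>, so their product clears each term. The filtration is increasing,
  hence one \<open>m\<close> bounds all numerators.\<close>

lemma clear_denominator:
  assumes "x \<in> lspan fractions W"
  shows "\<exists>q m. q \<in> polys \<and> q \<noteq> 0 \<and> q * x \<in> lspan (box_span xs m) W"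
  using assms
proof induction
  case zero
  show ?case by (rule exI[of _ 1]) (use polys_1 in \<open>auto intro: lspan.zero\<close>)
next
  case (step c w x)
  obtain q m where q: "q \<in> polys" "q \<noteq> 0" "q * x \<in> lspan (box_span xs m) W"
    using step.IH by blast
  obtain a b where ab: "c = a * inverse b" "a \<in> polys" "b \<in> polys" "b \<noteq> 0"
    using step.hyps(1) unfolding fractions_def by blast
  obtain k l where kl: "q * a \<in> box_span xs k" "b \<in> box_span xs l"
    using polys_mult[OF q(1) ab(2)] ab(3) unfolding polys_def by blast
  have "b * q * c = q * a"
  proof -
    have "b * q * c = b * (q * a * inverse b)" by (simp add: ab mult.assoc)
    also have "q * a * inverse b = inverse b * (q * a)"
      using q ab polys_subset inverse_closed polys_mult by (intro G_comm) auto
    finally show ?thesis using ab(4) by (simp add: mult.assoc[symmetric])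
  qed
  then have "b * q * (c * w + x) = q * a * w + b * (q * x)"
    by (metis distrib_left mult.assoc)
  moreover have "q * a * w \<in> lspan (box_span xs (k + (l + m))) W"
    using kl(1) box_span_mono[of k "k + (l + m)"] step.hyps(2) by (intro lspan_scaled) auto
  moreover have "b * (q * x) \<in> lspan (box_span xs (k + (l + m))) W"
    by (rule lspan_mono[OF lspan_box_scale[OF q(3) kl(2)]]) (auto intro: box_span_mono[THEN subsetD, rotated])
  ultimately have "b * q * (c * w + x) \<in> lspan (box_span xs (k + (l + m))) W"
    by (simp add: lspan_add)
  moreover have "b * q \<in> polys" "b * q \<noteq> 0" using polys_mult q ab by auto
  ultimately show ?case by blast
qed

lemma clear_denominators:
  assumes "finite I" "\<And>i. i \<in> I \<Longrightarrow> x i \<in> lspan fractions W"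
  shows "\<exists>q m. q \<in> polys \<and> q \<noteq> 0 \<and> (\<forall>i\<in>I. q * x i \<in> lspan (box_span xs m) W)"
  using assms
proof (induction I)
  case empty
  show ?case by (rule exI[of _ 1]) (use polys_1 in auto)
next
  case (insert i I)
  obtain q m where q: "q \<in> polys" "q \<noteq> 0" "\<forall>i\<in>I. q * x i \<in> lspan (box_span xs m) W"
    using insert by auto
  obtain r n where r: "r \<in> polys" "r \<noteq> 0" "r * x i \<in> lspan (box_span xs n) W"
    using clear_denominator[OF insert.prems[of i]] by blast
  obtain k l where kl: "q \<in> box_span xs k" "r \<in> box_span xs l"
    using q(1) r(1) unfolding polys_def by blast
  let ?M = "(k + n) + (l + m)"
  have mono: "y \<in> lspan (box_span xs a) W \<Longrightarrow> a \<le> ?M \<Longrightarrow> y \<in> lspan (box_span xs ?M) W" for y a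
    by (rule lspan_mono) (auto intro: box_span_mono[THEN subsetD, rotated])
  have qr: "q * r = r * q" using q(1) r(1) polys_subset by (intro G_comm) auto
  have "q * r * x i \<in> lspan (box_span xs ?M) W"
    using mono[OF lspan_box_scale[OF r(3) kl(1)]] by (simp add: mult.assoc)
  moreover have "q * r * x l' \<in> lspan (box_span xs ?M) W" if "l' \<in> I" for l'
    unfolding qr mult.assoc by (rule mono[OF lspan_box_scale[OF q(3)[rule_format, OF that] kl(2)]]) simp
  ultimately show ?case
    using polys_mult q r by (intro exI[of _ "q * r"] exI[of _ ?M]) auto
qed

text \<open>A single polynomial \<open>q\<close> clears the whole multiplication table of
  \<open>B\<close> on \<open>W\<close>. Each factor of a product then costs one inverse of
  \<open>q\<close> and raises exponents by at most \<open>m\<close>, so an n-fold product, applied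
  to 1 in \<open>W\<close>, is the n-th power of the inverse of \<open>q\<close> times a combination
  of \<open>W\<close> with coefficients in \<open>box_span xs (n * m)\<close>.\<close>

lemma products_bound:
  assumes B: "finite B" "\<forall>b\<in>B. \<forall>g\<in>G. b * g = g * b"
    and W: "finite W" "1 \<in> W" "\<forall>b\<in>B. \<forall>w\<in>W. b * w \<in> lspan fractions W"
  shows "\<exists>C. \<forall>n. \<exists>T. finite T \<and> card T \<le> C * (n + 1) ^ length xs \<and> products B n \<subseteq> span T"
proof -
  obtain q m where q: "q \<in> polys" "q \<noteq> 0"
    and "\<forall>i\<in>B \<times> W. q * (fst i * snd i) \<in> lspan (box_span xs m) W"
    using clear_denominators[of "B \<times> W" "\<lambda>i. fst i * snd i" W] B(1) W by auto
  then have qm: "q * (b * w) \<in> lspan (box_span xs m) W" if "b \<in> B" "w \<in> W" for b w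
    using that by auto
  have iq: "inverse q ^ n \<in> G" for n
    using q(1) polys_subset inverse_closed by (intro commuting_set_power[OF commuting]) auto
  have prod_in: "\<exists>y \<in> lspan (box_span xs (n * m)) W. x = inverse q ^ n * y" if "x \<in> products B n" for x n
    using that
  proof (induction n arbitrary: x)
    case 0
    then show ?case
      using lspan_base[OF one_in_box_span W(2)] by (auto simp: products_0)
  next
    case (Suc n)
    obtain b z where bz: "x = b * z" "b \<in> B" "z \<in> products B n"
      using Suc.prems unfolding products_Suc by blast
    obtain y where y: "y \<in> lspan (box_span xs (n * m)) W" "z = inverse q ^ n * y"
      using Suc.IH[OF bz(3)] by blast
    have "q * b * y \<in> lspan (box_span xs (n * m + m)) W"
    proof (rule lspan_mult_left[OF y(1)])
      fix g w assume g: "g \<in> box_span xs (n * m)" "w \<in> W"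
      then have gG: "g \<in> G" using polys_subset unfolding polys_def by blast
      have "q * b * (g * w) = g * (q * (b * w))"
      proof -
        have "b * g = g * b" using B(2) bz(2) gG by blast
        moreover have "q * g = g * q" using gG q(1) polys_subset by (intro G_comm) auto
        ultimately show ?thesis by (metis mult.assoc)
      qed
      then show "q * b * (g * w) \<in> lspan (box_span xs (n * m + m)) W"
        using lspan_box_scale[OF qm[OF bz(2) g(2)] g(1)] by simp
    qed
    moreover have "x = inverse q ^ Suc n * (q * b * y)"
    proof -
      have "x = inverse q ^ n * (b * y)"
      proof -
        have "b * inverse q ^ n = inverse q ^ n * b" using B(2) bz(2) iq by blast
        then show ?thesis unfolding bz(1) y(2) by (metis mult.assoc)
      qed
      also have "b * y = inverse q * (q * b * y)" using q(2) by (simp add: mult.assoc[symmetric])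
      finally show ?thesis by (simp add: mult.assoc[symmetric] power_commutes)
    qed
    ultimately show ?case by (auto simp: add.commute)
  qed
  define T where "T n = (\<lambda>(e, w). inverse q ^ n * (monomial xs e * w)) `
    (exponent_box (length xs) (n * m) \<times> W)" for n
  have "finite (T n)" for n
    unfolding T_def using W(1) finite_exponent_box by auto
  moreover have "card (T n) \<le> (m + 1) ^ length xs * card W * (n + 1) ^ length xs" for n
  proof -
    have "card (T n) \<le> card (exponent_box (length xs) (n * m) \<times> W)"
      unfolding T_def using W(1) finite_exponent_box by (intro card_image_le) auto
    also have "\<dots> = (n * m + 1) ^ length xs * card W"
      by (simp add: card_cartesian_product card_exponent_box)
    \<comment> \<open>The estimate n m + 1 \<le> (m + 1) (n + 1) isolates the dependence on
      n.\<close>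
    also have "\<dots> \<le> ((m + 1) * (n + 1)) ^ length xs * card W"
      by (intro mult_right_mono power_mono) auto
    also have "\<dots> = (m + 1) ^ length xs * card W * (n + 1) ^ length xs"
      by (simp only: power_mult_distrib ac_simps)
    finally show ?thesis .
  qed
  moreover have "products B n \<subseteq> span (T n)" for n
  proof
    fix x assume "x \<in> products B n"
    then obtain y where y: "y \<in> lspan (box_span xs (n * m)) W" "x = inverse q ^ n * y"
      using prod_in by blast
    have "inverse q ^ n * y \<in> lspan (range j) (T n)"
    proof (rule lspan_mult_left[OF y(1)])
      fix g w assume g: "g \<in> box_span xs (n * m)" and w: "w \<in> W"
      from g have "g \<in> lspan (range j) (monomial xs ` exponent_box (length xs) (n * m))"
        unfolding box_span_def span_eq_lspan .
      then have "inverse q ^ n * g * w \<in> lspan (range j) (T n)"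
      proof (induction)
        case zero
        show ?case by (simp add: lspan.zero)
      next
        case (step c u v)
        then obtain a e where ae: "c = j a" "u = monomial xs e" "e \<in> exponent_box (length xs) (n * m)"
          by auto
        have "inverse q ^ n * (c * u + v) * w
            = c * (inverse q ^ n * (u * w)) + inverse q ^ n * v * w"
        proof -
          have "inverse q ^ n * c = c * inverse q ^ n" by (simp add: ae(1) j_central)
          then have "inverse q ^ n * (c * u) * w = c * (inverse q ^ n * (u * w))"
            by (metis mult.assoc)
          then show ?thesis by (simp only: distrib_left distrib_right)
        qed
        moreover have "inverse q ^ n * (u * w) \<in> T n"
          unfolding T_def using ae w by force
        ultimately show ?case using step by (simp add: lspan.step)
      qed
      then show "inverse q ^ n * (g * w) \<in> lspan (range j) (T n)" by (simp add: mult.assoc)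
    qed
    then show "x \<in> span (T n)" by (simp add: span_eq_lspan y(2))
  qed
  ultimately show ?thesis by blast
qed

end

section \<open>Lower transcendence degree\<close>

lemma sum_list_le_length_mult: "set e \<subseteq> {..q} \<Longrightarrow> sum_list e \<le> length e * (q::nat)"
  by (induction e) auto

section \<open>Subrings given as sets, and bounds for the lower transcendence degree\<close>

lemma is_subring_1: "is_subring A \<Longrightarrow> 1 \<in> A"
  and is_subring_diff: "is_subring A \<Longrightarrow> a \<in> A \<Longrightarrow> b \<in> A \<Longrightarrow> a - b \<in> A"
  and is_subring_mult: "is_subring A \<Longrightarrow> a \<in> A \<Longrightarrow> b \<in> A \<Longrightarrow> a * b \<in> A"
  unfolding is_subring_def by simp_all

lemma is_subring_0: "is_subring A \<Longrightarrow> 0 \<in> A"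
  using is_subring_diff[of A 1 1] is_subring_1[of A] by simp

lemma is_subring_uminus: "is_subring A \<Longrightarrow> a \<in> A \<Longrightarrow> - a \<in> A"
  using is_subring_diff[of A 0 a] is_subring_0[of A] by simp

lemma is_subring_add: "is_subring A \<Longrightarrow> a \<in> A \<Longrightarrow> b \<in> A \<Longrightarrow> a + b \<in> A"
  using is_subring_diff[of A a "- b"] is_subring_uminus[of A b] by simp

lemma is_subring_power: "is_subring A \<Longrightarrow> a \<in> A \<Longrightarrow> a ^ n \<in> A"
  by (induction n) (auto intro: is_subring_1 is_subring_mult)

lemma is_subring_sum: "is_subring A \<Longrightarrow> (\<And>i. i \<in> I \<Longrightarrow> f i \<in> A) \<Longrightarrow> sum f I \<in> A"
  by (induction I rule: infinite_finite_induct) (auto intro: is_subring_0 is_subring_add)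

lemma is_subring_monomial: "is_subring A \<Longrightarrow> set xs \<subseteq> A \<Longrightarrow> monomial xs e \<in> A"
proof (induction xs arbitrary: e)
  case Nil
  then show ?case by (simp add: is_subring_1)
next
  case (Cons x xs)
  then show ?case
    by (cases e) (auto intro: is_subring_1 is_subring_mult is_subring_power)
qed

context k_algebra
begin

text \<open>Injectivity comes with independence, so the size of the index set becomes a lower bound
  for a dimension.\<close>

lemma independent_family:
  assumes "finite I" "\<And>c. (\<Sum>i\<in>I. scale_by j (c i) (f i)) = 0 \<Longrightarrow> \<forall>i\<in>I. c i = 0"
  shows "inj_on f I" "independent (f ` I)"
proof -
  show inj: "inj_on f I"
  proof (rule inj_onI, rule ccontr)
    fix a b assume ab: "a \<in> I" "b \<in> I" "f a = f b" "a \<noteq> b"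
    define c :: "'b \<Rightarrow> 'k" where "c i = (if i = a then 1 else if i = b then - 1 else 0)" for i
    have "(\<Sum>i\<in>I. scale_by j (c i) (f i)) = (\<Sum>i\<in>{a, b}. scale_by j (c i) (f i))"
      using assms(1) ab by (intro sum.mono_neutral_right) (auto simp: c_def)
    also have "\<dots> = 0" using ab by (simp add: c_def)
    finally have "c a = 0" using assms(2) ab(1) by blast
    then show False by (simp add: c_def)
  qed
  show "independent (f ` I)"
  proof
    assume "dependent (f ` I)"
    then obtain u v where u: "v \<in> f ` I" "u v \<noteq> 0" "(\<Sum>v\<in>f ` I. scale_by j (u v) v) = 0"
      using dependent_finite[of "f ` I"] assms(1) by auto
    have "(\<Sum>i\<in>I. scale_by j (u (f i)) (f i)) = 0"
      using u(3) by (simp add: sum.reindex[OF inj])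
    from assms(2)[OF this] u(1,2) show False by auto
  qed
qed

lemma subring_span_subset:
  assumes "is_subring A" "range j \<subseteq> A" "B \<subseteq> A"
  shows "span B \<subseteq> A"
proof
  fix x assume "x \<in> span B"
  then show "x \<in> A"
  proof (induction rule: span_induct_alt)
    case base
    show ?case using assms(1) by (rule is_subring_0)
  next
    case (step c x y)
    have "j c \<in> A" using assms(2) by auto
    with step show ?case
      using assms(1,3) unfolding scale_by_def by (auto intro: is_subring_add is_subring_mult)
  qed
qed

text \<open>From each of the n factors one picks \<open>b\<close> or b y with y in
  \<open>ys\<close>; since \<open>b\<close> commutes with \<open>ys\<close>, its occurrences collect
  in front as b ^ n. Regularity of \<open>b\<close> permits cancelling b ^ n, so independent
  monomials stay independent after the multiplication.\<close>

lemma growth_perturbed_ge: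
  assumes A: "is_subring A" "range j \<subseteq> A" and b: "b \<in> regular_elements A"
    and ys: "set ys \<subseteq> A" "\<And>y. y \<in> set ys \<Longrightarrow> b * y = y * b" "alg_independent j ys"
  shows "growth j {j c + b * v | c v. v \<in> span (insert 1 (set ys))} \<ge> ereal (real (length ys))"
proof -
  let ?r = "length ys" and ?S = "insert 1 (set ys)"
  let ?U = "{j c + b * v | c v. v \<in> span ?S}"
  have bA: "b \<in> A" and reg: "\<And>x. x \<in> A \<Longrightarrow> b * x = 0 \<Longrightarrow> x = 0"
    using b unfolding regular_elements_def by auto
  have regn: "x = 0" if "x \<in> A" "b ^ n * x = 0" for n x
    using that
  proof (induction n)
    case (Suc n)
    have "b * (b ^ n * x) = 0" using Suc.prems by (simp add: mult.assoc)
    moreover have "b ^ n * x \<in> A"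
      using Suc.prems bA A(1) by (intro is_subring_mult is_subring_power) auto
    ultimately have "b ^ n * x = 0" using reg by blast
    then show ?case using Suc.IH Suc.prems(1) by blast
  qed simp
  have U_span: "?U \<subseteq> span (insert 1 ((*) b ` ?S))"
  proof
    fix u assume "u \<in> ?U"
    then obtain c v where u: "u = j c + b * v" "v \<in> span ?S" by blast
    have "b * v \<in> span (insert 1 ((*) b ` ?S))"
      by (rule span_mult[of _ "{b}" _ ?S]) (use u in \<open>auto intro!: span_base\<close>)
    moreover have "scale_by j c 1 \<in> span (insert 1 ((*) b ` ?S))"
      by (intro span_scale span_base) simp
    ultimately show "u \<in> span (insert 1 ((*) b ` ?S))"
      unfolding u by (simp add: scale_by_def span_add add.commute)
  qed
  have bU: "b * s \<in> ?U" if "s \<in> ?S" for s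
    using span_base[OF that] j_0 by (intro CollectI exI[of _ 0] exI[of _ s]) simp
  have bprod: "b ^ n * monomial zs e \<in> products ?U n"
    if "set zs \<subseteq> set ys" "length e = length zs" "sum_list e \<le> n" for zs e n
    using that
  proof (induction zs arbitrary: e n)
    case Nil
    have "b ^ n \<in> products ?U n"
    proof (induction n)
      case 0
      then show ?case by (simp add: products_0)
    next
      case (Suc n)
      then show ?case using bU[of 1] unfolding products_Suc by auto
    qed
    then show ?case by simp
  next
    case (Cons z zs)
    obtain m f where e: "e = m # f" using Cons.prems by (cases e) auto
    have "b ^ n * (z ^ m * monomial zs f) \<in> products ?U n" if "m + sum_list f \<le> n" for m n
      using that
    proof (induction m arbitrary: n)
      case 0
      then show ?case using Cons e by simp
    next
      case (Suc m)
      then obtain n' where n: "n = Suc n'" by (cases n) auto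
      have comm: "b ^ n' * z = z * b ^ n'"
        using ys(2)[of z] Cons.prems(1) by (intro power_commuting_commutes) auto
      have "b ^ n * (z ^ Suc m * monomial zs f) = b * (b ^ n' * z) * (z ^ m * monomial zs f)"
        by (simp add: n mult.assoc)
      also have "\<dots> = b * z * (b ^ n' * (z ^ m * monomial zs f))"
        unfolding comm by (simp add: mult.assoc)
      finally show ?case
        using Suc bU[of z] Cons.prems(1) unfolding n products_Suc by auto
    qed
    then show ?case using Cons.prems(3) by (simp add: e)
  qed
  have "(1 / real ?r) ^ ?r * real n ^ ?r \<le> real (dim_over j (power_span j ?U n))" for n
  proof -
    \<comment> \<open>Exponents up to n div r have sum at most n, so n factors suffice for every
      monomial in this box.\<close>
    define q where "q = n div ?r"
    let ?f = "\<lambda>e. b ^ n * monomial ys e"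
    have ind: "\<forall>e\<in>exponent_box ?r q. c e = 0"
      if "(\<Sum>e\<in>exponent_box ?r q. scale_by j (c e) (?f e)) = 0" for c
    proof -
      let ?s = "\<Sum>e\<in>exponent_box ?r q. j (c e) * monomial ys e"
      have "b ^ n * ?s = (\<Sum>e\<in>exponent_box ?r q. scale_by j (c e) (?f e))"
        unfolding sum_distrib_left scale_by_def
      proof (intro sum.cong refl)
        fix e
        have "b ^ n * j (c e) = j (c e) * b ^ n" by (simp add: j_central)
        then show "b ^ n * (j (c e) * monomial ys e) = j (c e) * (b ^ n * monomial ys e)"
          by (metis mult.assoc)
      qed
      moreover have "j c \<in> A" for c using A(2) by auto
      then have "?s \<in> A"
        using A(1) ys(1) by (intro is_subring_sum is_subring_mult is_subring_monomial)
      ultimately have "?s = 0" using that regn by metis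
      then show ?thesis
        using ys(3) finite_exponent_box unfolding alg_independent_def
        by (auto simp: exponent_box_def)
    qed
    note fam = independent_family[OF finite_exponent_box ind]
    have "?f ` exponent_box ?r q \<subseteq> products ?U n"
    proof
      fix x assume "x \<in> ?f ` exponent_box ?r q"
      then obtain e where e: "x = ?f e" "length e = ?r" "set e \<subseteq> {..q}"
        by (auto simp: exponent_box_def)
      have "sum_list e \<le> ?r * q" using sum_list_le_length_mult[OF e(3)] e(2) by simp
      also have "\<dots> \<le> n" by (simp add: q_def)
      finally show "x \<in> products ?U n" using bprod[of ys e n] e by simp
    qed
    then have sub: "?f ` exponent_box ?r q \<subseteq> power_span j ?U n"
      unfolding power_span_eq using span_superset by blast
    have "card (?f ` exponent_box ?r q) \<le> dim_over j (power_span j ?U n)"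
      by (rule card_le_dim_power_span[OF U_span _ sub fam(2)]) simp
    then have "(q + 1) ^ ?r \<le> dim_over j (power_span j ?U n)"
      by (simp add: card_image[OF fam(1)] card_exponent_box)
    then have *: "real ((q + 1) ^ ?r) \<le> real (dim_over j (power_span j ?U n))"
      using of_nat_le_iff by blast
    \<comment> \<open>This follows from n / r \<le> q + 1; for r = 0 both sides are 1.\<close>
    have "(1 / real ?r * real n) ^ ?r \<le> (real q + 1) ^ ?r"
    proof (cases "?r = 0")
      case False
      have "n \<le> (q + 1) * ?r"
        using False unfolding q_def
        by (metis Suc_eq_plus1 dividend_less_div_times less_imp_le mult.commute mult_Suc_right neq0_conv add.commute)
      then have "real n \<le> (real q + 1) * real ?r"
        by (metis of_nat_Suc of_nat_le_iff of_nat_mult Suc_eq_plus1 add.commute)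
      then have "1 / real ?r * real n \<le> real q + 1" using False by (simp add: field_simps)
      then show ?thesis by (intro power_mono) auto
    qed simp
    with * show ?thesis unfolding power_mult_distrib[symmetric] by (simp add: add.commute)
  qed
  then show ?thesis
    by (intro growth_ge[where c = "(1 / real ?r) ^ ?r" and N = 0]) (cases "?r = 0"; simp)
qed

lemma Ld_ge:
  assumes A: "is_subring A" "range j \<subseteq> A"
    and ys: "set ys \<subseteq> center_of A" "alg_independent j ys"
  shows "Ld j A \<ge> ereal (real (length ys))"
proof -
  let ?V = "span (insert 1 (set ys))"
  have sub: "set ys \<subseteq> A" using ys(1) by (auto simp: center_of_def)
  have V: "fd_subspace j ?V" "?V \<subseteq> A"
    unfolding fd_subspace_def span_over_eq
    using subring_span_subset[OF A] sub is_subring_1[OF A(1)] by blast+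
  have "ereal (real (length ys)) \<le> (INF b\<in>regular_elements A. growth j {j c + b * v | c v. v \<in> ?V})"
  proof (rule INF_greatest)
    fix b assume b: "b \<in> regular_elements A"
    then have "b \<in> A" by (simp add: regular_elements_def)
    then have "b * y = y * b" if "y \<in> set ys" for y
      using ys(1) that by (auto simp: center_of_def)
    then show "ereal (real (length ys)) \<le> growth j {j c + b * v | c v. v \<in> ?V}"
      by (rule growth_perturbed_ge[OF A b sub _ ys(2)])
  qed
  also have "\<dots> \<le> Ld j A"
    unfolding Ld_def using V by (intro SUP_upper) auto
  finally show ?thesis .
qed

text \<open>The regular element b = 1 turns k + b V into k + V, which is again a finite dimensional
  subspace of \<open>A\<close>.\<close>

lemma Ld_le_GKdim:
  assumes A: "is_subring A" "range j \<subseteq> A"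
  shows "Ld j A \<le> GKdim j A"
  unfolding Ld_def
proof (rule SUP_least)
  fix V assume "V \<in> {V. fd_subspace j V \<and> V \<subseteq> A}"
  then obtain B where B: "finite B" "V = span B" "V \<subseteq> A"
    unfolding fd_subspace_def span_over_eq by blast
  have one: "1 \<in> regular_elements A"
    using is_subring_1[OF A(1)] by (simp add: regular_elements_def)
  have eq: "{j c + 1 * v | c v. v \<in> V} = span (insert 1 B)"
  proof (intro equalityI subsetI)
    fix x assume "x \<in> {j c + 1 * v | c v. v \<in> V}"
    then obtain c v where x: "x = scale_by j c 1 + v" "v \<in> span B"
      using B(2) by (auto simp: scale_by_def)
    have "scale_by j c 1 \<in> span (insert 1 B)" by (intro span_scale span_base) simp
    moreover have "v \<in> span (insert 1 B)" using x(2) span_mono[of B "insert 1 B"] by auto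
    ultimately show "x \<in> span (insert 1 B)" unfolding x(1) by (rule span_add)
  next
    fix x assume "x \<in> span (insert 1 B)"
    then obtain c where "x - scale_by j c 1 \<in> span B"
      unfolding span_insert by blast
    then show "x \<in> {j c + 1 * v | c v. v \<in> V}"
      using B(2) by (intro CollectI exI[of _ c] exI[of _ "x - scale_by j c 1"]) (simp add: scale_by_def)
  qed
  have "B \<subseteq> A" using B(2,3) span_superset by blast
  then have "span (insert 1 B) \<subseteq> A"
    using subring_span_subset[OF A] is_subring_1[OF A(1)] by blast
  moreover have "fd_subspace j (span (insert 1 B))"
    unfolding fd_subspace_def span_over_eq using B(1) by blast
  ultimately have "growth j (span (insert 1 B)) \<le> GKdim j A"
    unfolding GKdim_def by (intro SUP_upper) auto
  moreover have "(INF b\<in>regular_elements A. growth j {j c + b * v | c v. v \<in> V})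
      \<le> growth j {j c + 1 * v | c v. v \<in> V}"
    by (rule INF_lower[OF one])
  ultimately show "(INF b\<in>regular_elements A. growth j {j c + b * v | c v. v \<in> V}) \<le> GKdim j A"
    unfolding eq by simp
qed

text \<open>Products of elements of \<open>V\<close> lie in the span of products of a spanning set
  \<open>B\<close>, so finite sets can replace subspaces in the estimate.\<close>

lemma GKdim_le:
  assumes "\<And>B. finite B \<Longrightarrow> B \<subseteq> A \<Longrightarrow>
    \<exists>C. \<forall>n. \<exists>T. finite T \<and> card T \<le> C * (n + 1) ^ d \<and> products B n \<subseteq> span T"
  shows "GKdim j A \<le> ereal (real d)"
  unfolding GKdim_def
proof (rule SUP_least)
  fix V assume "V \<in> {V. fd_subspace j V \<and> V \<subseteq> A}"
  then obtain B where B: "finite B" "V = span B" "V \<subseteq> A"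
    unfolding fd_subspace_def span_over_eq by blast
  have "B \<subseteq> A" using B(2,3) span_superset by blast
  then obtain C where C: "\<forall>n. \<exists>T. finite T \<and> card T \<le> C * (n + 1) ^ d \<and> products B n \<subseteq> span T"
    using assms[OF B(1)] by blast
  show "growth j V \<le> ereal (real d)"
  proof (rule growth_le)
    fix n
    obtain T where T: "finite T" "card T \<le> C * (n + 1) ^ d" "products B n \<subseteq> span T"
      using C by blast
    have "power_span j V n \<subseteq> power_span j B n"
      by (rule power_span_mono) (simp add: B(2))
    also have "\<dots> \<subseteq> span T"
      unfolding power_span_eq by (rule span_minimal[OF T(3) subspace_span])
    finally show "\<exists>T. finite T \<and> card T \<le> C * (n + 1) ^ d \<and> power_span j V n \<subseteq> span T"
      using T by blast
  qed
qed

end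

section \<open>Transcendence degree and maximal independent lists\<close>

lemma trdeg_ge_length:
  "set xs \<subseteq> center_of F \<Longrightarrow> alg_independent j xs \<Longrightarrow> ereal (real (length xs)) \<le> trdeg j F"
  unfolding trdeg_def by (rule SUP_upper) simp

lemma trdeg_le_Ld:
  fixes j :: "'k::field \<Rightarrow> 'a::division_ring"
  assumes "algebra_map j" "is_subring A" "range j \<subseteq> A"
  shows "trdeg j A \<le> Ld j A"
  unfolding trdeg_def
  using k_algebra.Ld_ge[OF k_algebra.intro[OF assms(1)] assms(2,3)] by (intro SUP_least) auto

text \<open>The lengths of independent lists are unbounded or have a maximum, and a list of maximal
  length admits no extension. The empty list ensures that there is a length at all.\<close>

lemma trdeg_cases:
  fixes j :: "'k::field \<Rightarrow> 'a::division_ring"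
  assumes "algebra_map j"
  obtains "trdeg j F = \<infinity>"
  | xs where "set xs \<subseteq> center_of F" "alg_independent j xs" "trdeg j F = ereal (real (length xs))"
    "\<And>y. y \<in> center_of F \<Longrightarrow> \<not> alg_independent j (xs @ [y])"
proof -
  interpret k_algebra j using assms by (rule k_algebra.intro)
  let ?P = "\<lambda>n. \<exists>xs. length xs = n \<and> set xs \<subseteq> center_of F \<and> alg_independent j xs"
  have P0: "?P 0"
  proof (intro exI[of _ "[]"] conjI)
    show "alg_independent j []"
      unfolding alg_independent_def
    proof (intro allI impI ballI)
      fix E c e assume E: "finite E \<and> E \<subseteq> {e. length e = length ([]::'a list)} \<and>
        (\<Sum>e\<in>E. j (c e) * monomial [] e) = 0" and e: "e \<in> E"
      then have "E = {[]}" "e = []" by auto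
      with E show "c e = 0" by (simp add: j_eq_0_iff)
    qed
  qed auto
  show thesis
  proof (cases "\<exists>N. \<forall>n. ?P n \<longrightarrow> n \<le> N")
    case True
    define m where "m = (GREATEST n. ?P n)"
    obtain N where N: "\<forall>n. ?P n \<longrightarrow> n \<le> N" using True by blast
    have "?P m" unfolding m_def by (rule GreatestI_nat[of ?P 0 N]) (use P0 N in auto)
    then obtain xs where xs: "length xs = m" "set xs \<subseteq> center_of F" "alg_independent j xs" by blast
    have max: "n \<le> m" if "?P n" for n
      unfolding m_def by (rule Greatest_le_nat[of ?P n N]) (use that N in auto)
    show thesis
    proof (rule that(2)[OF xs(2,3)])
      show "trdeg j F = ereal (real (length xs))"
      proof (rule antisym)
        show "trdeg j F \<le> ereal (real (length xs))"
          unfolding trdeg_def using max xs(1) by (intro SUP_least) auto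
      qed (rule trdeg_ge_length[OF xs(2,3)])
      show "\<not> alg_independent j (xs @ [y])" if "y \<in> center_of F" for y
        using max[of "length (xs @ [y])"] that xs by (metis Un_insert_right append_Nil2
            empty_subsetI insert_subset length_append_singleton list.simps(15) not_less_eq_eq order_refl set_append Un_subset_iff list.set(1))
    qed
  next
    case False
    have "trdeg j F = \<infinity>"
    proof (rule ereal_top)
      fix B :: real
      obtain n where n: "?P n" "\<not> n \<le> nat \<lceil>B\<rceil>" using False by blast
      then obtain xs where xs: "length xs = n" "set xs \<subseteq> center_of F" "alg_independent j xs" by blast
      have "B \<le> real n" using n(2) by linarith
      then have "ereal B \<le> ereal (real (length xs))" using xs(1) by simp
      also have "\<dots> \<le> trdeg j F" by (rule trdeg_ge_length[OF xs(2,3)])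
      finally show "ereal B \<le> trdeg j F" .
    qed
    then show thesis by (rule that(1))
  qed
qed

text \<open>
  The algebra generated by \<open>B\<close> sits in a finite module over an algebraic extension \<open>Z\<close> of \<open>F\<close>;
  descending along \<open>Z\<close> over \<open>F\<close> over the rational functions in a transcendence basis bounds
  its growth by that of polynomials.
\<close>

lemma products_bound_algebraic:
  fixes j :: "'k::field \<Rightarrow> 'a::division_ring"
  assumes j: "algebra_map j" "range j \<subseteq> F"
    and F: "commuting_set F" "\<forall>a\<in>F. \<forall>b\<in>F. a + b \<in> F" "\<forall>a\<in>F. inverse a \<in> F"
    and xs: "set xs \<subseteq> F" "alg_independent j xs" "\<And>y. y \<in> F \<Longrightarrow> \<not> alg_independent j (xs @ [y])"
    and Z: "commuting_set Z" "F \<subseteq> Z" "\<And>z. z \<in> Z \<Longrightarrow> algebraic_on F z"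
    and B: "finite B" "\<forall>b\<in>B. \<forall>z\<in>Z. b * z = z * b"
    and W: "finite W" "1 \<in> W" "\<forall>b\<in>B. \<forall>w\<in>W. b * w \<in> lspan Z W"
  shows "\<exists>C. \<forall>n. \<exists>T. finite T \<and> card T \<le> C * (n + 1) ^ length xs \<and>
    k_algebra.products B n \<subseteq> span_over j T"
proof -
  interpret division_k_algebra j F xs
    by unfold_locales (use j F xs in auto)
  note cs = F(1)[unfolded commuting_set_def] Z(1)[unfolded commuting_set_def]
  obtain W1 where W1: "finite W1" "1 \<in> W1" "\<forall>b\<in>B. \<forall>w\<in>W1. b * w \<in> lspan F W1"
    using finite_module_descent[of Z F B W] cs Z(2,3) B W by blast
  have BF: "\<forall>b\<in>B. \<forall>g\<in>F. b * g = g * b" using B(2) Z(2) by blast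
  have "\<exists>W2. finite W2 \<and> 1 \<in> W2 \<and> (\<forall>b\<in>B. \<forall>w\<in>W2. b * w \<in> lspan fractions W2)"
  proof (rule finite_module_descent[of F fractions B W1])
    show "1 \<in> F" "\<forall>a\<in>F. \<forall>b\<in>F. a * b \<in> F \<and> a * b = b * a" using cs(1) by blast+
    show "fractions \<subseteq> F" "1 \<in> fractions" "\<forall>a\<in>fractions. \<forall>b\<in>fractions. a * b \<in> fractions"
      using fractions_subset fractions_1 fractions_mult by blast+
    show "algebraic_on fractions y" if "y \<in> F" for y
      by (rule algebraic_over_fractions[OF xs(2) xs(3)[OF that] that])
  qed (use B(1) BF W1 in auto)
  then obtain W2 where "finite W2" "1 \<in> W2" "\<forall>b\<in>B. \<forall>w\<in>W2. b * w \<in> lspan fractions W2"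
    by blast
  from products_bound[OF B(1) BF this] show ?thesis by (simp add: span_over_eq)
qed

section \<open>Division subrings of finite dimensional division algebras\<close>

definition division_subring :: "'a::division_ring set \<Rightarrow> bool" where
  "division_subring A \<longleftrightarrow> is_subring A \<and> (\<forall>a\<in>A. inverse a \<in> A)"

lemma commutes_inverse:
  fixes a :: "'a::division_ring"
  assumes "z * a = a * z"
  shows "inverse z * a = a * inverse z"
proof (cases "z = 0")
  case False
  then have "inverse z * a = inverse z * (a * z) * inverse z" by (simp add: mult.assoc)
  also have "\<dots> = a * inverse z"
    unfolding assms[symmetric] using False by (simp add: mult.assoc[symmetric])
  finally show ?thesis .
qed simp

lemma center_of_division_subring:
  assumes "division_subring A"
  shows "division_subring (center_of A)" "commuting_set (center_of A)"
proof -
  have A: "is_subring A" "\<And>a. a \<in> A \<Longrightarrow> inverse a \<in> A"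
    using assms by (auto simp: division_subring_def)
  have m: "a * b \<in> center_of A" if ab: "a \<in> center_of A" "b \<in> center_of A" for a b
  proof -
    have "a * b * x = x * (a * b)" if "x \<in> A" for x
    proof -
      have "b * x = x * b" "a * x = x * a"
        using that ab by (simp_all add: center_of_def)
      then show ?thesis by (metis mult.assoc)
    qed
    moreover have "a * b \<in> A"
      using ab by (intro is_subring_mult[OF A(1)]) (simp_all add: center_of_def)
    ultimately show ?thesis by (simp add: center_of_def)
  qed
  have one: "1 \<in> center_of A" using A is_subring_1 by (auto simp: center_of_def)
  have "a - b \<in> center_of A" if "a \<in> center_of A" "b \<in> center_of A" for a b
    using that is_subring_diff[OF A(1)]
    by (simp add: center_of_def left_diff_distrib right_diff_distrib)
  then have "is_subring (center_of A)"
    using m one by (auto simp: is_subring_def)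
  moreover have "inverse a \<in> center_of A" if "a \<in> center_of A" for a
    using that A(2) by (simp add: center_of_def commutes_inverse)
  ultimately show "division_subring (center_of A)" by (auto simp: division_subring_def)
  have "a * b = b * a" if "a \<in> center_of A" "b \<in> center_of A" for a b
    using that unfolding center_of_def by blast
  then show "commuting_set (center_of A)" using m one unfolding commuting_set_def by (intro conjI ballI)
qed

text \<open>
  A shortest relation, normalised to have one coefficient \<open>1\<close>, is shortened by
  commutators with elements of \<open>A\<close> unless all its coefficients are central.
\<close>

lemma centralizer_relation:
  fixes A :: "'a::division_ring set"
  assumes A: "division_subring A"
    and "finite I" "\<And>i x. i \<in> I \<Longrightarrow> x \<in> A \<Longrightarrow> c i * x = x * c i"
    and "\<And>i. i \<in> I \<Longrightarrow> f i \<in> A" "(\<Sum>i\<in>I. c i * f i) = 0" "\<exists>i\<in>I. f i \<noteq> 0"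
  shows "\<exists>z. (\<forall>i\<in>I. z i \<in> center_of A) \<and> (\<exists>i\<in>I. z i \<noteq> 0) \<and> (\<Sum>i\<in>I. c i * z i) = 0"
  using assms(2-)
proof (induction "card I" arbitrary: I f rule: less_induct)
  case less
  have sub: "is_subring A" and inv: "\<And>a. a \<in> A \<Longrightarrow> inverse a \<in> A"
    using A by (auto simp: division_subring_def)
  obtain i0 where i0: "i0 \<in> I" "f i0 \<noteq> 0" using less.prems by blast
  define g where "g i = f i * inverse (f i0)" for i
  have gA: "g i \<in> A" if "i \<in> I" for i
    unfolding g_def using less.prems(3) that i0 sub inv by (intro is_subring_mult) auto
  have g0: "g i0 = 1" using i0 by (simp add: g_def)
  have g_sum: "(\<Sum>i\<in>I. c i * g i) = 0"
    using less.prems(4) by (simp add: g_def mult.assoc[symmetric] sum_distrib_right[symmetric])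
  show ?case
  proof (cases "\<forall>i\<in>I. g i \<in> center_of A")
    case True
    then show ?thesis using g_sum g0 i0(1) by (intro exI[of _ g] conjI bexI[of _ i0]) auto
  next
    case False
    then obtain i1 x where x: "i1 \<in> I" "x \<in> A" "g i1 * x \<noteq> x * g i1"
      using gA by (auto simp: center_of_def)
    define h where "h i = g i * x - x * g i" for i
    have hA: "h i \<in> A" if "i \<in> I" for i
      unfolding h_def using gA that x sub by (intro is_subring_diff is_subring_mult) auto
    \<comment> \<open>Each \<open>c i\<close> commutes with \<open>x\<close>, so the commutator of
      the relation with \<open>x\<close> is a relation again. It loses the index \<open>i0\<close>,
      where \<open>g\<close> is 1.\<close>
    have "(\<Sum>i\<in>I. c i * h i) = (\<Sum>i\<in>I. c i * g i) * x - x * (\<Sum>i\<in>I. c i * g i)"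
      unfolding sum_distrib_left sum_distrib_right sum_subtractf[symmetric] h_def right_diff_distrib
    proof (intro sum.cong refl)
      fix i assume "i \<in> I"
      then have "c i * x = x * c i" using less.prems(2) x(2) by blast
      then show "c i * (g i * x) - c i * (x * g i) = c i * g i * x - x * (c i * g i)"
        by (metis mult.assoc)
    qed
    also have "\<dots> = 0" by (simp add: g_sum)
    finally have h_sum: "(\<Sum>i\<in>I. c i * h i) = 0" .
    have h0: "h i0 = 0" by (simp add: h_def g0)
    have "(\<Sum>i\<in>I - {i0}. c i * h i) = 0"
      using h_sum sum.remove[OF less.prems(1) i0(1), of "\<lambda>i. c i * h i"] h0 by simp
    moreover have "\<exists>i\<in>I - {i0}. h i \<noteq> 0"
    proof
      show "h i1 \<noteq> 0" using x(3) by (simp add: h_def)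
      then show "i1 \<in> I - {i0}" using x(1) h0 by auto
    qed
    moreover have "finite (I - {i0})" using less.prems(1) by simp
    moreover have "card (I - {i0}) < card I"
      using less.prems(1) i0(1) by (rule card_Diff1_less)
    ultimately obtain z where z: "\<forall>i\<in>I - {i0}. z i \<in> center_of A" "\<exists>i\<in>I - {i0}. z i \<noteq> 0"
      "(\<Sum>i\<in>I - {i0}. c i * z i) = 0"
      using less.hyps[of "I - {i0}" h] less.prems(2) hA by blast
    define z' where "z' = z(i0 := 0)"
    have "0 \<in> center_of A"
      using center_of_division_subring(1)[OF A] is_subring_0 by (auto simp: division_subring_def)
    then have "\<forall>i\<in>I. z' i \<in> center_of A" using z(1) by (auto simp: z'_def)
    moreover have "\<exists>i\<in>I. z' i \<noteq> 0" using z(2) by (auto simp: z'_def)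
    moreover have "(\<Sum>i\<in>I. c i * z' i) = (\<Sum>i\<in>I - {i0}. c i * z i)"
      using less.prems(1) i0(1) by (subst sum.remove[of _ i0]) (auto simp: z'_def intro!: sum.cong)
    ultimately show ?thesis using z(3) by (intro exI[of _ z']) auto
  qed
qed

text \<open>This is linear disjointness of \<open>A\<close> and its centralizer over the centre of
  \<open>A\<close>. By \<open>centralizer_relation\<close> the coefficients \<open>c\<close> satisfy
  a relation with central coefficients, and eliminating one of them shortens the given
  relation.\<close>

lemma center_relation:
  fixes A :: "'a::division_ring set"
  assumes A: "division_subring A"
    and "finite I" "\<And>i x. i \<in> I \<Longrightarrow> x \<in> A \<Longrightarrow> c i * x = x * c i" "\<exists>i\<in>I. c i \<noteq> 0"
    and "\<And>i. i \<in> I \<Longrightarrow> f i \<in> A" "(\<Sum>i\<in>I. c i * f i) = 0"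
  shows "\<exists>z. (\<forall>i\<in>I. z i \<in> center_of A) \<and> (\<exists>i\<in>I. z i \<noteq> 0) \<and> (\<Sum>i\<in>I. z i * f i) = 0"
  using assms(2-)
proof (induction "card I" arbitrary: I f rule: less_induct)
  case less
  have Z: "is_subring (center_of A)" and invZ: "\<And>a. a \<in> center_of A \<Longrightarrow> inverse a \<in> center_of A"
    using center_of_division_subring(1)[OF A] by (auto simp: division_subring_def)
  have ZA: "center_of A \<subseteq> A" by (auto simp: center_of_def)
  have sub: "is_subring A" using A by (auto simp: division_subring_def)
  show ?case
  proof (cases "\<exists>i\<in>I. f i = 0")
    case True
    then obtain i where i: "i \<in> I" "f i = 0" by blast
    \<comment> \<open>A vanishing element gives the relation with coefficient 1 at its index and 0
      elsewhere.\<close>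
    have "(\<Sum>k\<in>I. (if k = i then 1 else 0) * f k) = 0"
      by (rule sum.neutral) (use i in auto)
    then show ?thesis
      using i Z is_subring_0 is_subring_1 by (intro exI[of _ "\<lambda>k. if k = i then 1 else 0"]) auto
  next
    case False
    then have "\<exists>i\<in>I. f i \<noteq> 0" using less.prems(3) by blast
    then obtain z where z: "\<forall>i\<in>I. z i \<in> center_of A" "\<exists>i\<in>I. z i \<noteq> 0" "(\<Sum>i\<in>I. c i * z i) = 0"
      using centralizer_relation[OF A less.prems(1,2,4,5)] by blast
    then obtain i0 where i0: "i0 \<in> I" "z i0 \<noteq> 0" by blast
    define w where "w i = z i * inverse (z i0)" for i
    have w: "w i \<in> center_of A" if "i \<in> I" for i
      unfolding w_def using z(1) that i0(1) Z invZ by (intro is_subring_mult) auto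
    have "(\<Sum>i\<in>I. c i * w i) = 0"
      using z(3) by (simp add: w_def mult.assoc[symmetric] sum_distrib_right[symmetric])
    then have c0: "c i0 = - (\<Sum>i\<in>I - {i0}. c i * w i)"
      using sum.remove[OF less.prems(1) i0(1), of "\<lambda>i. c i * w i"] i0(2)
      by (simp add: w_def eq_neg_iff_add_eq_0)
    \<comment> \<open>Replacing \<open>c i0\<close> by its expression in the other coefficients
      turns the relation into one among these elements.\<close>
    define g where "g i = f i - w i * f i0" for i
    have "(\<Sum>i\<in>I - {i0}. c i * g i)
        = (\<Sum>i\<in>I - {i0}. c i * f i) - (\<Sum>i\<in>I - {i0}. c i * w i) * f i0"
      by (simp add: g_def right_diff_distrib sum_subtractf sum_distrib_right mult.assoc)
    also have "\<dots> = (\<Sum>i\<in>I - {i0}. c i * f i) + c i0 * f i0"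
      by (simp add: c0)
    also have "\<dots> = 0"
      using less.prems(5) sum.remove[OF less.prems(1) i0(1), of "\<lambda>i. c i * f i"]
      by (simp add: add.commute)
    finally have g_sum: "(\<Sum>i\<in>I - {i0}. c i * g i) = 0" .
    have c_nz: "\<exists>i\<in>I - {i0}. c i \<noteq> 0"
    proof (rule ccontr)
      assume "\<not> ?thesis"
      then have "c i0 = 0" "\<forall>i\<in>I - {i0}. c i = 0" unfolding c0 by (auto intro!: sum.neutral)
      then show False using less.prems(3) by blast
    qed
    have gA: "g i \<in> A" if "i \<in> I - {i0}" for i
      unfolding g_def using that w ZA less.prems(4) i0(1) sub
      by (intro is_subring_diff is_subring_mult) auto
    have card: "card (I - {i0}) < card I"
      using less.prems(1) i0(1) by (rule card_Diff1_less)
    have "finite (I - {i0})" using less.prems(1) by simp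
    from less.hyps[OF card this _ c_nz gA g_sum] less.prems(2)
    obtain y where y: "\<forall>i\<in>I - {i0}. y i \<in> center_of A" "\<exists>i\<in>I - {i0}. y i \<noteq> 0"
      "(\<Sum>i\<in>I - {i0}. y i * g i) = 0"
      by auto
    \<comment> \<open>Unfolding \<open>g\<close> collects all multiples of \<open>f i0\<close> at
      the index \<open>i0\<close>, with this coefficient.\<close>
    define y' where "y' = y(i0 := - (\<Sum>i\<in>I - {i0}. y i * w i))"
    have "(\<Sum>i\<in>I. y' i * f i) = y' i0 * f i0 + (\<Sum>i\<in>I - {i0}. y i * f i)"
      using less.prems(1) i0(1) by (subst sum.remove[of _ i0]) (auto simp: y'_def intro!: sum.cong)
    also have "\<dots> = (\<Sum>i\<in>I - {i0}. y i * g i)"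
      by (simp add: y'_def g_def right_diff_distrib sum_subtractf sum_distrib_right mult.assoc)
    finally have "(\<Sum>i\<in>I. y' i * f i) = 0" using y(3) by simp
    moreover have "(\<Sum>i\<in>I - {i0}. y i * w i) \<in> center_of A"
      using Z y(1) w by (intro is_subring_sum is_subring_mult) auto
    then have "\<forall>i\<in>I. y' i \<in> center_of A"
      using y(1) is_subring_uminus[OF Z] by (auto simp: y'_def)
    moreover have "\<exists>i\<in>I. y' i \<noteq> 0" using y(2) by (auto simp: y'_def)
    ultimately show ?thesis by blast
  qed
qed

text \<open>Scalars from \<open>'K\<close> centralize \<open>A\<close>, so by
  \<open>center_relation\<close> a set independent over the centre of \<open>A\<close> is
  independent over \<open>'K\<close> and no larger than a finite spanning set. One of greatest size
  spans.\<close>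

lemma finite_over_center:
  fixes \<kappa> :: "'K::field \<Rightarrow> 'd::division_ring"
  assumes "algebra_map \<kappa>" "fd_subspace \<kappa> UNIV" and A: "division_subring (A :: 'd set)"
  shows "\<exists>W. finite W \<and> W \<subseteq> A \<and> A \<subseteq> lspan (center_of A) W"
proof -
  interpret k_algebra \<kappa> by (rule k_algebra.intro) fact
  obtain B where B: "finite B" "UNIV = span B"
    using assms(2) unfolding fd_subspace_def span_over_eq by blast
  have Z: "is_subring (center_of A)" and invZ: "\<And>a. a \<in> center_of A \<Longrightarrow> inverse a \<in> center_of A"
    using center_of_division_subring(1)[OF A] by (auto simp: division_subring_def)
  define ind where "ind T \<longleftrightarrow> finite T \<and> T \<subseteq> A \<and>
    (\<forall>z. (\<forall>t\<in>T. z t \<in> center_of A) \<and> (\<Sum>t\<in>T. z t * t) = 0 \<longrightarrow> (\<forall>t\<in>T. z t = 0))" for T :: "'d set"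
  have bound: "card T \<le> card B" if "ind T" for T
  proof (rule ccontr)
    assume "\<not> card T \<le> card B"
    then have "dependent T" using independent_span_bound[OF B(1), of T] B(2) by auto
    then obtain u v where u: "v \<in> T" "u v \<noteq> 0" "(\<Sum>v\<in>T. \<kappa> (u v) * v) = 0"
      using dependent_finite[of T] \<open>ind T\<close> unfolding ind_def scale_by_def by auto
    have "\<exists>z. (\<forall>i\<in>T. z i \<in> center_of A) \<and> (\<exists>i\<in>T. z i \<noteq> 0) \<and> (\<Sum>i\<in>T. z i * i) = 0"
    proof (rule center_relation[OF A, where c = "\<lambda>t. \<kappa> (u t)"])
      show "\<exists>i\<in>T. \<kappa> (u i) \<noteq> 0" using u(1,2) j_eq_0_iff by auto
      show "\<kappa> (u i) * x = x * \<kappa> (u i)" for i x by (rule j_central)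
    qed (use \<open>ind T\<close> u(3) in \<open>auto simp: ind_def\<close>)
    then show False using \<open>ind T\<close> unfolding ind_def by blast
  qed
  have "ind {}" by (simp add: ind_def)
  then obtain T where T: "ind T" "\<And>T'. ind T' \<Longrightarrow> card T' \<le> card T"
    using ex_has_greatest_nat[of ind "{}" card "Suc (card B)"] bound by (auto simp: less_Suc_eq_le)
  have "x \<in> lspan (center_of A) T" if x: "x \<in> A" for x
  proof (cases "x \<in> T")
    case True
    then show ?thesis using is_subring_1[OF Z] by (intro lspan_base)
  next
    case False
    have fin: "finite T" "T \<subseteq> A" using T(1) by (auto simp: ind_def)
    have "\<not> ind (insert x T)"
      using T(2)[of "insert x T"] False fin by auto
    then obtain z where z: "\<forall>t\<in>insert x T. z t \<in> center_of A" "(\<Sum>t\<in>insert x T. z t * t) = 0"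
      "\<exists>t\<in>insert x T. z t \<noteq> 0"
      using fin x unfolding ind_def by auto
    have sum: "z x * x + (\<Sum>t\<in>T. z t * t) = 0" using z(2) False fin by simp
    have "z x \<noteq> 0"
    proof
      assume "z x = 0"
      then have "\<forall>t\<in>T. z t = 0" using T(1) sum z(1) unfolding ind_def by auto
      with z(3) \<open>z x = 0\<close> show False by blast
    qed
    then have "x = inverse (z x) * (z x * x)" by (simp add: mult.assoc[symmetric])
    also have "z x * x = - (\<Sum>t\<in>T. z t * t)" using sum by (simp add: eq_neg_iff_add_eq_0)
    also have "inverse (z x) * \<dots> = (\<Sum>t\<in>T. - (inverse (z x) * z t) * t)"
      by (simp add: sum_distrib_left sum_negf mult.assoc)
    also have "\<dots> \<in> lspan (center_of A) T"
      using z(1) Z invZ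
      by (intro lspan_sum lspan_scaled is_subring_uminus is_subring_mult) auto
    finally show ?thesis .
  qed
  then show ?thesis using T(1) by (intro exI[of _ T]) (auto simp: ind_def)
qed

section \<open>Evaluation of polynomials at elements of an algebra\<close>

context k_algebra
begin

definition eval :: "'a \<Rightarrow> 'k poly \<Rightarrow> 'a" where
  "eval b p = (\<Sum>i\<le>degree p. j (coeff p i) * b ^ i)"

lemma eval_eq: "degree p \<le> n \<Longrightarrow> eval b p = (\<Sum>i\<le>n. j (coeff p i) * b ^ i)"
  unfolding eval_def by (rule sum.mono_neutral_left) (auto simp: coeff_eq_0 j_0)

lemma eval_0: "eval b 0 = 0"
  by (simp add: eval_def j_0)

lemma eval_add: "eval b (p + q) = eval b p + eval b q"
proof -
  define n where "n = max (degree p) (degree q)"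
  have "degree (p + q) \<le> n" "degree p \<le> n" "degree q \<le> n"
    by (auto simp: n_def intro: degree_add_le)
  then show ?thesis
    by (simp add: eval_eq[where n = n] j_add distrib_right sum.distrib)
qed

lemma eval_smult: "eval b (smult a p) = j a * eval b p"
  by (subst eval_eq[of _ "degree p"]) (auto simp: eval_def j_mult mult.assoc sum_distrib_left)

lemma eval_pCons: "eval b (pCons a p) = j a + b * eval b p"
proof -
  have "eval b (pCons a p) = (\<Sum>i\<le>Suc (degree p). j (coeff (pCons a p) i) * b ^ i)"
    by (rule eval_eq) (rule degree_pCons_le)
  also have "\<dots> = j a + (\<Sum>i\<le>degree p. j (coeff p i) * b ^ Suc i)"
    by (simp only: sum.atMost_Suc_shift) simp
  also have "(\<Sum>i\<le>degree p. j (coeff p i) * b ^ Suc i) = b * eval b p"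
    unfolding eval_def sum_distrib_left
  proof (intro sum.cong refl)
    fix i
    have "j (coeff p i) * b = b * j (coeff p i)" by (rule j_central)
    then show "j (coeff p i) * b ^ Suc i = b * (j (coeff p i) * b ^ i)"
      by (metis mult.assoc power_Suc)
  qed
  finally show ?thesis .
qed

text \<open>The algebra need not be commutative, but central coefficients and the powers of the
  single element \<open>b\<close> commute with each other.\<close>

lemma eval_mult: "eval b (p * q) = eval b p * eval b q"
proof (induction p)
  case 0
  show ?case by (simp add: eval_0)
next
  case (pCons a p)
  then show ?case
    by (simp add: eval_add eval_smult eval_pCons j_0 distrib_right mult.assoc)
qed

lemma eval_sum: "eval b (sum f I) = (\<Sum>i\<in>I. eval b (f i))"
  by (induction I rule: infinite_finite_induct) (auto simp: eval_0 eval_add)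

lemma eval_const: "eval b [:a:] = j a"
  by (simp add: eval_pCons eval_0)

lemma eval_scalar: "eval (j c) p = j (poly p c)"
  by (induction p) (auto simp: eval_0 eval_pCons j_0 j_add j_mult)

lemma eval_pcompose: "eval b (pcompose p q) = eval (eval b q) p"
proof (induction p)
  case 0
  show ?case by (simp add: eval_0)
next
  case (pCons a p)
  then show ?case
    by (simp add: pcompose_pCons eval_add eval_const eval_mult eval_pCons eval_0)
qed

end

section \<open>Integrality over a subring of a field\<close>

definition coeffs_in :: "'a::comm_ring_1 set \<Rightarrow> 'a poly \<Rightarrow> bool" where
  "coeffs_in P p \<longleftrightarrow> (\<forall>i. coeff p i \<in> P)"

lemma coeffs_in_0: "is_subring P \<Longrightarrow> coeffs_in P 0"
  by (simp add: coeffs_in_def is_subring_0)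

lemma coeffs_in_1: "is_subring P \<Longrightarrow> coeffs_in P 1"
  by (simp add: coeffs_in_def is_subring_0 is_subring_1)

lemma coeffs_in_pCons: "is_subring P \<Longrightarrow> a \<in> P \<Longrightarrow> coeffs_in P p \<Longrightarrow> coeffs_in P (pCons a p)"
  by (simp add: coeffs_in_def coeff_pCons split: nat.split)

lemma coeffs_in_add: "is_subring P \<Longrightarrow> coeffs_in P p \<Longrightarrow> coeffs_in P q \<Longrightarrow> coeffs_in P (p + q)"
  by (simp add: coeffs_in_def is_subring_add)

lemma coeffs_in_uminus: "is_subring P \<Longrightarrow> coeffs_in P p \<Longrightarrow> coeffs_in P (- p)"
  by (simp add: coeffs_in_def is_subring_uminus)

lemma coeffs_in_mult: "is_subring P \<Longrightarrow> coeffs_in P p \<Longrightarrow> coeffs_in P q \<Longrightarrow> coeffs_in P (p * q)"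
  by (simp add: coeffs_in_def coeff_mult is_subring_sum is_subring_mult)

lemma coeffs_in_sum:
  "is_subring P \<Longrightarrow> (\<And>i. i \<in> I \<Longrightarrow> coeffs_in P (f i)) \<Longrightarrow> coeffs_in P (sum f I)"
  by (induction I rule: infinite_finite_induct) (auto intro: coeffs_in_0 coeffs_in_add)

lemma coeffs_in_prod:
  "is_subring P \<Longrightarrow> (\<And>i. i \<in> I \<Longrightarrow> coeffs_in P (f i)) \<Longrightarrow> coeffs_in P (prod f I)"
  by (induction I rule: infinite_finite_induct) (auto intro: coeffs_in_1 coeffs_in_mult)

text \<open>The Leibniz expansion of the determinant applies only ring operations to the
  entries.\<close>

lemma coeffs_in_char_poly:
  assumes P: "is_subring P" and M: "M \<in> carrier_mat n n"
    "\<And>i k. i < n \<Longrightarrow> k < n \<Longrightarrow> M $$ (i, k) \<in> P"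
  shows "coeffs_in P (char_poly M)"
proof -
  have entry: "coeffs_in P (char_poly_matrix M $$ (i, k))" if "i < n" "k < n" for i k
    using that M is_subring_0[OF P] is_subring_1[OF P] unfolding char_poly_matrix_def
    by (auto intro!: coeffs_in_add[OF P] coeffs_in_pCons[OF P] coeffs_in_0[OF P] coeffs_in_1[OF P]
        is_subring_uminus[OF P])
  have "coeffs_in P (signof p * (\<Prod>i = 0..<n. char_poly_matrix M $$ (i, p i)))"
    if p: "p permutes {0..<n}" for p
  proof -
    have "coeffs_in P (\<Prod>i = 0..<n. char_poly_matrix M $$ (i, p i))"
      using entry permutes_in_image[OF p] by (intro coeffs_in_prod[OF P]) auto
    then show ?thesis
      by (cases p rule: sign_cases) (auto intro: coeffs_in_uminus[OF P])
  qed
  moreover have "char_poly_matrix M \<in> carrier_mat n n" using M(1) by simp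
  ultimately show ?thesis
    unfolding char_poly_def by (subst det_def') (auto intro!: coeffs_in_sum[OF P])
qed

context k_algebra
begin

text \<open>The determinant trick, with the adjugate of the characteristic matrix.\<close>

lemma monic_annihilator:
  assumes P: "is_subring P" and A: "finite A" "\<And>a. a \<in> A \<Longrightarrow> b * a \<in> lspan (j ` P) A"
  shows "\<exists>p. lead_coeff p = 1 \<and> coeffs_in P p \<and> (\<forall>a\<in>A. eval b p * a = 0)"
proof -
  have "\<exists>c. (\<forall>w. c w \<in> P) \<and> b * a = (\<Sum>w\<in>A. j (c w) * w)" if "a \<in> A" for a
  proof -
    have "\<exists>c. (\<forall>w. c w \<in> j ` P) \<and> b * a = (\<Sum>w\<in>A. c w * w)"
    proof (rule lspan_coeffs[OF A(2)[OF that] A(1)])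
      show "0 \<in> j ` P" using is_subring_0[OF P] j_0 by (metis image_eqI)
      show "\<forall>a\<in>j ` P. \<forall>b\<in>j ` P. a + b \<in> j ` P"
        using is_subring_add[OF P] by (auto simp: j_add[symmetric])
    qed
    then obtain c where c: "\<And>w. c w \<in> j ` P" "b * a = (\<Sum>w\<in>A. c w * w)" by blast
    have "\<forall>w. \<exists>d. d \<in> P \<and> c w = j d" using c(1) by blast
    from choice[OF this] obtain d where d: "\<And>w. d w \<in> P" "\<And>w. c w = j (d w)" by blast
    show ?thesis using d(1) c(2) unfolding d(2) by blast
  qed
  then have "\<forall>a\<in>A. \<exists>c. (\<forall>w. c w \<in> P) \<and> b * a = (\<Sum>w\<in>A. j (c w) * w)" by blast
  from bchoice[OF this] obtain c where cP: "\<And>a w. a \<in> A \<Longrightarrow> c a w \<in> P"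
    and c: "\<And>a. a \<in> A \<Longrightarrow> b * a = (\<Sum>w\<in>A. j (c a w) * w)"
    by blast
  obtain as where as: "set as = A" "distinct as" using finite_distinct_list[OF A(1)] by blast
  define n where "n = length as"
  have as_in: "as ! i \<in> A" if "i < n" for i using that as(1) by (auto simp: n_def)
  have sum_as: "(\<Sum>w\<in>A. f w) = (\<Sum>i<n. f (as ! i))" for f :: "'a \<Rightarrow> 'a"
    using sum.reindex_bij_betw[OF bij_betw_nth[OF as(2) _ as(1)[symmetric]], of "{..<n}" f]
    by (simp add: n_def)
  define M where "M = mat n n (\<lambda>(i, k). c (as ! i) (as ! k))"
  have M: "M \<in> carrier_mat n n" by (simp add: M_def)
  define C where "C = char_poly_matrix M"
  have C: "C \<in> carrier_mat n n" using M by (simp add: C_def)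
  have C_entry: "C $$ (i, k) = (if i = k then [:0, 1:] else 0) + [:- c (as ! i) (as ! k):]"
    if "i < n" "k < n" for i k
    using that M unfolding C_def char_poly_matrix_def by (simp add: M_def)
  \<comment> \<open>Evaluated at \<open>b\<close>, the characteristic matrix annihilates the vector
    \<open>as\<close> listing \<open>A\<close>. The adjugate is formed over the commutative ring of
    polynomials, and the homomorphism \<open>eval b\<close> then transports its identity to the
    algebra.\<close>
  have row: "(\<Sum>k<n. eval b (C $$ (i, k)) * as ! k) = 0" if i: "i < n" for i
  proof -
    have "(\<Sum>k<n. eval b (C $$ (i, k)) * as ! k)
        = (\<Sum>k<n. (if i = k then b * as ! k else 0) - j (c (as ! i) (as ! k)) * as ! k)"
      using i by (intro sum.cong refl)
        (auto simp: C_entry eval_add eval_const eval_pCons eval_0 j_0 j_1 j_uminus distrib_right left_diff_distrib)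
    also have "\<dots> = b * as ! i - (\<Sum>w\<in>A. j (c (as ! i) w) * w)"
      using i by (simp add: sum_subtractf sum_as)
    finally show ?thesis using c[OF as_in[OF i]] by simp
  qed
  define p where "p = char_poly M"
  have ann: "eval b p * as ! l = 0" if l: "l < n" for l
  proof -
    define J where "J = adj_mat C"
    have J: "J \<in> carrier_mat n n" "J * C = p \<cdot>\<^sub>m 1\<^sub>m n"
      using adj_mat[OF C] by (auto simp: J_def p_def char_poly_def C_def)
    have entry: "(\<Sum>i<n. J $$ (l, i) * C $$ (i, k)) = (if l = k then p else 0)" if "k < n" for k
    proof -
      have "(J * C) $$ (l, k) = (\<Sum>i<n. J $$ (l, i) * C $$ (i, k))"
        using J(1) C l that by (auto simp: scalar_prod_def atLeast0LessThan intro!: sum.cong)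
      then show ?thesis unfolding J(2) using l that by (cases "l = k") auto
    qed
    have "eval b p * as ! l = (\<Sum>k<n. eval b (if l = k then p else 0) * as ! k)"
      using l by (simp add: if_distrib[of "eval b"] if_distrib[of "\<lambda>x. x * _"] eval_0 cong: if_cong)
    also have "\<dots> = (\<Sum>k<n. \<Sum>i<n. eval b (J $$ (l, i)) * (eval b (C $$ (i, k)) * as ! k))"
      by (intro sum.cong refl)
        (simp add: entry[symmetric] eval_sum eval_mult sum_distrib_right mult.assoc)
    also have "\<dots> = (\<Sum>i<n. eval b (J $$ (l, i)) * (\<Sum>k<n. eval b (C $$ (i, k)) * as ! k))"
      by (subst sum.swap) (simp add: sum_distrib_left)
    also have "\<dots> = 0" using row by simp
    finally show ?thesis .
  qed
  have "lead_coeff p = 1" using degree_monic_char_poly[OF M] by (simp add: p_def)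
  moreover have "coeffs_in P p"
    unfolding p_def by (rule coeffs_in_char_poly[OF P M]) (auto simp: M_def intro!: cP as_in)
  moreover have "eval b p * a = 0" if "a \<in> A" for a
    using that ann as(1) by (metis in_set_conv_nth n_def)
  ultimately show ?thesis by blast
qed

end

lemma eval_to_ac:
  "k_algebra.eval to_ac r p = poly (map_poly to_ac p) r"
proof -
  interpret k_algebra to_ac by unfold_locales (simp add: algebra_map_def mult.commute)
  show ?thesis by (induction p) (auto simp: eval_0 eval_pCons map_poly_pCons)
qed

text \<open>
  The roots of the factor are integral, hence so are its coefficients, which are
  polynomials in the roots.
\<close>

lemma coeffs_in_monic_factor:
  fixes p q :: "'K::field poly"
  assumes P: "is_subring P" "\<And>a. integral_over P a \<Longrightarrow> a \<in> P"
    and q: "lead_coeff q = 1" "coeffs_in P q"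
    and p: "lead_coeff p = 1" "p dvd q"
  shows "coeffs_in P p"
proof -
  let ?h = "map_poly to_ac :: 'K poly \<Rightarrow> 'K alg_closure poly"
  interpret k_algebra "to_ac :: 'K \<Rightarrow> 'K alg_closure"
    by unfold_locales (simp add: algebra_map_def mult.commute)
  have hom: "?h (f * g) = ?h f * ?h g" for f g
    by (rule poly_eqI) (simp add: coeff_map_poly coeff_mult to_ac_sum)
  have "degree (?h p) = degree p" by (rule degree_map_poly) simp
  then have lead: "lead_coeff (?h p) = 1" using p(1) by (simp add: coeff_map_poly)
  then have "?h p \<noteq> 0" by auto
  then obtain R where R: "?h p = smult (lead_coeff (?h p)) (\<Prod>x\<in>#R. [:-x, 1:])"
    using alg_closed_imp_factorization by blast
  then have R: "?h p = (\<Prod>x\<in>#R. [:-x, 1:])" by (simp only: lead smult_1_left)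
  let ?Q = "to_ac ` P"
  have Q: "1 \<in> ?Q" "\<forall>a\<in>?Q. \<forall>b\<in>?Q. a * b \<in> ?Q"
    using is_subring_1[OF P(1)] is_subring_mult[OF P(1)] by (auto simp: to_ac_mult[symmetric] image_iff simp del: to_ac_mult intro!: bexI[of _ 1])
  have alg: "algebraic_on ?Q r" if r: "r \<in># R" for r
  proof -
    have "[:-r, 1:] dvd ?h p" unfolding R using r by (auto intro: dvd_prod_mset)
    then have "[:-r, 1:] dvd ?h q" using p(2) hom by (metis dvd_def dvd_trans)
    then have "poly (?h q) r = 0" by (simp add: poly_eq_0_iff_dvd)
    then have "(\<Sum>i\<le>degree q. to_ac (coeff q i) * r ^ i) = 0"
      unfolding eval_to_ac[symmetric] eval_def .
    then have "r ^ degree q = - (\<Sum>i<degree q. to_ac (coeff q i) * r ^ i)"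
      using q(1) by (simp add: lessThan_Suc_atMost[symmetric] eq_neg_iff_add_eq_0 add.commute)
    then have "r ^ degree q = (\<Sum>i<degree q. to_ac (- coeff q i) * r ^ i)"
      by (simp add: sum_negf)
    moreover have "to_ac (- coeff q i) \<in> ?Q" for i
      using q(2) is_subring_uminus[OF P(1)] by (auto simp: coeffs_in_def simp del: to_ac_minus)
    ultimately show ?thesis
      unfolding algebraic_on_def
      by (intro exI[of _ "degree q"] exI[of _ "\<lambda>i. to_ac (- coeff q i)"]) simp
  qed
  have "\<exists>A. finite A \<and> A \<subseteq> UNIV \<and> 1 \<in> A \<and> (\<forall>s\<in>set_mset R. \<forall>a\<in>A. s * a \<in> lspan ?Q A)"
    using alg Q by (intro finite_extension) (auto simp: mult.commute)
  then obtain A where A: "finite A" "1 \<in> A" "\<forall>s\<in>set_mset R. \<forall>a\<in>A. s * a \<in> lspan ?Q A"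
    by blast
  \<comment> \<open>The ring of multipliers of the module spanned by \<open>A\<close>. It contains
    every root in \<open>R\<close>, hence the coefficients of the factor, and the determinant trick
    makes each of its elements integral.\<close>
  define T where "T = {y. \<forall>a\<in>A. y * a \<in> lspan ?Q A}"
  have T1: "1 \<in> T" using lspan_base[OF Q(1)] by (simp add: T_def)
  have Tmult: "x * y \<in> T" if "x \<in> T" "y \<in> T" for x y
  proof -
    have "x * (y * a) \<in> lspan ?Q A" if a: "a \<in> A" for a
    proof (rule lspan_mult_left[of _ ?Q A])
      show "y * a \<in> lspan ?Q A" using \<open>y \<in> T\<close> a by (simp add: T_def)
      fix g w assume gw: "g \<in> ?Q" "w \<in> A"
      have "x * w \<in> lspan ?Q A" using \<open>x \<in> T\<close> gw(2) by (simp add: T_def)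
      then have "g * (x * w) \<in> lspan ?Q A" using Q(2) gw(1) by (rule lspan_scale)
      then show "x * (g * w) \<in> lspan ?Q A" by (simp only: ac_simps)
    qed
    then show ?thesis by (simp add: T_def mult.assoc)
  qed
  have neg: "- 1 \<in> ?Q"
    using is_subring_uminus[OF P(1) is_subring_1[OF P(1)]] by (metis image_eqI to_ac_1 to_ac_minus)
  have Tsub: "x - y \<in> T" if "x \<in> T" "y \<in> T" for x y
  proof -
    have "x * a + (- 1) * (y * a) \<in> lspan ?Q A" if a: "a \<in> A" for a
    proof -
      have "x * a \<in> lspan ?Q A" "y * a \<in> lspan ?Q A"
        using \<open>x \<in> T\<close> \<open>y \<in> T\<close> a by (auto simp: T_def)
      then show ?thesis using lspan_scale[OF _ Q(2) neg] by (intro lspan_add) auto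
    qed
    then show ?thesis by (simp add: T_def left_diff_distrib)
  qed
  have T: "is_subring T" using T1 Tmult Tsub by (auto simp: is_subring_def)
  have "set_mset S \<subseteq> T \<Longrightarrow> coeffs_in T (\<Prod>x\<in>#S. [:-x, 1:])" for S
  proof (induction S)
    case empty
    show ?case using coeffs_in_1[OF T] by simp
  next
    case (add x S)
    have "coeffs_in T [:-x, 1:]"
      using add.prems T1 by (intro coeffs_in_pCons[OF T] coeffs_in_0[OF T] is_subring_uminus[OF T]) auto
    moreover have "coeffs_in T (\<Prod>x\<in>#S. [:-x, 1:])" using add by simp
    ultimately have "coeffs_in T ([:-x, 1:] * (\<Prod>x\<in>#S. [:-x, 1:]))" by (rule coeffs_in_mult[OF T])
    then show ?case by (simp only: image_mset_add_mset prod_mset.add_mset)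
  qed
  then have coeffs_T: "coeffs_in T (?h p)" unfolding R using A(3) by (auto simp: T_def)
  have "coeff p i \<in> P" for i
  proof (rule P(2))
    have "to_ac (coeff p i) \<in> T"
      using coeffs_T by (simp add: coeffs_in_def coeff_map_poly)
    then obtain f where f: "lead_coeff f = 1" "coeffs_in P f" "\<forall>a\<in>A. eval (to_ac (coeff p i)) f * a = 0"
      using monic_annihilator[OF P(1) A(1), of "to_ac (coeff p i)"] by (auto simp: T_def)
    \<comment> \<open>As 1 lies in \<open>A\<close>, annihilating \<open>A\<close> means being
      zero.\<close>
    then have "to_ac (poly f (coeff p i)) = 0" using A(2) by (auto simp: eval_scalar)
    then show "integral_over P (coeff p i)"
      unfolding integral_over_def using f(1,2) by (auto simp: coeffs_in_def)
  qed
  then show ?thesis by (simp add: coeffs_in_def)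
qed

section \<open>Degree zero fractions of a graded order\<close>

lemma single_in_graded_iff:
  assumes "\<And>l. 0 \<in> R l"
  shows "Poly_Mapping.single l s \<in> {p. \<forall>l. Poly_Mapping.lookup p l \<in> R l} \<longleftrightarrow> s \<in> R l"
  using assms by (auto simp: Poly_Mapping.lookup_single Poly_Mapping.when_def)

lemma degree_zero_fractions_graded:
  assumes "\<And>l. 0 \<in> R l"
  shows "degree_zero_fractions {p. \<forall>l. Poly_Mapping.lookup p l \<in> R l}
    = {inverse s * a | s a l. s \<noteq> 0 \<and> s \<in> R l \<and> a \<in> R l}"
  unfolding degree_zero_fractions_def single_in_graded_iff[OF assms] ..

text \<open>The component of degree \<open>l\<close> is stored as the set of coefficients allowed at
  the \<open>l\<close>-th power of the grading variable, so one element of \<open>'a\<close> can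
  belong to several degrees.\<close>

locale graded_ring =
  fixes R :: "nat \<Rightarrow> 'a::ring_1 set"
  assumes one: "1 \<in> R 0"
    and diff: "a \<in> R l \<Longrightarrow> b \<in> R l \<Longrightarrow> a - b \<in> R l"
    and mult: "a \<in> R l \<Longrightarrow> b \<in> R m \<Longrightarrow> a * b \<in> R (l + m)"
    and zero: "0 \<in> R l"
begin

lemma uminus: "a \<in> R l \<Longrightarrow> - a \<in> R l"
  using diff[OF zero, of a l] by simp

lemma add: "a \<in> R l \<Longrightarrow> b \<in> R l \<Longrightarrow> a + b \<in> R l"
  using diff[of a l "- b"] uminus[of b] by simp

lemma sum: "(\<And>i. i \<in> I \<Longrightarrow> f i \<in> R l) \<Longrightarrow> sum f I \<in> R l"
  by (induction I rule: infinite_finite_induct) (auto intro: zero add)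

lemma power: "a \<in> R l \<Longrightarrow> a ^ n \<in> R (l * n)"
  by (induction n) (auto intro: one mult)

end

text \<open>Normality enters in the form of the axiom \<open>minimal_polynomial\<close>: when the
  variable has the degree \<open>l\<close> of \<open>s\<close>, the minimal polynomial is
  homogeneous of degree \<open>l\<close> times its ordinary degree.\<close>

locale graded_order = R: graded_ring R + S: graded_ring S + k_algebra \<kappa>
  for R :: "nat \<Rightarrow> 'K::field set" and S :: "nat \<Rightarrow> 'd::division_ring set"
    and \<kappa> :: "'K \<Rightarrow> 'd" +
  assumes scalars: "\<And>a l. a \<in> R l \<Longrightarrow> \<kappa> a \<in> S l"
    and minimal_polynomial: "\<And>s l. s \<in> S l \<Longrightarrow> \<exists>p. lead_coeff p = 1 \<and> eval s p = 0
      \<and> (\<forall>q. q \<noteq> 0 \<and> eval s q = 0 \<longrightarrow> degree p \<le> degree q)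
      \<and> (\<forall>i\<le>degree p. coeff p i \<in> R (l * (degree p - i)))"
begin

definition F :: "'K set" where
  "F = {inverse s * a | s a l. s \<noteq> 0 \<and> s \<in> R l \<and> a \<in> R l}"

definition \<Delta> :: "'d set" where
  "\<Delta> = {inverse s * a | s a l. s \<noteq> 0 \<and> s \<in> S l \<and> a \<in> S l}"

lemma \<kappa>_inverse: "\<kappa> (inverse c) = inverse (\<kappa> c)"
proof (cases "c = 0")
  case False
  then have "\<kappa> c * \<kappa> (inverse c) = 1" by (simp add: j_mult[symmetric] j_1)
  then show ?thesis by (metis inverse_unique)
qed (simp add: j_0)

lemma \<kappa>_eq_0_iff: "\<kappa> c = 0 \<longleftrightarrow> c = 0"
  by (simp add: j_eq_0_iff)

lemma inverse_\<kappa>_central: "inverse (\<kappa> c) * x = x * inverse (\<kappa> c)"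
  using j_central[of "inverse c" x] by (simp add: \<kappa>_inverse)

text \<open>The minimal polynomial turns a denominator into a central one.\<close>

lemma central_denominator:
  assumes "z \<in> \<Delta>"
  obtains c a m where "c \<noteq> 0" "c \<in> R m" "a \<in> S m" "z = inverse (\<kappa> c) * a"
proof -
  obtain s a l where z: "s \<noteq> 0" "s \<in> S l" "a \<in> S l" "z = inverse s * a"
    using assms unfolding \<Delta>_def by blast
  obtain p where p: "lead_coeff p = 1" "eval s p = 0"
    "\<And>q. q \<noteq> 0 \<Longrightarrow> eval s q = 0 \<Longrightarrow> degree p \<le> degree q"
    "\<And>i. i \<le> degree p \<Longrightarrow> coeff p i \<in> R (l * (degree p - i))"
    using minimal_polynomial[OF z(2)] by blast
  \<comment> \<open>Splitting off the constant term, p = c + x q, gives s (- q(s)) = c. Minimality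
    of \<open>p\<close> makes \<open>c\<close> nonzero, so the inverse of \<open>s\<close> is the
    homogeneous element - q(s) divided by the central \<open>c\<close>.\<close>
  obtain c q where pq: "p = pCons c q" by (cases p)
  have q0: "q \<noteq> 0"
  proof
    assume "q = 0"
    then have "eval s p = 1" using p(1) pq by (simp add: eval_const j_1)
    then show False using p(2) by simp
  qed
  then have deg: "degree p = Suc (degree q)" by (simp add: pq)
  have rel: "\<kappa> c + s * eval s q = 0" using p(2) by (simp add: pq eval_pCons)
  have c0: "c \<noteq> 0"
  proof
    assume "c = 0"
    then have "eval s q = 0" using rel z(1) by (simp add: j_0)
    then show False using p(3)[OF q0] deg by simp
  qed
  define t where "t = - eval s q"
  have st: "s * t = \<kappa> c" using rel by (simp add: t_def add_eq_0_iff)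
  have "eval s q \<in> S (l * degree q)"
    unfolding eval_def
  proof (rule S.sum)
    fix i assume i: "i \<in> {..degree q}"
    have "coeff q i \<in> R (l * (degree q - i))"
      using p(4)[of "Suc i"] i by (simp add: deg) (simp add: pq)
    then have "\<kappa> (coeff q i) * s ^ i \<in> S (l * (degree q - i) + l * i)"
      using z(2) by (intro S.mult scalars S.power)
    then show "\<kappa> (coeff q i) * s ^ i \<in> S (l * degree q)"
      using i by (simp add: distrib_left[symmetric])
  qed
  then have "t * a \<in> S (l * degree q + l)"
    unfolding t_def using z(3) by (intro S.mult S.uminus)
  moreover have "c \<in> R (l * degree q + l)"
    using p(4)[of 0] by (simp add: deg) (simp add: pq add.commute)
  moreover have "z = inverse (\<kappa> c) * (t * a)"
  proof -
    have "inverse (\<kappa> c) * (t * a) = t * inverse (\<kappa> c) * a"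
      unfolding mult.assoc[symmetric] inverse_\<kappa>_central[of c t] ..
    also have "t * inverse (\<kappa> c) = inverse s * (s * t) * inverse (\<kappa> c)"
      using z(1) by (simp add: mult.assoc[symmetric])
    also have "\<dots> = inverse s"
      unfolding st using c0 by (simp add: mult.assoc \<kappa>_eq_0_iff)
    finally show ?thesis using z(4) by simp
  qed
  ultimately show thesis using that c0 by blast
qed

lemma \<Delta>I: "c \<noteq> 0 \<Longrightarrow> c \<in> R m \<Longrightarrow> a \<in> S m \<Longrightarrow> inverse (\<kappa> c) * a \<in> \<Delta>"
  unfolding \<Delta>_def using scalars \<kappa>_eq_0_iff by blast

text \<open>Central denominators move past numerators, so fractions are subtracted and multiplied as
  over a commutative ring; this does the work of the Ore condition. For inverses, numerator and
  denominator are exchanged in the original description.\<close>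

lemma division_subring_\<Delta>: "division_subring \<Delta>"
proof -
  have "inverse (\<kappa> 1) * 1 \<in> \<Delta>" by (rule \<Delta>I) (use R.one S.one in auto)
  then have 1: "1 \<in> \<Delta>" by (simp add: j_1)
  have 2: "x - y \<in> \<Delta> \<and> x * y \<in> \<Delta>" if xy: "x \<in> \<Delta>" "y \<in> \<Delta>" for x y
  proof -
    obtain c a m where x: "c \<noteq> 0" "c \<in> R m" "a \<in> S m" "x = inverse (\<kappa> c) * a"
      using central_denominator[OF xy(1)] .
    obtain d b n where y: "d \<noteq> 0" "d \<in> R n" "b \<in> S n" "y = inverse (\<kappa> d) * b"
      using central_denominator[OF xy(2)] .
    have cd: "c * d \<noteq> 0" "c * d \<in> R (m + n)" using x y R.mult by auto
    have inv: "inverse (\<kappa> (c * d)) = inverse (\<kappa> c) * inverse (\<kappa> d)"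
      by (simp add: \<kappa>_inverse[symmetric] j_mult[symmetric])
    have "x * y = inverse (\<kappa> (c * d)) * (a * b)"
      unfolding inv x y using inverse_\<kappa>_central[of d a] by (metis mult.assoc)
    then have "x * y \<in> \<Delta>" using \<Delta>I[OF cd S.mult[OF x(3) y(3)]] by simp
    have "\<kappa> d * a - \<kappa> c * b \<in> S (m + n)"
      using S.mult[OF scalars[OF y(2)] x(3)] S.mult[OF scalars[OF x(2)] y(3)]
      by (intro S.diff) (simp_all add: add.commute)
    then have "inverse (\<kappa> (c * d)) * (\<kappa> d * a - \<kappa> c * b) \<in> \<Delta>" by (rule \<Delta>I[OF cd])
    also have "inverse (\<kappa> (c * d)) * (\<kappa> d * a - \<kappa> c * b)
        = \<kappa> (inverse (c * d) * d) * a - \<kappa> (inverse (c * d) * c) * b"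
      by (simp only: right_diff_distrib j_mult[of "inverse (c * d)"] \<kappa>_inverse[of "c * d"] mult.assoc)
    also have "inverse (c * d) * d = inverse c" using y(1) by simp
    also have "inverse (c * d) * c = inverse d" using x(1) by simp
    also have "\<kappa> (inverse c) * a - \<kappa> (inverse d) * b = x - y"
      unfolding x(4) y(4) \<kappa>_inverse ..
    finally show ?thesis using \<open>x * y \<in> \<Delta>\<close> by simp
  qed
  have "inverse x \<in> \<Delta>" if "x \<in> \<Delta>" for x
  proof (cases "x = 0")
    case False
    obtain s a l where x: "s \<noteq> 0" "s \<in> S l" "a \<in> S l" "x = inverse s * a"
      using \<open>x \<in> \<Delta>\<close> unfolding \<Delta>_def by blast
    then have "a \<noteq> 0" using False by auto
    moreover have "inverse x = inverse a * s"
      using x(1,4) \<open>a \<noteq> 0\<close> by (simp add: nonzero_inverse_mult_distrib)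
    ultimately show ?thesis using x unfolding \<Delta>_def by blast
  qed (use that in simp)
  with 1 2 show ?thesis by (auto simp: division_subring_def is_subring_def)
qed

lemma \<kappa>_F_subset: "\<kappa> ` F \<subseteq> center_of \<Delta>"
proof
  fix z assume "z \<in> \<kappa> ` F"
  then obtain s a l where "z = \<kappa> (inverse s * a)" "s \<noteq> 0" "s \<in> R l" "a \<in> R l"
    unfolding F_def by auto
  then have "z \<in> \<Delta>" "\<And>x. z * x = x * z"
    using \<Delta>I[of s l "\<kappa> a"] scalars j_central[of "inverse s * a"] by (simp_all add: j_mult \<kappa>_inverse)
  then show "z \<in> center_of \<Delta>" unfolding center_of_def by blast
qed

text \<open>Dividing the equation of a = c z by c ^ r, with r its degree, turns its i-th coefficient
  into coeff p i / c ^ (r - i), a quotient of two elements of degree m (r - i).\<close>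

lemma algebraic_over_F:
  assumes "z \<in> \<Delta>"
  shows "algebraic_on (\<kappa> ` F) z"
proof -
  obtain c a m where z: "c \<noteq> 0" "c \<in> R m" "a \<in> S m" "z = inverse (\<kappa> c) * a"
    using central_denominator[OF assms] .
  obtain p where p: "lead_coeff p = 1" "eval a p = 0"
    "\<And>i. i \<le> degree p \<Longrightarrow> coeff p i \<in> R (m * (degree p - i))"
    using minimal_polynomial[OF z(3)] by blast
  let ?r = "degree p"
  have a: "a = \<kappa> c * z" using z(1) by (simp add: z(4) mult.assoc[symmetric] \<kappa>_eq_0_iff)
  have a_pow: "a ^ i = \<kappa> (c ^ i) * z ^ i" for i
  proof (induction i)
    case (Suc i)
    have "a ^ Suc i = \<kappa> c * z * (\<kappa> (c ^ i) * z ^ i)" by (simp add: Suc a[symmetric])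
    also have "\<dots> = \<kappa> c * (\<kappa> (c ^ i) * z) * z ^ i"
      using j_central[of "c ^ i" z] by (metis mult.assoc)
    finally show ?case by (simp add: j_mult mult.assoc)
  qed (simp add: j_1)
  define q where "q i = - coeff p i * c ^ i * inverse (c ^ ?r)" for i
  have "(\<Sum>i\<le>?r. \<kappa> (coeff p i * c ^ i) * z ^ i) = 0"
    using p(2) unfolding eval_def a_pow by (simp add: j_mult mult.assoc)
  then have "\<kappa> (c ^ ?r) * z ^ ?r = - (\<Sum>i<?r. \<kappa> (coeff p i * c ^ i) * z ^ i)"
    using p(1) by (simp add: lessThan_Suc_atMost[symmetric] eq_neg_iff_add_eq_0 add.commute)
  moreover have "z ^ ?r = \<kappa> (inverse (c ^ ?r)) * (\<kappa> (c ^ ?r) * z ^ ?r)"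
    using z(1) by (simp add: mult.assoc[symmetric] j_mult[symmetric] j_1)
  ultimately have "z ^ ?r = \<kappa> (inverse (c ^ ?r)) * - (\<Sum>i<?r. \<kappa> (coeff p i * c ^ i) * z ^ i)"
    by simp
  also have "\<dots> = (\<Sum>i<?r. \<kappa> (q i) * z ^ i)"
    unfolding sum_negf[symmetric] sum_distrib_left
  proof (intro sum.cong refl)
    fix i
    have "q i = - (inverse (c ^ ?r) * (coeff p i * c ^ i))" by (simp add: q_def)
    then show "\<kappa> (inverse (c ^ ?r)) * - (\<kappa> (coeff p i * c ^ i) * z ^ i) = \<kappa> (q i) * z ^ i"
      by (simp add: j_uminus j_mult mult.assoc)
  qed
  finally have "z ^ ?r = (\<Sum>i<?r. \<kappa> (q i) * z ^ i)" .
  moreover have "q i \<in> F" if "i < ?r" for i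
  proof -
    have "c ^ ?r = c ^ (?r - i) * c ^ i" using that by (simp add: power_add[symmetric])
    then have "q i = inverse (c ^ (?r - i)) * - coeff p i"
      using z(1) by (simp add: q_def field_simps)
    moreover have "c ^ (?r - i) \<in> R (m * (?r - i))" by (rule R.power[OF z(2)])
    moreover have "- coeff p i \<in> R (m * (?r - i))" using p(3)[of i] that by (intro R.uminus) auto
    ultimately show ?thesis
      unfolding F_def using z(1)
      by (intro CollectI exI[of _ "c ^ (?r - i)"] exI[of _ "- coeff p i"] exI[of _ "m * (?r - i)"] conjI)
        auto
  qed
  ultimately show ?thesis
    unfolding algebraic_on_def by (intro exI[of _ ?r] exI[of _ "\<lambda>i. \<kappa> (q i)"]) auto
qed

end

lemma division_subring_fractions:
  fixes F :: "'b::field set"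
  assumes "graded_ring Q" "F = {inverse s * a | s a l. s \<noteq> 0 \<and> s \<in> Q l \<and> a \<in> Q l}"
  shows "division_subring F"
proof -
  interpret Q: graded_ring Q by fact
  have 1: "1 \<in> F"
    unfolding assms(2) by (intro CollectI exI[of _ 1] exI[of _ 0] conjI) (use Q.one in auto)
  have 2: "x - y \<in> F \<and> x * y \<in> F" if xy: "x \<in> F" "y \<in> F" for x y
  proof -
    obtain s a l t b m where x: "x = inverse s * a" "s \<noteq> 0" "s \<in> Q l" "a \<in> Q l"
      and y: "y = inverse t * b" "t \<noteq> 0" "t \<in> Q m" "b \<in> Q m"
      using xy unfolding assms(2) by blast
    have "x - y = inverse (s * t) * (a * t - s * b)" "x * y = inverse (s * t) * (a * b)"
      using x(2) y(2) unfolding x(1) y(1) by (simp_all add: field_simps)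
    moreover have "s * t \<noteq> 0" "s * t \<in> Q (l + m)" "a * t - s * b \<in> Q (l + m)" "a * b \<in> Q (l + m)"
      using x(2) y(2) Q.mult[OF x(3) y(3)] Q.mult[OF x(4) y(3)] Q.mult[OF x(3) y(4)]
        Q.mult[OF x(4) y(4)] by (auto intro: Q.diff)
    ultimately show ?thesis unfolding assms(2) by blast
  qed
  have "inverse x \<in> F" if x: "x \<in> F" for x
  proof (cases "x = 0")
    case False
    obtain s a l where *: "x = inverse s * a" "s \<noteq> 0" "s \<in> Q l" "a \<in> Q l"
      using x unfolding assms(2) by blast
    then have "inverse x = inverse a * s" "a \<noteq> 0" using False by simp_all
    then show ?thesis unfolding assms(2) using * by blast
  qed (use x in simp)
  with 1 2 show ?thesis by (auto simp: division_subring_def is_subring_def)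
qed

section \<open>Local rings of a variety\<close>

lemma is_subring_hull: "is_subring (is_subring hull S)"
  by (rule hull_in) (auto simp: is_subring_def)

lemma fg_subalgebra_is_subring:
  assumes "fg_subalgebra \<iota> A"
  shows "is_subring A" "range \<iota> \<subseteq> A"
proof -
  obtain S where S: "A = is_subring hull (range \<iota> \<union> S)"
    using assms unfolding fg_subalgebra_def by blast
  show "is_subring A" unfolding S by (rule is_subring_hull)
  show "range \<iota> \<subseteq> A" unfolding S using hull_subset[of "range \<iota> \<union> S" is_subring] by blast
qed

lemma prime_idealD:
  assumes "prime_ideal_of A I"
  shows "I \<subseteq> A" "0 \<in> I" "1 \<notin> I" "\<And>a b. a \<in> I \<Longrightarrow> b \<in> I \<Longrightarrow> a + b \<in> I"
    "\<And>a b. a \<in> A \<Longrightarrow> b \<in> I \<Longrightarrow> a * b \<in> I"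
    "\<And>a b. a \<in> A \<Longrightarrow> b \<in> A \<Longrightarrow> a * b \<in> I \<Longrightarrow> a \<in> I \<or> b \<in> I"
  using assms unfolding prime_ideal_of_def by simp_all

lemma subset_localization:
  assumes "is_subring A" "prime_ideal_of A I"
  shows "A \<subseteq> localization A I"
proof
  fix a assume "a \<in> A"
  then show "a \<in> localization A I"
    unfolding localization_def using is_subring_1[OF assms(1)] prime_idealD(3)[OF assms(2)]
    by (intro CollectI exI[of _ a] exI[of _ 1]) auto
qed

lemma prime_complement_mult:
  assumes "is_subring A" "prime_ideal_of A I" "s \<in> A - I" "t \<in> A - I"
  shows "s * t \<in> A - I"
  using assms(3,4) is_subring_mult[OF assms(1)] prime_idealD(6)[OF assms(2)] by blast

lemma is_subring_localization:
  assumes A: "is_subring A" and I: "prime_ideal_of A I"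
  shows "is_subring (localization A I)"
  unfolding is_subring_def
proof (intro conjI ballI)
  show "1 \<in> localization A I" using subset_localization[OF A I] is_subring_1[OF A] by blast
  fix x y assume "x \<in> localization A I" "y \<in> localization A I"
  then obtain a s b t where x: "x = a / s" "a \<in> A" "s \<in> A - I" and y: "y = b / t" "b \<in> A" "t \<in> A - I"
    unfolding localization_def by blast
  have nz: "s \<noteq> 0" "t \<noteq> 0" using x y prime_idealD(2)[OF I] by auto
  have st: "s * t \<in> A - I" by (rule prime_complement_mult[OF A I x(3) y(3)])
  have "x - y = (a * t - b * s) / (s * t)" using nz unfolding x(1) y(1) by (simp add: field_simps)
  moreover have "a * t - b * s \<in> A"
    using x y by (intro is_subring_diff[OF A] is_subring_mult[OF A]) auto
  ultimately show "x - y \<in> localization A I" unfolding localization_def using st by blast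
  have "x * y = (a * b) / (s * t)" unfolding x(1) y(1) by simp
  moreover have "a * b \<in> A" using x y by (intro is_subring_mult[OF A]) auto
  ultimately show "x * y \<in> localization A I" unfolding localization_def using st by blast
qed

text \<open>For nonzero a / s, invertibility in the localization means that \<open>a\<close> avoids
  \<open>I\<close>, by primality of \<open>I\<close>.\<close>

lemma max_ideal_localization:
  assumes A: "is_subring A" and I: "prime_ideal_of A I"
  shows "max_ideal (localization A I) = {a / s | a s. a \<in> I \<and> s \<in> A - I}"
proof (intro equalityI subsetI)
  fix x assume x: "x \<in> max_ideal (localization A I)"
  then obtain a s where as: "x = a / s" "a \<in> A" "s \<in> A - I"
    unfolding max_ideal_def localization_def by blast
  have "a \<in> I"
  proof (rule ccontr)
    assume "a \<notin> I"
    then have "inverse x \<in> localization A I"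
      using as unfolding localization_def by (intro CollectI exI[of _ s] exI[of _ a]) auto
    then have "x = 0" using x unfolding max_ideal_def by blast
    then have "a = 0" using as prime_idealD(2)[OF I] by auto
    then show False using \<open>a \<notin> I\<close> prime_idealD(2)[OF I] by simp
  qed
  then show "x \<in> {a / s | a s. a \<in> I \<and> s \<in> A - I}" using as by blast
next
  fix x assume "x \<in> {a / s | a s. a \<in> I \<and> s \<in> A - I}"
  then obtain a s where as: "x = a / s" "a \<in> I" "s \<in> A - I" by blast
  have xA: "x \<in> localization A I"
    using as prime_idealD(1)[OF I] unfolding localization_def by blast
  have "x = 0" if inv: "inverse x \<in> localization A I"
  proof (rule ccontr)
    assume "x \<noteq> 0"
    obtain b t where b: "inverse x = b / t" "b \<in> A" "t \<in> A - I"
      using inv unfolding localization_def by blast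
    have nz: "a \<noteq> 0" "s \<noteq> 0" "t \<noteq> 0" using \<open>x \<noteq> 0\<close> as b prime_idealD(2)[OF I] by auto
    have "s / a = b / t" using b(1) as(1) by simp
    then have "s * t = b * a" using nz by (simp add: frac_eq_eq)
    moreover have "b * a \<in> I" by (rule prime_idealD(5)[OF I b(2) as(2)])
    ultimately show False using prime_complement_mult[OF A I as(3) b(3)] by simp
  qed
  then show "x \<in> max_ideal (localization A I)" using xA unfolding max_ideal_def by blast
qed

lemma local_subring_localization:
  assumes A: "is_subring A" and I: "prime_ideal_of A I"
  shows "local_subring (localization A I)"
  unfolding local_subring_def
proof (intro conjI ballI)
  show "is_subring (localization A I)" by (rule is_subring_localization[OF A I])
  fix x y assume "x \<in> max_ideal (localization A I)" "y \<in> max_ideal (localization A I)"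
  then obtain a s b t where x: "x = a / s" "a \<in> I" "s \<in> A - I" and y: "y = b / t" "b \<in> I" "t \<in> A - I"
    unfolding max_ideal_localization[OF A I] by blast
  have nz: "s \<noteq> 0" "t \<noteq> 0" using x y prime_idealD(2)[OF I] by auto
  have "x + y = (t * a + s * b) / (s * t)" using nz unfolding x(1) y(1) by (simp add: field_simps)
  moreover have "t * a + s * b \<in> I"
    using x y by (intro prime_idealD(4)[OF I] prime_idealD(5)[OF I]) auto
  moreover have "s * t \<in> A - I" by (rule prime_complement_mult[OF A I x(3) y(3)])
  ultimately show "x + y \<in> max_ideal (localization A I)"
    unfolding max_ideal_localization[OF A I] by blast
qed

lemma max_ideal_mult:
  assumes "is_subring P" "a \<in> max_ideal P" "b \<in> P"
  shows "a * b \<in> max_ideal P"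
proof -
  have a: "a \<in> P" "a = 0 \<or> inverse a \<notin> P" using assms(2) by (auto simp: max_ideal_def)
  have "a * b = 0 \<or> inverse (a * b) \<notin> P"
  proof (rule ccontr)
    assume *: "\<not> ?thesis"
    then have "b * inverse (a * b) \<in> P" using assms by (intro is_subring_mult) auto
    moreover have "b * inverse (a * b) = inverse a" using * by auto
    ultimately have "inverse a \<in> P" by (simp only:)
    then show False using a * by auto
  qed
  then show ?thesis using is_subring_mult[OF assms(1) a(1) assms(3)] by (simp add: max_ideal_def)
qed

text \<open>The centre is the localization at the contraction of the maximal ideal of
  \<open>Q\<close>; elements of \<open>A\<close> outside that contraction are units of
  \<open>Q\<close>.\<close>

lemma center_on_affine:
  assumes Q: "local_subring Q" and A: "is_subring A" "A \<subseteq> Q"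
  shows "\<exists>P\<in>Spec A. dominates Q P"
proof -
  have Qs: "is_subring Q" and Qadd: "\<And>a b. a \<in> max_ideal Q \<Longrightarrow> b \<in> max_ideal Q \<Longrightarrow> a + b \<in> max_ideal Q"
    using Q unfolding local_subring_def by auto
  define I where "I = max_ideal Q \<inter> A"
  have unit: "inverse a \<in> Q" "a \<noteq> 0" if "a \<in> A" "a \<notin> I" for a
    using that A(2) by (auto simp: I_def max_ideal_def)
  have I: "prime_ideal_of A I"
    unfolding prime_ideal_of_def
  proof (intro conjI ballI impI)
    show "I \<subseteq> A" by (simp add: I_def)
    show "0 \<in> I" using is_subring_0[OF Qs] is_subring_0[OF A(1)] by (simp add: I_def max_ideal_def)
    show "1 \<notin> I" using is_subring_1[OF Qs] by (simp add: I_def max_ideal_def)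
    show "a + b \<in> I" if "a \<in> I" "b \<in> I" for a b
      using that Qadd is_subring_add[OF A(1)] by (simp add: I_def)
    show "a * b \<in> I" if "a \<in> A" "b \<in> I" for a b
      using that max_ideal_mult[OF Qs, of b a] A(2) is_subring_mult[OF A(1), of a b]
      by (auto simp: I_def mult.commute)
    show "a \<in> I \<or> b \<in> I" if ab: "a \<in> A" "b \<in> A" "a * b \<in> I" for a b
    proof (rule ccontr)
      assume "\<not> ?thesis"
      then have u: "inverse a \<in> Q" "a \<noteq> 0" "inverse b \<in> Q" "b \<noteq> 0" using unit ab by auto
      have "inverse (a * b) \<in> Q"
        using is_subring_mult[OF Qs u(1,3)] by (simp add: mult.commute)
      then show False using ab(3) u by (auto simp: I_def max_ideal_def)
    qed
  qed
  have "localization A I \<subseteq> Q"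
  proof
    fix x assume "x \<in> localization A I"
    then obtain a s where "x = a / s" "a \<in> A" "s \<in> A" "s \<notin> I" unfolding localization_def by blast
    then show "x \<in> Q" using unit[of s] A(2) is_subring_mult[OF Qs] by (auto simp: divide_inverse)
  qed
  moreover have "max_ideal (localization A I) \<subseteq> max_ideal Q"
  proof
    fix x assume "x \<in> max_ideal (localization A I)"
    then obtain a s where "x = a / s" "a \<in> I" "s \<in> A" "s \<notin> I"
      unfolding max_ideal_localization[OF A(1) I] by blast
    then show "x \<in> max_ideal Q"
      using unit[of s] max_ideal_mult[OF Qs] by (auto simp: divide_inverse I_def)
  qed
  ultimately show ?thesis using I unfolding Spec_def dominates_def by blast
qed

lemma dominates_refl: "dominates P P"
  by (simp add: dominates_def)

lemma variety_point:
  assumes "variety \<iota> X" "P \<in> X"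
  shows "is_subring P" "range \<iota> \<subseteq> P" "local_subring P"
proof -
  obtain A I where A: "fg_subalgebra \<iota> A" "prime_ideal_of A I" "P = localization A I"
    using assms unfolding variety_def Spec_def by blast
  note sub = fg_subalgebra_is_subring[OF A(1)]
  show "local_subring P" unfolding A(3) by (rule local_subring_localization[OF sub(1) A(2)])
  then show "is_subring P" by (simp add: local_subring_def)
  show "range \<iota> \<subseteq> P" using sub(2) subset_localization[OF sub(1) A(2)] A(3) by blast
qed

lemma variety_nonempty:
  assumes "variety \<iota> X"
  shows "X \<noteq> {}"
proof -
  obtain \<A> where \<A>: "\<A> \<noteq> {}" "\<And>A. A \<in> \<A> \<Longrightarrow> fg_subalgebra \<iota> A" "X = \<Union> (Spec ` \<A>)"
    using assms unfolding variety_def by blast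
  then obtain A where A: "A \<in> \<A>" by blast
  have "is_subring A" using fg_subalgebra_is_subring(1)[OF \<A>(2)[OF A]] .
  \<comment> \<open>The zero ideal supplies the generic point.\<close>
  then have "prime_ideal_of A {0}" by (auto simp: prime_ideal_of_def is_subring_0)
  then show ?thesis using \<A>(3) A unfolding Spec_def by blast
qed

lemma nonempty_open_whole: "variety \<iota> X \<Longrightarrow> nonempty_open X X"
  unfolding nonempty_open_def using variety_nonempty by auto

lemma nonempty_open_Int:
  assumes "nonempty_open X U" "nonempty_open X V" "P \<in> U" "P \<in> V"
  shows "nonempty_open X (U \<inter> V)"
  unfolding nonempty_open_def
proof (intro conjI ballI)
  show "U \<inter> V \<noteq> {}" "U \<inter> V \<subseteq> X" using assms unfolding nonempty_open_def by auto
  fix Q assume "Q \<in> U \<inter> V"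
  then have Q: "Q \<in> U" "Q \<in> V" by auto
  obtain E where "finite E" "E \<subseteq> Q" "{Q \<in> X. E \<subseteq> Q} \<subseteq> U"
    using assms(1) Q(1) unfolding nonempty_open_def by blast
  moreover obtain E' where "finite E'" "E' \<subseteq> Q" "{Q \<in> X. E' \<subseteq> Q} \<subseteq> V"
    using assms(2) Q(2) unfolding nonempty_open_def by blast
  ultimately show "\<exists>E. finite E \<and> E \<subseteq> Q \<and> {Q \<in> X. E \<subseteq> Q} \<subseteq> U \<inter> V"
    by (intro exI[of _ "E \<union> E'"]) auto
qed

text \<open>A point containing the generators of \<open>A\<close> has a centre on \<open>Spec A\<close>; separatedness identifies them.\<close>

lemma nonempty_open_Spec:
  assumes X: "variety \<iota> X" and A: "fg_subalgebra \<iota> A" "Spec A \<subseteq> X" and P: "P \<in> Spec A"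
  shows "nonempty_open X (Spec A)"
  unfolding nonempty_open_def
proof (intro conjI ballI)
  show "Spec A \<noteq> {}" "Spec A \<subseteq> X" using A P by auto
  obtain S where S: "finite S" "A = is_subring hull (range \<iota> \<union> S)"
    using A(1) unfolding fg_subalgebra_def by blast
  note sub = fg_subalgebra_is_subring[OF A(1)]
  fix P assume "P \<in> Spec A"
  then have "A \<subseteq> P" unfolding Spec_def using subset_localization[OF sub(1)] by blast
  moreover have "S \<subseteq> A" unfolding S(2) using hull_subset[of "range \<iota> \<union> S" is_subring] by blast
  moreover have "{Q \<in> X. S \<subseteq> Q} \<subseteq> Spec A"
  proof
    fix Q assume "Q \<in> {Q \<in> X. S \<subseteq> Q}"
    then have Q: "Q \<in> X" "S \<subseteq> Q" by auto
    note Qp = variety_point[OF X Q(1)]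
    have "A \<subseteq> Q" unfolding S(2) by (rule hull_minimal) (use Q Qp in auto)
    then obtain P' where P': "P' \<in> Spec A" "dominates Q P'"
      using center_on_affine[OF Qp(3) sub(1)] by blast
    moreover have "\<forall>P\<in>X. \<forall>Q\<in>X. \<forall>R. local_subring R \<and> dominates R P \<and> dominates R Q \<longrightarrow> P = Q"
      using X unfolding variety_def by (rule conjunct2)
    ultimately have "Q = P'" using Q(1) A(2) Qp(3) dominates_refl[of Q] by blast
    with P'(1) show "Q \<in> Spec A" by simp
  qed
  ultimately show "\<exists>E. finite E \<and> E \<subseteq> P \<and> {Q \<in> X. E \<subseteq> Q} \<subseteq> Spec A"
    using S(1) by blast
qed

section \<open>Sections of orders\<close>

lemma sums_of_products_eq: "sums_of_products \<kappa> S M = lspan (\<kappa> ` S) M"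
proof (intro equalityI subsetI)
  fix x assume "x \<in> sums_of_products \<kappa> S M"
  then obtain ps where ps: "x = sum_list (map (\<lambda>(s, a). \<kappa> s * a) ps)" "set ps \<subseteq> S \<times> M"
    unfolding sums_of_products_def by blast
  from ps(2) have "sum_list (map (\<lambda>(s, a). \<kappa> s * a) ps) \<in> lspan (\<kappa> ` S) M"
    by (induction ps) (auto intro: lspan.intros)
  then show "x \<in> lspan (\<kappa> ` S) M" using ps(1) by simp
next
  fix x assume "x \<in> lspan (\<kappa> ` S) M"
  then show "x \<in> sums_of_products \<kappa> S M"
  proof induction
    case zero
    show ?case unfolding sums_of_products_def by (intro CollectI exI[of _ "[]"]) simp
  next
    case (step c w x)
    then obtain s ps where "c = \<kappa> s" "s \<in> S" "x = sum_list (map (\<lambda>(s, a). \<kappa> s * a) ps)" "set ps \<subseteq> S \<times> M"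
      unfolding sums_of_products_def by blast
    then show ?case using step(2)
      unfolding sums_of_products_def by (intro CollectI exI[of _ "(s, w) # ps"]) simp
  qed
qed

lemma divisor_sheaf_mult_iff:
  "s \<in> divisor_sheaf (divisor_mult l D) V \<longleftrightarrow> (\<forall>(U, f)\<in>D. \<forall>P\<in>V \<inter> U. s * f ^ l \<in> P)"
  unfolding divisor_sheaf_def divisor_mult_def structure_sheaf_def by auto

lemma graded_ring_divisor_sheaf:
  assumes "\<And>P. P \<in> V \<Longrightarrow> is_subring P"
  shows "graded_ring (\<lambda>l. divisor_sheaf (divisor_mult l D) V)"
proof
  fix l m a b
  show "1 \<in> divisor_sheaf (divisor_mult 0 D) V" "0 \<in> divisor_sheaf (divisor_mult l D) V"
    using is_subring_1[OF assms] is_subring_0[OF assms] by (auto simp: divisor_sheaf_mult_iff)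
  assume a: "a \<in> divisor_sheaf (divisor_mult l D) V"
  show "a - b \<in> divisor_sheaf (divisor_mult l D) V" if "b \<in> divisor_sheaf (divisor_mult l D) V"
    using a that is_subring_diff[OF assms]
    by (fastforce simp: divisor_sheaf_mult_iff left_diff_distrib)
  show "a * b \<in> divisor_sheaf (divisor_mult (l + m) D) V"
    if b: "b \<in> divisor_sheaf (divisor_mult m D) V"
    unfolding divisor_sheaf_mult_iff
  proof (intro ballI, clarify)
    fix U f P assume *: "(U, f) \<in> D" "P \<in> V" "P \<in> U"
    then have "a * f ^ l \<in> P" "b * f ^ m \<in> P" using a b by (auto simp: divisor_sheaf_mult_iff)
    from is_subring_mult[OF assms[OF *(2)] this] show "a * b * f ^ (l + m) \<in> P"
      by (simp add: power_add ac_simps)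
  qed
qed

lemma divisor_sheaf_antimono:
  "V \<subseteq> V' \<Longrightarrow> divisor_sheaf (divisor_mult l D) V' \<subseteq> divisor_sheaf (divisor_mult l D) V"
  by (force simp: divisor_sheaf_mult_iff)

text \<open>One more power of \<open>b\<close> than the size of a spanning set forces a linear
  relation. A nonzero annihilating polynomial of least degree is then divided by its leading
  coefficient.\<close>

lemma minimal_polynomial_exists:
  fixes \<kappa> :: "'K::field \<Rightarrow> 'd::division_ring"
  assumes "algebra_map \<kappa>" "fd_subspace \<kappa> UNIV"
  shows "\<exists>p. lead_coeff p = 1 \<and> k_algebra.eval \<kappa> b p = 0
    \<and> (\<forall>q. q \<noteq> 0 \<and> k_algebra.eval \<kappa> b q = 0 \<longrightarrow> degree p \<le> degree q)"
proof -
  interpret k_algebra \<kappa> by (rule k_algebra.intro) fact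
  obtain B where B: "finite B" "UNIV = span B"
    using assms(2) unfolding fd_subspace_def span_over_eq by blast
  have "\<exists>p. p \<noteq> 0 \<and> eval b p = 0"
  proof (rule ccontr)
    assume no: "\<not> ?thesis"
    have "\<forall>i\<in>{..card B}. c i = 0" if "(\<Sum>i\<in>{..card B}. scale_by \<kappa> (c i) (b ^ i)) = 0" for c
    proof -
      define p where "p = (\<Sum>i\<le>card B. monom (c i) i)"
      have coeff: "coeff p i = (if i \<le> card B then c i else 0)" for i
        by (simp add: p_def coeff_sum)
      then have "degree p \<le> card B" by (intro degree_le) auto
      then have "eval b p = (\<Sum>i\<le>card B. \<kappa> (coeff p i) * b ^ i)" by (rule eval_eq)
      also have "\<dots> = 0" using that by (simp add: coeff scale_by_def)
      finally have "p = 0" using no by blast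
      then show ?thesis using coeff by (metis atMost_iff coeff_0)
    qed
    from independent_family[OF finite_atMost this]
    have "inj_on ((^) b) {..card B}" "independent ((^) b ` {..card B})" by auto
    then show False
      using independent_span_bound[OF B(1), of "(^) b ` {..card B}"] B(2) by (simp add: card_image)
  qed
  then obtain p where p: "p \<noteq> 0" "eval b p = 0"
    "\<And>q. q \<noteq> 0 \<Longrightarrow> eval b q = 0 \<Longrightarrow> degree p \<le> degree q"
    using ex_has_least_nat[of "\<lambda>p. p \<noteq> 0 \<and> eval b p = 0" _ degree] by blast
  show ?thesis
    by (rule exI[of _ "smult (inverse (lead_coeff p)) p"]) (use p in \<open>auto simp: eval_smult\<close>)
qed

section \<open>Section ring of an order over a normal variety\<close>

locale normal_order =
  fixes \<iota> :: "'k::field \<Rightarrow> 'K::field" and \<kappa> :: "'K \<Rightarrow> 'd::division_ring"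
    and X :: "'K set set" and \<Lambda> :: "'K set set \<Rightarrow> 'd set" and D :: "('K set set \<times> 'K) set"
  assumes cda: "central_division_algebra \<kappa>"
    and variety: "variety \<iota> X" and normal: "normal_scheme X"
    and order: "order_in \<iota> X \<kappa> \<Lambda>" and cartier: "cartier_divisor X D"
begin

sublocale k_algebra \<kappa>
  using cda by (intro k_algebra.intro) (simp add: central_division_algebra_def)

abbreviation L :: "nat \<Rightarrow> 'K set set \<Rightarrow> 'K set" where
  "L l \<equiv> divisor_sheaf (divisor_mult l D)"

abbreviation S :: "nat \<Rightarrow> 'd set" where
  "S l \<equiv> tensor_sheaf X \<kappa> (L l) \<Lambda> X"

lemmas point = variety_point[OF variety]

lemma graded_ring_L: "V \<subseteq> X \<Longrightarrow> graded_ring (\<lambda>l. L l V)"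
  using point(1) by (intro graded_ring_divisor_sheaf) auto

lemma \<Lambda>_subring: "nonempty_open X U \<Longrightarrow> is_subring (\<Lambda> U)"
  and \<Lambda>_scale: "nonempty_open X U \<Longrightarrow> f \<in> structure_sheaf U \<Longrightarrow> a \<in> \<Lambda> U \<Longrightarrow> \<kappa> f * a \<in> \<Lambda> U"
  and \<Lambda>_restrict: "nonempty_open X U \<Longrightarrow> nonempty_open X V \<Longrightarrow> V \<subseteq> U \<Longrightarrow> a \<in> \<Lambda> U \<Longrightarrow> a \<in> \<Lambda> V"
proof -
  have *: "sheaf_of_algebras X \<kappa> \<Lambda>" using order by (simp add: order_in_def)
  show "nonempty_open X U \<Longrightarrow> is_subring (\<Lambda> U)"
    using * unfolding sheaf_of_algebras_def by simp
  show "nonempty_open X U \<Longrightarrow> f \<in> structure_sheaf U \<Longrightarrow> a \<in> \<Lambda> U \<Longrightarrow> \<kappa> f * a \<in> \<Lambda> U"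
    using * unfolding sheaf_of_algebras_def by simp
  have "\<forall>U V. nonempty_open X U \<and> nonempty_open X V \<and> V \<subseteq> U \<longrightarrow> \<Lambda> U \<subseteq> \<Lambda> V"
    using * unfolding sheaf_of_algebras_def by (elim conjE)
  then show "nonempty_open X U \<Longrightarrow> nonempty_open X V \<Longrightarrow> V \<subseteq> U \<Longrightarrow> a \<in> \<Lambda> U \<Longrightarrow> a \<in> \<Lambda> V"
    by (meson subsetD)
qed

text \<open>An element of \<open>\<Lambda> U\<close> maps the generators of a finite stalk at \<open>P \<in> U\<close> into that stalk.\<close>

lemma \<Lambda>_integral:
  assumes U: "nonempty_open X U" "P \<in> U" and b: "b \<in> \<Lambda> U"
  shows "\<exists>p. lead_coeff p = 1 \<and> coeffs_in P p \<and> eval b p = 0"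
proof -
  have P: "P \<in> X" using U unfolding nonempty_open_def by blast
  obtain A M where A: "fg_subalgebra \<iota> A" "P \<in> Spec A" "Spec A \<subseteq> X" "fg_module \<kappa> A M"
    and \<Lambda>: "\<And>U. nonempty_open X U \<Longrightarrow> U \<subseteq> Spec A \<Longrightarrow> \<Lambda> U = (\<Inter>Q\<in>U. localized_module \<kappa> A M Q)"
  proof -
    have "coherent_sheaf \<iota> X \<kappa> \<Lambda>" using order by (simp add: order_in_def)
    from bspec[OF this[unfolded coherent_sheaf_def] P] show thesis using that by (elim exE conjE) simp
  qed
  obtain G where G: "finite G" "M = {\<Sum>g\<in>G. \<kappa> (c g) * g | c. \<forall>g\<in>G. c g \<in> A}"
    using A(4) unfolding fg_module_def by blast
  note subA = fg_subalgebra_is_subring[OF A(1)]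
  have AQ: "A \<subseteq> Q" if "Q \<in> Spec A" for Q
    using that subset_localization[OF subA(1)] unfolding Spec_def by blast
  have openA: "nonempty_open X (Spec A)" by (rule nonempty_open_Spec[OF variety A(1,3,2)])
  \<comment> \<open>On this smaller neighbourhood of \<open>P\<close> the order comes from the
    finitely generated module \<open>M\<close>, and \<open>b\<close> restricts to a section.\<close>
  let ?U = "U \<inter> Spec A"
  have openU: "nonempty_open X ?U" by (rule nonempty_open_Int[OF U(1) openA U(2) A(2)])
  have to_lspan: "x \<in> lspan (\<kappa> ` P) G" if x: "x \<in> localized_module \<kappa> A M P" for x
  proof -
    obtain s m where s: "x = \<kappa> (inverse s) * m" "inverse s \<in> P" "m \<in> M"
      using x unfolding localized_module_def by blast
    obtain c where c: "m = (\<Sum>g\<in>G. \<kappa> (c g) * g)" "\<forall>g\<in>G. c g \<in> A" using s(3) G(2) by blast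
    have "x = (\<Sum>g\<in>G. \<kappa> (inverse s * c g) * g)"
      unfolding s(1) c(1) sum_distrib_left j_mult by (simp add: mult.assoc)
    also have "\<dots> \<in> lspan (\<kappa> ` P) G"
      using c(2) s(2) AQ[OF A(2)] by (intro lspan_sum lspan_scaled imageI is_subring_mult[OF point(1)[OF P]]) auto
    finally show ?thesis .
  qed
  have \<Lambda>_lspan: "x \<in> lspan (\<kappa> ` P) G" if "x \<in> \<Lambda> ?U" for x
    using that \<Lambda>[OF openU] U(2) A(2) by (intro to_lspan) auto
  \<comment> \<open>The generators have denominator 1 at every point, so they are sections
    themselves and can be multiplied by \<open>b\<close> within the order.\<close>
  have G\<Lambda>: "g \<in> \<Lambda> ?U" if g: "g \<in> G" for g
  proof -
    have "g = (\<Sum>h\<in>G. \<kappa> (if h = g then 1 else 0) * h)"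
      using g G(1) by (simp add: if_distrib[of \<kappa>] if_distrib[of "\<lambda>x. x * _"] j_0 j_1 cong: if_cong)
    then have gM: "g \<in> M"
      unfolding G(2) using is_subring_0[OF subA(1)] is_subring_1[OF subA(1)]
      by (intro CollectI exI[of _ "\<lambda>h. if h = g then 1 else 0"]) auto
    have "g \<in> localized_module \<kappa> A M Q" if Q: "Q \<in> Spec A" for Q
      unfolding localized_module_def
    proof (intro CollectI exI conjI)
      show "g = \<kappa> (inverse 1) * g" by (simp add: j_1)
      have "Q \<in> X" using Q A(3) by blast
      then show "inverse 1 \<in> Q" using is_subring_1[OF point(1)] by simp
    qed (use is_subring_1[OF subA(1)] gM in auto)
    then have "g \<in> \<Lambda> (Spec A)" using \<Lambda>[OF openA] by blast
    then show ?thesis by (rule \<Lambda>_restrict[OF openA openU Int_lower2])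
  qed
  have b': "b \<in> \<Lambda> ?U" by (rule \<Lambda>_restrict[OF U(1) openU Int_lower1 b])
  have "b * g \<in> lspan (\<kappa> ` P) G" if "g \<in> G" for g
    using is_subring_mult[OF \<Lambda>_subring[OF openU] b' G\<Lambda>[OF that]] by (rule \<Lambda>_lspan)
  from monic_annihilator[OF point(1)[OF P] G(1) this]
  obtain p where p: "lead_coeff p = 1" "coeffs_in P p" "\<forall>g\<in>G. eval b p * g = 0" by blast
  \<comment> \<open>The element 1 is in the span of \<open>G\<close>, so some generator is nonzero;
    cancelling it in the division ring leaves eval b p = 0.\<close>
  have "\<exists>g\<in>G. g \<noteq> 0"
  proof (rule ccontr)
    assume zero: "\<not> ?thesis"
    have "x = 0" if "x \<in> lspan (\<kappa> ` P) G" for x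
      using that by (induction rule: lspan.induct) (use zero in auto)
    then show False using \<Lambda>_lspan[OF is_subring_1[OF \<Lambda>_subring[OF openU]]] by (metis zero_neq_one)
  qed
  then show ?thesis using p by auto
qed

lemma S_iff: "d \<in> S l \<longleftrightarrow> (\<forall>P\<in>X. \<exists>V. nonempty_open X V \<and> P \<in> V \<and> V \<subseteq> X \<and> d \<in> lspan (\<kappa> ` L l V) (\<Lambda> V))"
  unfolding tensor_sheaf_def sums_of_products_eq by blast

lemma S_common:
  assumes "d \<in> S l" "e \<in> S m" "P \<in> X"
  shows "\<exists>V. nonempty_open X V \<and> P \<in> V \<and> V \<subseteq> X \<and> d \<in> lspan (\<kappa> ` L l V) (\<Lambda> V) \<and> e \<in> lspan (\<kappa> ` L m V) (\<Lambda> V)"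
proof -
  obtain V where V: "nonempty_open X V" "P \<in> V" "V \<subseteq> X" "d \<in> lspan (\<kappa> ` L l V) (\<Lambda> V)"
    using assms(1,3) unfolding S_iff by blast
  obtain W where W: "nonempty_open X W" "P \<in> W" "W \<subseteq> X" "e \<in> lspan (\<kappa> ` L m W) (\<Lambda> W)"
    using assms(2,3) unfolding S_iff by blast
  have VW: "nonempty_open X (V \<inter> W)" by (rule nonempty_open_Int[OF V(1) W(1) V(2) W(2)])
  have "d \<in> lspan (\<kappa> ` L l (V \<inter> W)) (\<Lambda> (V \<inter> W))"
  proof (rule lspan_mono[OF V(4)])
    show "\<kappa> ` L l V \<subseteq> \<kappa> ` L l (V \<inter> W)" by (intro image_mono divisor_sheaf_antimono) simp
    show "\<Lambda> V \<subseteq> \<Lambda> (V \<inter> W)" using \<Lambda>_restrict[OF V(1) VW] by blast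
  qed
  moreover have "e \<in> lspan (\<kappa> ` L m (V \<inter> W)) (\<Lambda> (V \<inter> W))"
  proof (rule lspan_mono[OF W(4)])
    show "\<kappa> ` L m W \<subseteq> \<kappa> ` L m (V \<inter> W)" by (intro image_mono divisor_sheaf_antimono) simp
    show "\<Lambda> W \<subseteq> \<Lambda> (V \<inter> W)" using \<Lambda>_restrict[OF W(1) VW] by blast
  qed
  ultimately show ?thesis using VW V W by blast
qed

lemma scalars_S:
  assumes "a \<in> L l X"
  shows "\<kappa> a \<in> S l"
  unfolding S_iff
proof
  fix P assume "P \<in> X"
  have X: "nonempty_open X X" by (rule nonempty_open_whole[OF variety])
  have "\<kappa> a * 1 \<in> lspan (\<kappa> ` L l X) (\<Lambda> X)"
    using assms is_subring_1[OF \<Lambda>_subring[OF X]] by (intro lspan_scaled) auto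
  then show "\<exists>V. nonempty_open X V \<and> P \<in> V \<and> V \<subseteq> X \<and> \<kappa> a \<in> lspan (\<kappa> ` L l V) (\<Lambda> V)"
    using X \<open>P \<in> X\<close> by auto
qed

lemma graded_ring_S: "graded_ring S"
proof
  interpret R: graded_ring "\<lambda>l. L l X" by (rule graded_ring_L) simp
  fix l m d e
  show "1 \<in> S 0" using scalars_S[OF R.one] by (simp add: j_1)
  show "0 \<in> S l" using scalars_S[OF R.zero] by (simp add: j_0)
  assume d: "d \<in> S l"
  show "d - e \<in> S l" if e: "e \<in> S l"
    unfolding S_iff
  proof
    fix P assume "P \<in> X"
    then obtain V where V: "nonempty_open X V" "P \<in> V" "V \<subseteq> X"
      "d \<in> lspan (\<kappa> ` L l V) (\<Lambda> V)" "e \<in> lspan (\<kappa> ` L l V) (\<Lambda> V)"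
      using S_common[OF d e] by blast
    have "- 1 * e \<in> lspan (\<kappa> ` L l V) (\<Lambda> V)"
    proof (rule lspan_mult_left[OF V(5)])
      fix g w assume "g \<in> \<kappa> ` L l V" "w \<in> \<Lambda> V"
      then obtain x where x: "g = \<kappa> x" "x \<in> L l V" by blast
      then have "- 1 * (g * w) = \<kappa> (- x) * w" by (simp add: j_uminus)
      then show "- 1 * (g * w) \<in> lspan (\<kappa> ` L l V) (\<Lambda> V)"
        using graded_ring.uminus[OF graded_ring_L[OF V(3)] x(2)] \<open>w \<in> \<Lambda> V\<close>
        by (metis imageI lspan_scaled)
    qed
    then have "d - e \<in> lspan (\<kappa> ` L l V) (\<Lambda> V)" using lspan_add[OF V(4)] by fastforce
    then show "\<exists>V. nonempty_open X V \<and> P \<in> V \<and> V \<subseteq> X \<and> d - e \<in> lspan (\<kappa> ` L l V) (\<Lambda> V)"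
      using V by blast
  qed
  show "d * e \<in> S (l + m)" if e: "e \<in> S m"
    unfolding S_iff
  proof
    fix P assume "P \<in> X"
    then obtain V where V: "nonempty_open X V" "P \<in> V" "V \<subseteq> X"
      "d \<in> lspan (\<kappa> ` L l V) (\<Lambda> V)" "e \<in> lspan (\<kappa> ` L m V) (\<Lambda> V)"
      using S_common[OF d e] by blast
    have "d * e \<in> lspan (\<kappa> ` L (l + m) V) (\<Lambda> V)"
    proof (rule lspan_mult_right[OF V(4)])
      fix g w assume gw: "g \<in> \<kappa> ` L l V" "w \<in> \<Lambda> V"
      show "g * w * e \<in> lspan (\<kappa> ` L (l + m) V) (\<Lambda> V)"
      proof (rule lspan_mult_left[OF V(5)])
        fix h v assume hv: "h \<in> \<kappa> ` L m V" "v \<in> \<Lambda> V"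
        obtain x y where xy: "g = \<kappa> x" "x \<in> L l V" "h = \<kappa> y" "y \<in> L m V" using gw hv by blast
        have "w * h = h * w" using j_central by (simp add: xy(3))
        then have "g * w * (h * v) = \<kappa> (x * y) * (w * v)"
          unfolding j_mult xy(1,3)[symmetric] by (metis mult.assoc)
        then show "g * w * (h * v) \<in> lspan (\<kappa> ` L (l + m) V) (\<Lambda> V)"
          using graded_ring.mult[OF graded_ring_L[OF V(3)] xy(2,4)]
            is_subring_mult[OF \<Lambda>_subring[OF V(1)] gw(2) hv(2)]
          by (metis imageI lspan_scaled)
      qed
    qed
    then show "\<exists>V. nonempty_open X V \<and> P \<in> V \<and> V \<subseteq> X \<and> d * e \<in> lspan (\<kappa> ` L (l + m) V) (\<Lambda> V)"
      using V by blast
  qed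
qed

text \<open>Over \<open>U\<close> the sheaf of the multiple l D is generated by the inverse of f ^
  l, so multiplication by f ^ l removes the twist near \<open>P\<close>.\<close>

lemma S_local:
  assumes d: "d \<in> S l" and Uf: "(U, f) \<in> D" "P \<in> U"
  shows "\<exists>V. nonempty_open X V \<and> P \<in> V \<and> \<kappa> (f ^ l) * d \<in> \<Lambda> V"
proof -
  have U: "nonempty_open X U" using cartier Uf(1) unfolding cartier_divisor_def by blast
  then have "P \<in> X" using Uf(2) unfolding nonempty_open_def by blast
  then obtain V where V: "nonempty_open X V" "P \<in> V" "d \<in> lspan (\<kappa> ` L l V) (\<Lambda> V)"
    using d unfolding S_iff by blast
  have VU: "nonempty_open X (V \<inter> U)" by (rule nonempty_open_Int[OF V(1) U V(2) Uf(2)])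
  from V(3) have "\<kappa> (f ^ l) * d \<in> \<Lambda> (V \<inter> U)"
  proof induction
    case zero
    show ?case using is_subring_0[OF \<Lambda>_subring[OF VU]] by simp
  next
    case (step c w x)
    then obtain a where a: "c = \<kappa> a" "a \<in> L l V" by blast
    have "f ^ l * a \<in> structure_sheaf (V \<inter> U)"
      using a(2) Uf(1) unfolding divisor_sheaf_mult_iff structure_sheaf_def
      by (auto simp: mult.commute)
    moreover have "w \<in> \<Lambda> (V \<inter> U)" by (rule \<Lambda>_restrict[OF V(1) VU Int_lower1 step(2)])
    ultimately have "\<kappa> (f ^ l * a) * w \<in> \<Lambda> (V \<inter> U)" by (rule \<Lambda>_scale[OF VU])
    then have "\<kappa> (f ^ l * a) * w + \<kappa> (f ^ l) * x \<in> \<Lambda> (V \<inter> U)"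
      using step.IH by (rule is_subring_add[OF \<Lambda>_subring[OF VU]])
    then show ?case by (simp add: a(1) distrib_left j_mult mult.assoc)
  qed
  then show ?thesis using VU V(2) Uf(2) by blast
qed

lemma minimal_polynomial_dvd:
  assumes p: "p \<noteq> 0" "eval b p = 0" "\<And>q. q \<noteq> 0 \<Longrightarrow> eval b q = 0 \<Longrightarrow> degree p \<le> degree q"
    and q: "eval b q = 0"
  shows "p dvd q"
proof -
  have "eval b (q div p * p + q mod p) = 0" using q by simp
  then have "eval b (q mod p) = 0" using p(2) by (simp only: eval_add eval_mult) simp
  then have "q mod p = 0" using p(3)[of "q mod p"] degree_mod_less[OF p(1), of q] by fastforce
  then show ?thesis by (rule mod_0_imp_dvd)
qed

text \<open>With c = f ^ l, the element c s is near \<open>P\<close> a section of the order, hence a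
  root of a monic \<open>q\<close> over \<open>P\<close>. Its minimal polynomial c ^ r p(x / c),
  where r is the degree of \<open>p\<close>, divides \<open>q\<close>, so normality puts its
  coefficients into \<open>P\<close>; the i-th one is coeff p i times c ^ (r - i).\<close>

lemma minimal_polynomial_S:
  assumes s: "s \<in> S l" and p: "lead_coeff p = 1" "eval s p = 0"
    "\<And>q. q \<noteq> 0 \<Longrightarrow> eval s q = 0 \<Longrightarrow> degree p \<le> degree q" and i: "i \<le> degree p"
  shows "coeff p i \<in> L (l * (degree p - i)) X"
  unfolding divisor_sheaf_mult_iff
proof (intro ballI, clarify)
  fix U f P assume P: "(U, f) \<in> D" "P \<in> X" "P \<in> U"
  have f0: "f \<noteq> 0" using cartier P(1) unfolding cartier_divisor_def by blast
  define c where "c = f ^ l"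
  have c0: "c \<noteq> 0" using f0 by (simp add: c_def)
  let ?r = "degree p"
  obtain V where V: "nonempty_open X V" "P \<in> V" "\<kappa> c * s \<in> \<Lambda> V"
    using S_local[OF s P(1,3)] by (auto simp: c_def)
  obtain q where q: "lead_coeff q = 1" "coeffs_in P q" "eval (\<kappa> c * s) q = 0"
    using \<Lambda>_integral[OF V] by blast
  have ev: "eval s [:0, c:] = \<kappa> c * s"
    using j_central[of c s] by (simp add: eval_pCons eval_0 j_0)
  have "eval s (pcompose q [:0, c:]) = 0" using q(3) by (simp add: eval_pcompose ev)
  then have "p dvd pcompose q [:0, c:]"
    using p by (intro minimal_polynomial_dvd) auto
  then obtain r where "pcompose q [:0, c:] = p * r" by (rule dvdE)
  then have "pcompose (pcompose q [:0, c:]) [:0, inverse c:] = pcompose p [:0, inverse c:] * pcompose r [:0, inverse c:]"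
    by (simp add: pcompose_mult)
  moreover have "pcompose (pcompose q [:0, c:]) [:0, inverse c:] = q"
    using c0 by (simp add: pcompose_assoc[symmetric] pcompose_pCons pcompose_idR)
  ultimately have "pcompose p [:0, inverse c:] dvd q" by simp
  define p' where "p' = smult (c ^ ?r) (pcompose p [:0, inverse c:])"
  have "p' dvd q" using \<open>pcompose p [:0, inverse c:] dvd q\<close> c0 by (simp add: p'_def smult_dvd_iff)
  have coeff: "coeff p' k = c ^ ?r * (inverse c ^ k * coeff p k)" for k
    by (simp add: p'_def coeff_pcompose_linear)
  have "degree p' = ?r" using c0 by (simp add: p'_def)
  then have "lead_coeff p' = 1" using p(1) c0 by (simp add: coeff power_mult_distrib[symmetric])
  moreover have "\<And>a. integral_over P a \<Longrightarrow> a \<in> P" using normal P(2) unfolding normal_scheme_def by blast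
  ultimately have "coeffs_in P p'"
    using coeffs_in_monic_factor[OF point(1)[OF P(2)] _ q(1,2) _ \<open>p' dvd q\<close>] by blast
  then have "coeff p' i \<in> P" by (simp add: coeffs_in_def)
  also have "coeff p' i = coeff p i * c ^ (?r - i)"
  proof -
    have "c ^ ?r = c ^ (?r - i) * c ^ i" using i by (simp add: power_add[symmetric])
    then show ?thesis using c0 by (simp add: coeff power_inverse)
  qed
  finally show "coeff p i * f ^ (l * (?r - i)) \<in> P" by (simp add: c_def power_mult)
qed

sublocale graded_order "\<lambda>l. L l X" S \<kappa>
proof (intro graded_order.intro graded_order_axioms.intro)
  show "graded_ring (\<lambda>l. L l X)" by (rule graded_ring_L) simp
  show "graded_ring S" by (rule graded_ring_S)
  show "k_algebra \<kappa>" by unfold_locales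
  show "\<And>a l. a \<in> L l X \<Longrightarrow> \<kappa> a \<in> S l" by (rule scalars_S)
  fix s l assume s: "s \<in> S l"
  have "algebra_map \<kappa>" "fd_subspace \<kappa> UNIV"
    using cda by (auto simp: central_division_algebra_def)
  from minimal_polynomial_exists[OF this, of s] obtain p where p: "lead_coeff p = 1" "eval s p = 0"
    "\<And>q. q \<noteq> 0 \<Longrightarrow> eval s q = 0 \<Longrightarrow> degree p \<le> degree q" by blast
  show "\<exists>p. lead_coeff p = 1 \<and> eval s p = 0 \<and> (\<forall>q. q \<noteq> 0 \<and> eval s q = 0 \<longrightarrow> degree p \<le> degree q)
      \<and> (\<forall>i\<le>degree p. coeff p i \<in> L (l * (degree p - i)) X)"
    using p by (intro exI[of _ p] conjI allI impI) (auto intro: minimal_polynomial_S[OF s p])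
qed

end

section \<open>Growth of a commutative section ring\<close>

lemma algebra_map_const_map:
  fixes \<iota> :: "'k::field \<Rightarrow> 'K::field"
  assumes "algebra_map \<iota>"
  shows "algebra_map (const_map \<iota>)"
proof -
  interpret k_algebra \<iota> by (rule k_algebra.intro) fact
  show ?thesis
    unfolding algebra_map_def const_map_def
    by (auto simp: j_1 j_add j_mult Poly_Mapping.single_add Poly_Mapping.mult_single mult.commute)
qed

lemma single_power:
  fixes a :: "'a::comm_ring_1"
  shows "Poly_Mapping.single m a ^ n = Poly_Mapping.single (m * n) (a ^ n)"
  by (induction n) (simp_all add: Poly_Mapping.mult_single)

lemma monomial_single:
  fixes s :: "'a::comm_ring_1"
  assumes "length e = length xs"
  shows "monomial (map (\<lambda>x. Poly_Mapping.single m (x * s)) xs) e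
    = Poly_Mapping.single (m * sum_list e) (s ^ sum_list e * monomial xs e)"
  using assms
proof (induction e xs rule: list_induct2)
  case (Cons n e x xs)
  then show ?case
    by (simp add: single_power Poly_Mapping.mult_single distrib_left power_add power_mult_distrib ac_simps)
qed simp

lemma poly_mapping_sum_singles:
  "p = (\<Sum>k\<in>Poly_Mapping.keys p. Poly_Mapping.single k (Poly_Mapping.lookup p k))"
  by (rule poly_mapping_eqI)
    (auto simp: Poly_Mapping.lookup_sum Poly_Mapping.lookup_single Poly_Mapping.when_def
      sum.delta in_keys_iff)

section \<open>Graded subrings of a polynomial ring in one variable over a field\<close>

locale graded_domain = graded_ring R + k_algebra \<iota>
  for R :: "nat \<Rightarrow> 'K::field set" and \<iota> :: "'k::field \<Rightarrow> 'K" +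
  assumes range_subset: "range \<iota> \<subseteq> R 0"
    and positive_degree: "\<exists>l>0. R l \<noteq> {0}"
begin

definition A :: "(nat \<Rightarrow>\<^sub>0 'K) set" where
  "A = {p. \<forall>l. Poly_Mapping.lookup p l \<in> R l}"

definition F :: "'K set" where
  "F = {inverse s * a | s a l. s \<noteq> 0 \<and> s \<in> R l \<and> a \<in> R l}"

lemma FI: "s \<noteq> 0 \<Longrightarrow> s \<in> R l \<Longrightarrow> a \<in> R l \<Longrightarrow> inverse s * a \<in> F"
  unfolding F_def by blast

lemma division_subring_F: "division_subring F"
  by (rule division_subring_fractions[OF _ F_def]) unfold_locales

lemma range_subset_F: "range \<iota> \<subseteq> F"
proof
  fix x assume "x \<in> range \<iota>"
  then show "x \<in> F" using range_subset FI[OF _ one, of x] by auto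
qed

lemma single_in_A_iff: "Poly_Mapping.single l a \<in> A \<longleftrightarrow> a \<in> R l"
  unfolding A_def by (rule single_in_graded_iff) (rule zero)

lemma is_subring_A: "is_subring A"
  unfolding is_subring_def
proof (intro conjI ballI)
  show "1 \<in> A" using single_in_A_iff[of 0 1] one by simp
  have diff: "p - q \<in> A" if "p \<in> A" "q \<in> A" for p q
    using that diff by (simp add: A_def Poly_Mapping.lookup_minus)
  have zero: "0 \<in> A" using zero by (simp add: A_def)
  have add: "p + q \<in> A" if "p \<in> A" "q \<in> A" for p q
    using diff[OF that(1) diff[OF zero that(2)]] by simp
  have sum: "sum f I \<in> A" if "\<And>i. i \<in> I \<Longrightarrow> f i \<in> A" for f :: "nat \<Rightarrow> nat \<Rightarrow>\<^sub>0 'K" and I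
    using that by (induction I rule: infinite_finite_induct) (auto intro: zero add)
  fix p q assume p: "p \<in> A" and q: "q \<in> A"
  show "p - q \<in> A" by (rule diff[OF p q])
  have "p * q = (\<Sum>k\<in>Poly_Mapping.keys p. \<Sum>l\<in>Poly_Mapping.keys q.
      Poly_Mapping.single (k + l) (Poly_Mapping.lookup p k * Poly_Mapping.lookup q l))"
    by (subst poly_mapping_sum_singles[of p], subst poly_mapping_sum_singles[of q])
      (simp add: sum_product Poly_Mapping.mult_single)
  also have "\<dots> \<in> A"
  proof (intro sum)
    fix k l
    have "Poly_Mapping.lookup p k * Poly_Mapping.lookup q l \<in> R (k + l)"
      using p q by (intro mult) (auto simp: A_def)
    then show "Poly_Mapping.single (k + l) (Poly_Mapping.lookup p k * Poly_Mapping.lookup q l) \<in> A"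
      by (simp add: single_in_A_iff)
  qed
  finally show "p * q \<in> A" .
qed

lemma range_const_map_subset: "range (const_map \<iota>) \<subseteq> A"
  using range_subset by (auto simp: const_map_def single_in_A_iff)

lemma positive_degree_element: obtains s l where "l > 0" "s \<in> R l" "s \<noteq> 0"
  using positive_degree zero by blast

text \<open>Positivity of the common degree \<open>m\<close> matters later, when multiples of
  \<open>m\<close> have to separate total degrees; for the empty list it comes from a homogeneous
  element of positive degree.\<close>

lemma common_denominator:
  assumes "set xs \<subseteq> F"
  shows "\<exists>m s. m > 0 \<and> s \<in> R m \<and> s \<noteq> 0 \<and> (\<forall>x\<in>set xs. x * s \<in> R m)"
  using assms
proof (induction xs)
  case Nil
  then show ?case using positive_degree_element by (metis empty_iff list.set(1))
next
  case (Cons x xs)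
  then obtain m s where s: "m > 0" "s \<in> R m" "s \<noteq> 0" "\<forall>x\<in>set xs. x * s \<in> R m" by auto
  obtain t a l where t: "x = inverse t * a" "t \<noteq> 0" "t \<in> R l" "a \<in> R l"
    using Cons.prems unfolding F_def by auto
  have "s * t \<in> R (m + l)" by (rule mult[OF s(2) t(3)])
  moreover have "x * (s * t) \<in> R (m + l)"
    using mult[OF s(2) t(4)] t(2) by (simp add: t(1) ac_simps)
  moreover have "y * (s * t) \<in> R (m + l)" if "y \<in> set xs" for y
    using mult[of "y * s" m t l] s(4) that t(3) by (simp add: mult.assoc)
  ultimately show ?case using s(1,3) t(2) by (intro exI[of _ "m + l"] exI[of _ "s * t"]) auto
qed

text \<open>
  Adjoining a homogeneous element of positive degree to degree zero fractions, scaled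
  into the same degree, gains one independent element.
\<close>

lemma independent_homogeneous:
  assumes xs: "set xs \<subseteq> F" "alg_independent \<iota> xs"
  shows "\<exists>ys. set ys \<subseteq> A \<and> length ys = Suc (length xs) \<and> alg_independent (const_map \<iota>) ys"
proof -
  obtain m s where s: "m > 0" "s \<in> R m" "s \<noteq> 0" "\<forall>x\<in>set xs. x * s \<in> R m"
    using common_denominator[OF xs(1)] by blast
  define ys where "ys = map (\<lambda>x. Poly_Mapping.single m (x * s)) (1 # xs)"
  have "set ys \<subseteq> A" using s by (auto simp: ys_def single_in_A_iff)
  moreover have "alg_independent (const_map \<iota>) ys"
    unfolding alg_independent_def
  proof (intro allI impI ballI)
    fix E c e0
    assume E: "finite E \<and> E \<subseteq> {e. length e = length ys} \<and> (\<Sum>e\<in>E. const_map \<iota> (c e) * monomial ys e) = 0"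
      and e0: "e0 \<in> E"
    \<comment> \<open>Only the homogeneous component containing the term of \<open>e0\<close> is
      considered: as m > 0, the degree m h singles out the exponent vectors with sum
      \<open>h\<close>.\<close>
    define h where "h = sum_list e0"
    define I where "I = {e \<in> E. sum_list e = h}"
    have len: "length e = Suc (length xs)" if "e \<in> E" for e using E that by (auto simp: ys_def)
    have mon: "monomial (1 # xs) e = monomial xs (tl e)" if "e \<in> E" for e
      using len[OF that] by (cases e) auto
    have term_eq: "const_map \<iota> (c e) * monomial ys e
        = Poly_Mapping.single (m * sum_list e) (s ^ sum_list e * (\<iota> (c e) * monomial xs (tl e)))"
      if "e \<in> E" for e
    proof -
      have "monomial ys e = Poly_Mapping.single (m * sum_list e) (s ^ sum_list e * monomial xs (tl e))"
        unfolding ys_def using len[OF that] mon[OF that] by (subst monomial_single) auto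
      then show ?thesis by (simp add: const_map_def Poly_Mapping.mult_single ac_simps)
    qed
    have "(\<Sum>e\<in>E. Poly_Mapping.single (m * sum_list e) (s ^ sum_list e * (\<iota> (c e) * monomial xs (tl e)))) = 0"
      using E by (simp add: term_eq)
    then have "0 = Poly_Mapping.lookup (\<Sum>e\<in>E. Poly_Mapping.single (m * sum_list e)
        (s ^ sum_list e * (\<iota> (c e) * monomial xs (tl e)))) (m * h)"
      by simp
    also have "\<dots> = (\<Sum>e\<in>E. if sum_list e = h then s ^ h * (\<iota> (c e) * monomial xs (tl e)) else 0)"
      unfolding Poly_Mapping.lookup_sum
      using s(1) by (intro sum.cong) (auto simp: Poly_Mapping.lookup_single Poly_Mapping.when_def)
    also have "\<dots> = (\<Sum>e\<in>I. s ^ h * (\<iota> (c e) * monomial xs (tl e)))"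
      unfolding I_def using E by (simp add: sum.inter_filter)
    also have "\<dots> = s ^ h * (\<Sum>e\<in>I. \<iota> (c e) * monomial xs (tl e))"
      by (simp add: sum_distrib_left)
    finally have zero: "(\<Sum>e\<in>I. \<iota> (c e) * monomial xs (tl e)) = 0" using s(3) by simp
    \<comment> \<open>Dehomogenization: with the sum fixed at \<open>h\<close>, the first exponent
      is determined by the others, so deleting it is injective and leads to a relation among
      \<open>xs\<close>.\<close>
    have split: "e = (h - sum_list (tl e)) # tl e" if "e \<in> I" for e
      using that len[of e] by (cases e) (auto simp: I_def)
    have inj: "inj_on tl I" by (rule inj_onI) (metis split)
    define d where "d f = c ((h - sum_list f) # f)" for f
    have "(\<Sum>f\<in>tl ` I. \<iota> (d f) * monomial xs f) = (\<Sum>e\<in>I. \<iota> (c e) * monomial xs (tl e))"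
      unfolding sum.reindex[OF inj] o_def d_def by (intro sum.cong) (use split in auto)
    then have "(\<Sum>f\<in>tl ` I. \<iota> (d f) * monomial xs f) = 0" using zero by simp
    moreover have "finite (tl ` I)" "tl ` I \<subseteq> {e. length e = length xs}"
      using E len by (auto simp: I_def)
    ultimately have "\<forall>f\<in>tl ` I. d f = 0"
      using xs(2) unfolding alg_independent_def by blast
    moreover have "e0 \<in> I" using e0 by (simp add: I_def h_def)
    ultimately have "c ((h - sum_list (tl e0)) # tl e0) = 0" "e0 = (h - sum_list (tl e0)) # tl e0"
      using split[of e0] unfolding d_def by blast+
    then show "c e0 = 0" by metis
  qed
  ultimately show ?thesis by (intro exI[of _ ys]) (simp add: ys_def)
qed

lemma center_of_A: "center_of A = A" and center_of_F: "center_of F = F"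
  by (simp_all add: center_of_def mult.commute)

lemma Ld_A_ge: "trdeg \<iota> F + 1 \<le> Ld (const_map \<iota>) A"
proof -
  interpret P: k_algebra "const_map \<iota>"
    by (intro k_algebra.intro algebra_map_const_map algebra_map)
  \<comment> \<open>With the 1 moved to the right hand side, the supremum can be bounded term by
    term.\<close>
  have "trdeg \<iota> F \<le> Ld (const_map \<iota>) A - 1"
    unfolding trdeg_def
  proof (rule SUP_least)
    fix xs assume "xs \<in> {xs. set xs \<subseteq> center_of F \<and> alg_independent \<iota> xs}"
    then obtain ys where ys: "set ys \<subseteq> A" "length ys = Suc (length xs)" "alg_independent (const_map \<iota>) ys"
      using independent_homogeneous unfolding center_of_F by blast
    have "ereal (real (length ys)) \<le> Ld (const_map \<iota>) A"
      by (rule P.Ld_ge[OF is_subring_A range_const_map_subset]) (use ys center_of_A in auto)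
    then show "ereal (real (length xs)) \<le> Ld (const_map \<iota>) A - 1"
      unfolding ys(2) by (cases "Ld (const_map \<iota>) A") (auto simp: one_ereal_def)
  qed
  then show ?thesis
    by (cases "Ld (const_map \<iota>) A"; cases "trdeg \<iota> F") (simp_all add: one_ereal_def)
qed

text \<open>The degrees of nonzero homogeneous elements form a monoid, and division with remainder
  shows that the least positive difference \<open>e\<close> of two of them divides all. A quotient
  \<open>u\<close> of homogeneous elements with degrees differing by \<open>e\<close> has degree
  \<open>e\<close> as a fraction, so division by u ^ m leads from degree e m to degree 0.\<close>

lemma uniformizer:
  obtains e u where "e > 0" "u \<noteq> 0" "\<And>l a. a \<in> R l \<Longrightarrow> a \<noteq> 0 \<Longrightarrow> e dvd l"
    "\<And>m a. a \<in> R (e * m) \<Longrightarrow> inverse (u ^ m) * a \<in> F"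
proof -
  define N where "N = {l. \<exists>a\<in>R l. a \<noteq> 0}"
  have N_add: "l + k \<in> N" if lk: "l \<in> N" "k \<in> N" for l k
  proof -
    obtain a b where "a \<in> R l" "a \<noteq> 0" "b \<in> R k" "b \<noteq> 0" using lk unfolding N_def by blast
    then show ?thesis unfolding N_def by (intro CollectI bexI[of _ "a * b"] mult) simp_all
  qed
  have N_0: "0 \<in> N" unfolding N_def by (intro CollectI bexI[of _ 1] one) simp
  have N_mult: "q * l \<in> N" if "l \<in> N" for q l
    using that by (induction q) (auto intro: N_0 N_add)
  let ?P = "\<lambda>k. k > 0 \<and> (\<exists>p\<in>N. p + k \<in> N)"
  define e where "e = (LEAST k. ?P k)"
  obtain l s where l: "l > 0" "s \<in> R l" "s \<noteq> 0" by (rule positive_degree_element)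
  then have "l \<in> N" by (auto simp: N_def)
  then have "?P l" using l(1) N_0 by (intro conjI bexI[of _ 0]) simp_all
  then have e: "?P e" unfolding e_def by (rule LeastI)
  then obtain p where p: "p \<in> N" "p + e \<in> N" by blast
  obtain s t where s: "s \<in> R p" "s \<noteq> 0" and t: "t \<in> R (p + e)" "t \<noteq> 0"
    using p unfolding N_def by blast
  show thesis
  proof (rule that[of e "t * inverse s"])
    show "e > 0" using e by blast
    show "t * inverse s \<noteq> 0" using s t by simp
    show "e dvd l" if "a \<in> R l" "a \<noteq> 0" for l a
    proof (rule ccontr)
      assume "\<not> e dvd l"
      then have r: "l mod e > 0" by (simp add: dvd_eq_mod_eq_0)
      have "l \<in> N" using that by (auto simp: N_def)
      \<comment> \<open>With q = l div e, the degrees l + q p and q (p + e) differ by l mod e, which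
        contradicts the choice of \<open>e\<close> unless the remainder is 0.\<close>
      then have "l + (l div e) * p \<in> N" using N_add N_mult p(1) by blast
      also have "l + (l div e) * p = (l div e) * (p + e) + l mod e"
        by (simp add: distrib_left)
      finally have "?P (l mod e)" using r N_mult[OF p(2)] by blast
      then have "e \<le> l mod e" unfolding e_def by (rule Least_le)
      then show False using e mod_less_divisor[of e l] by linarith
    qed
    show "inverse ((t * inverse s) ^ m) * a \<in> F" if "a \<in> R (e * m)" for m a
    proof -
      have "inverse (t ^ m) * (s ^ m * a) \<in> F"
      proof (rule FI)
        show "t ^ m \<in> R ((p + e) * m)" by (rule power[OF t(1)])
        show "s ^ m * a \<in> R ((p + e) * m)"
          using mult[OF power[OF s(1), of m] that] by (simp add: distrib_right)
      qed (use t in simp)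
      moreover have "inverse ((t * inverse s) ^ m) * a = inverse (t ^ m) * (s ^ m * a)"
        using s t by (simp add: power_mult_distrib field_simps)
      ultimately show ?thesis by (simp only:)
    qed
  qed
qed

text \<open>Homogeneous components are written as u ^ m v in degree e m with \<open>v\<close> in a
  finite subset \<open>V\<close> of \<open>F\<close>. An n-fold product then splits into a power of
  \<open>u\<close>, with an exponent bounded linearly in n, and an n-fold product from
  \<open>V\<close>; the choice of the exponent accounts for the additional dimension.\<close>

lemma GKdim_A_le: "GKdim (const_map \<iota>) A \<le> trdeg \<iota> F + 1"
proof (rule trdeg_cases[OF algebra_map, of F])
  assume "trdeg \<iota> F = \<infinity>"
  then show ?thesis by simp
next
  fix xs
  assume xs: "set xs \<subseteq> center_of F" "alg_independent \<iota> xs" "trdeg \<iota> F = ereal (real (length xs))"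
    "\<And>y. y \<in> center_of F \<Longrightarrow> \<not> alg_independent \<iota> (xs @ [y])"
  let ?d = "length xs"
  interpret P: k_algebra "const_map \<iota>"
    by (intro k_algebra.intro algebra_map_const_map algebra_map)
  have sub: "is_subring F" and inv: "\<forall>a\<in>F. inverse a \<in> F"
    using division_subring_F by (auto simp: division_subring_def)
  have comm: "commuting_set F"
    using is_subring_1[OF sub] is_subring_mult[OF sub] by (auto simp: commuting_set_def mult.commute)
  have alg: "algebraic_on F z" if "z \<in> F" for z
    unfolding algebraic_on_def using that by (intro exI[of _ 1] exI[of _ "\<lambda>_. z"]) auto
  obtain e u where e: "e > 0" "u \<noteq> 0" "\<And>l a. a \<in> R l \<Longrightarrow> a \<noteq> 0 \<Longrightarrow> e dvd l"
    "\<And>m a. a \<in> R (e * m) \<Longrightarrow> inverse (u ^ m) * a \<in> F"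
    using uniformizer by blast
  have "GKdim (const_map \<iota>) A \<le> ereal (real (Suc ?d))"
  proof (rule P.GKdim_le)
    fix B assume B: "finite B" "B \<subseteq> A"
    define V where "V = (\<lambda>(b, k). inverse (u ^ (k div e)) * Poly_Mapping.lookup b k) `
      (SIGMA b:B. Poly_Mapping.keys b)"
    have V: "finite V" unfolding V_def using B(1) by auto
    have key: "e * (k div e) = k" if "b \<in> B" "k \<in> Poly_Mapping.keys b" for b k
    proof -
      have "Poly_Mapping.lookup b k \<in> R k" using that B(2) by (auto simp: A_def)
      then have "e dvd k" by (rule e(3)) (use that in \<open>simp add: in_keys_iff\<close>)
      then show ?thesis by simp
    qed
    have VF: "V \<subseteq> F"
    proof
      fix v assume "v \<in> V"
      then obtain b k where v: "v = inverse (u ^ (k div e)) * Poly_Mapping.lookup b k"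
        "b \<in> B" "k \<in> Poly_Mapping.keys b"
        unfolding V_def by auto
      have "Poly_Mapping.lookup b k \<in> R (e * (k div e))"
        unfolding key[OF v(2,3)] using v(2) B(2) by (auto simp: A_def)
      then show "v \<in> F" unfolding v(1) by (rule e(4))
    qed
    \<comment> \<open>The general bound with Z = F and W = {1}, since \<open>V\<close> already lies
      in the commutative \<open>F\<close>.\<close>
    have "\<exists>C. \<forall>n. \<exists>T. finite T \<and> card T \<le> C * (n + 1) ^ ?d \<and> products V n \<subseteq> span_over \<iota> T"
    proof (rule products_bound_algebraic[OF algebra_map range_subset_F comm _ inv])
      show "\<forall>a\<in>F. \<forall>b\<in>F. a + b \<in> F" using is_subring_add[OF sub] by blast
      show "\<forall>b\<in>V. \<forall>w\<in>{1}. b * w \<in> lspan F {1}"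
        using VF by (auto simp del: mult_1_right intro!: lspan_scaled)
      show "commuting_set F" by fact
    qed (use xs center_of_F alg V in \<open>auto simp: mult.commute\<close>)
    then obtain C where C: "\<And>n. \<exists>T. finite T \<and> card T \<le> C * (n + 1) ^ ?d \<and> products V n \<subseteq> span T"
      unfolding span_over_eq by blast
    define M where "M = Max (insert 0 (\<Union>b\<in>B. Poly_Mapping.keys b))"
    define B' where "B' = {Poly_Mapping.single (e * m) (u ^ m * v) | m v. m \<le> M \<and> v \<in> V}"
    have "B \<subseteq> P.span B'"
    proof
      fix b assume b: "b \<in> B"
      have "Poly_Mapping.single k (Poly_Mapping.lookup b k) \<in> B'" if k: "k \<in> Poly_Mapping.keys b" for k
      proof -
        have "k \<le> M" unfolding M_def using b k B(1) by (intro Max_ge) auto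
        then have "k div e \<le> M" by (meson div_le_dividend le_trans)
        moreover define v where "v = inverse (u ^ (k div e)) * Poly_Mapping.lookup b k"
        moreover have "u ^ (k div e) * v = Poly_Mapping.lookup b k" using e(2) by (simp add: v_def)
        moreover have "v \<in> V" unfolding V_def v_def using b k by force
        ultimately show ?thesis
          unfolding B'_def using key[OF b k]
          by (intro CollectI exI[of _ "k div e"] exI[of _ v]) (simp only: simp_thms)
      qed
      then have "(\<Sum>k\<in>Poly_Mapping.keys b. Poly_Mapping.single k (Poly_Mapping.lookup b k)) \<in> P.span B'"
        by (intro P.span_sum P.span_base)
      then show "b \<in> P.span B'" using poly_mapping_sum_singles[of b] by simp
    qed
    note prods = P.products_subset_span[OF this]
    have B'_prods: "\<exists>t w. t \<le> n * M \<and> w \<in> products V n \<and> x = Poly_Mapping.single (e * t) (u ^ t * w)"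
      if "x \<in> P.products B' n" for x n
      using that
    proof (induction n arbitrary: x)
      case 0
      then show ?case by (intro exI[of _ 0] exI[of _ 1]) (simp add: P.products_0 products_0)
    next
      case (Suc n)
      obtain b y where x: "x = b * y" "b \<in> B'" "y \<in> P.products B' n"
        using Suc.prems unfolding P.products_Suc by blast
      obtain m v where b: "b = Poly_Mapping.single (e * m) (u ^ m * v)" "m \<le> M" "v \<in> V"
        using x(2) unfolding B'_def by blast
      obtain t w where y: "t \<le> n * M" "w \<in> products V n" "y = Poly_Mapping.single (e * t) (u ^ t * w)"
        using Suc.IH[OF x(3)] by blast
      have "x = Poly_Mapping.single (e * (m + t)) (u ^ (m + t) * (v * w))"
        unfolding x(1) b(1) y(3) by (simp add: Poly_Mapping.mult_single distrib_left power_add ac_simps)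
      moreover have "v * w \<in> products V (Suc n)" unfolding products_Suc using b(3) y(2) by blast
      moreover have "m + t \<le> Suc n * M" using b(2) y(1) by simp
      ultimately show ?case by blast
    qed
    have "\<exists>T. finite T \<and> card T \<le> (C * (M + 1)) * (n + 1) ^ Suc ?d \<and> P.products B n \<subseteq> P.span T" for n
    proof -
      obtain T where T: "finite T" "card T \<le> C * (n + 1) ^ ?d" "products V n \<subseteq> span T"
        using C by blast
      define T' where "T' = (\<lambda>(t, w). Poly_Mapping.single (e * t) (u ^ t * w)) ` ({..n * M} \<times> T)"
      have "card T' \<le> (n * M + 1) * card T"
        unfolding T'_def using T(1) card_image_le[of "{..n * M} \<times> T"] by (simp add: card_cartesian_product)
      \<comment> \<open>The n M + 1 possible exponents of \<open>u\<close> contribute the extra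
        factor n + 1.\<close>
      also have "\<dots> \<le> ((n + 1) * (M + 1)) * (C * (n + 1) ^ ?d)"
        using T(2) by (intro mult_le_mono) auto
      also have "\<dots> = (C * (M + 1)) * (n + 1) ^ Suc ?d" by (simp only: power_Suc ac_simps)
      finally have card: "card T' \<le> (C * (M + 1)) * (n + 1) ^ Suc ?d" .
      have single_span: "Poly_Mapping.single (e * t) (u ^ t * w) \<in> P.span T'" if t: "t \<le> n * M" and w: "w \<in> span T" for t w
        using w
      proof (induction rule: span_induct_alt)
        case base
        show ?case by (simp add: P.span_zero)
      next
        case (step c x y)
        have "Poly_Mapping.single (e * t) (u ^ t * (scale_by \<iota> c x + y))
            = scale_by (const_map \<iota>) c (Poly_Mapping.single (e * t) (u ^ t * x))
              + Poly_Mapping.single (e * t) (u ^ t * y)"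
          by (simp add: scale_by_def const_map_def Poly_Mapping.mult_single Poly_Mapping.single_add[symmetric] distrib_left ac_simps)
        moreover have "Poly_Mapping.single (e * t) (u ^ t * x) \<in> T'"
          unfolding T'_def using t step(1) by force
        ultimately show ?case
          using P.span_add[OF P.span_scale[OF P.span_base] step.IH] by simp
      qed
      have "P.products B' n \<subseteq> P.span T'"
      proof
        fix x assume "x \<in> P.products B' n"
        then obtain t w where "t \<le> n * M" "w \<in> products V n" "x = Poly_Mapping.single (e * t) (u ^ t * w)"
          using B'_prods by blast
        then show "x \<in> P.span T'" using single_span T(3) by blast
      qed
      then have "P.products B n \<subseteq> P.span T'"
        using prods[of n] P.span_minimal[OF _ P.subspace_span] by blast
      moreover have "finite T'" unfolding T'_def using T(1) by simp
      ultimately show ?thesis using card by blast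
    qed
    then show "\<exists>C. \<forall>n. \<exists>T. finite T \<and> card T \<le> C * (n + 1) ^ Suc ?d \<and> P.products B n \<subseteq> P.span T"
      by blast
  qed
  then show ?thesis by (simp add: xs(3) one_ereal_def add.commute)
qed

lemma GKdim_A: "GKdim (const_map \<iota>) A = trdeg \<iota> F + 1"
  and Ld_A: "Ld (const_map \<iota>) A = trdeg \<iota> F + 1"
proof -
  interpret P: k_algebra "const_map \<iota>"
    by (intro k_algebra.intro algebra_map_const_map algebra_map)
  have "Ld (const_map \<iota>) A \<le> GKdim (const_map \<iota>) A"
    by (rule P.Ld_le_GKdim[OF is_subring_A range_const_map_subset])
  with Ld_A_ge GKdim_A_le
  show "GKdim (const_map \<iota>) A = trdeg \<iota> F + 1" "Ld (const_map \<iota>) A = trdeg \<iota> F + 1"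
    by auto
qed

end

section \<open>Comparison of the invariants\<close>

context k_algebra
begin

lemma j_power: "j (c ^ n) = j c ^ n"
  by (induction n) (simp_all add: j_1 j_mult)

lemma monomial_map: "monomial (map j xs) e = j (monomial xs e)"
proof (induction xs arbitrary: e)
  case (Cons x xs)
  then show ?case by (cases e) (simp_all add: j_1 j_mult j_power)
qed (simp add: j_1)

lemma alg_independent_map:
  assumes "(0::'a) \<noteq> 1"
  shows "alg_independent (j \<circ> i) (map j xs) \<longleftrightarrow> alg_independent i xs"
proof -
  have "(\<Sum>e\<in>E. (j \<circ> i) (c e) * monomial (map j xs) e) = j (\<Sum>e\<in>E. i (c e) * monomial xs e)" for E c
    by (simp add: monomial_map j_mult j_sum)
  then show ?thesis
    unfolding alg_independent_def by (simp add: j_eq_0_iff[OF assms])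
qed

end

context normal_order
begin

text \<open>The facts about \<open>F\<close> over \<open>'k\<close> are taken as assumptions because
  they are proved in \<open>graded_domain\<close>, where the base field is present.\<close>

lemma order_invariants:
  assumes \<iota>: "algebra_map \<iota>" and F: "range \<iota> \<subseteq> F" "division_subring F"
  shows "trdeg (\<kappa> \<circ> \<iota>) \<Delta> = trdeg \<iota> F" "Ld (\<kappa> \<circ> \<iota>) \<Delta> = trdeg \<iota> F"
proof -
  let ?j = "\<kappa> \<circ> \<iota>"
  have nontrivial: "(0::'d) \<noteq> 1" by simp
  interpret I: k_algebra \<iota> by (rule k_algebra.intro) fact
  have j: "algebra_map ?j"
    unfolding algebra_map_def by (auto simp: I.j_1 I.j_add I.j_mult j_1 j_add j_mult intro: j_central)
  interpret J: k_algebra ?j by (rule k_algebra.intro) fact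
  have sub\<Delta>: "is_subring \<Delta>" using division_subring_\<Delta> by (simp add: division_subring_def)
  have center\<Delta>: "center_of \<Delta> \<subseteq> \<Delta>" by (auto simp: center_of_def)
  have range_j: "range ?j \<subseteq> \<kappa> ` F" using F(1) by auto
  then have range_\<Delta>: "range ?j \<subseteq> \<Delta>" using \<kappa>_F_subset center\<Delta> by blast
  have center_F: "center_of F = F" by (simp add: center_of_def mult.commute)
  have 1: "trdeg \<iota> F \<le> trdeg ?j \<Delta>"
    unfolding trdeg_def[of \<iota>]
  proof (rule SUP_least)
    fix xs assume "xs \<in> {xs. set xs \<subseteq> center_of F \<and> alg_independent \<iota> xs}"
    then have xs: "set xs \<subseteq> F" "alg_independent \<iota> xs" using center_F by auto
    have "set (map \<kappa> xs) \<subseteq> center_of \<Delta>" using xs(1) \<kappa>_F_subset by auto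
    moreover have "alg_independent ?j (map \<kappa> xs)" using xs(2) alg_independent_map[OF nontrivial] by blast
    ultimately show "ereal (real (length xs)) \<le> trdeg ?j \<Delta>"
      using trdeg_ge_length[of "map \<kappa> xs"] by simp
  qed
  have 2: "trdeg ?j \<Delta> \<le> Ld ?j \<Delta>" by (rule trdeg_le_Ld[OF j sub\<Delta> range_\<Delta>])
  have 3: "Ld ?j \<Delta> \<le> GKdim ?j \<Delta>" by (rule J.Ld_le_GKdim[OF sub\<Delta> range_\<Delta>])
  have 4: "GKdim ?j \<Delta> \<le> trdeg \<iota> F"
  proof (rule trdeg_cases[OF \<iota>, of F])
    assume "trdeg \<iota> F = \<infinity>"
    then show ?thesis by simp
  next
    fix xs
    assume xs: "set xs \<subseteq> center_of F" "alg_independent \<iota> xs" "trdeg \<iota> F = ereal (real (length xs))"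
      "\<And>y. y \<in> center_of F \<Longrightarrow> \<not> alg_independent \<iota> (xs @ [y])"
    have max: "\<not> alg_independent ?j (map \<kappa> xs @ [y])" if y: "y \<in> \<kappa> ` F" for y
    proof -
      obtain z where z: "y = \<kappa> z" "z \<in> F" using y by blast
      have "\<not> alg_independent \<iota> (xs @ [z])" using xs(4) z(2) center_F by blast
      then show ?thesis using alg_independent_map[OF nontrivial, of \<iota> "xs @ [z]"] by (simp add: z(1))
    qed
    have subF: "is_subring F" and invF: "\<And>a. a \<in> F \<Longrightarrow> inverse a \<in> F"
      using F(2) by (auto simp: division_subring_def)
    have comm_F: "commuting_set (\<kappa> ` F)"
      unfolding commuting_set_def
    proof (intro conjI ballI)
      show "1 \<in> \<kappa> ` F" using is_subring_1[OF subF] j_1 by (metis imageI)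
      fix a b assume "a \<in> \<kappa> ` F" "b \<in> \<kappa> ` F"
      then obtain x y where "a = \<kappa> x" "b = \<kappa> y" "x \<in> F" "y \<in> F" by blast
      then show "a * b \<in> \<kappa> ` F" "a * b = b * a"
        using is_subring_mult[OF subF] by (auto simp: j_mult[symmetric] mult.commute)
    qed
    have add_F: "\<forall>a\<in>\<kappa> ` F. \<forall>b\<in>\<kappa> ` F. a + b \<in> \<kappa> ` F"
      using is_subring_add[OF subF] by (auto simp: j_add[symmetric])
    have inv_F: "\<forall>a\<in>\<kappa> ` F. inverse a \<in> \<kappa> ` F"
      using invF by (auto simp: \<kappa>_inverse[symmetric])
    have fd: "algebra_map \<kappa>" "fd_subspace \<kappa> UNIV"
      using cda by (auto simp: central_division_algebra_def)
    obtain W where W: "finite W" "W \<subseteq> \<Delta>" "\<Delta> \<subseteq> lspan (center_of \<Delta>) W"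
      using finite_over_center[OF fd division_subring_\<Delta>] by blast
    have "GKdim ?j \<Delta> \<le> ereal (real (length (map \<kappa> xs)))"
    proof (rule J.GKdim_le)
      fix B assume B: "finite B" "B \<subseteq> \<Delta>"
      show "\<exists>C. \<forall>n. \<exists>T. finite T \<and> card T \<le> C * (n + 1) ^ length (map \<kappa> xs) \<and> J.products B n \<subseteq> J.span T"
        unfolding J.span_over_eq[symmetric]
      proof (rule products_bound_algebraic[OF j range_j comm_F add_F inv_F])
        show "set (map \<kappa> xs) \<subseteq> \<kappa> ` F" using xs(1) center_F by auto
        show "alg_independent ?j (map \<kappa> xs)" using xs(2) alg_independent_map[OF nontrivial] by blast
        show "\<not> alg_independent ?j (map \<kappa> xs @ [y])" if "y \<in> \<kappa> ` F" for y by (rule max[OF that])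
        show "commuting_set (center_of \<Delta>)" by (rule center_of_division_subring(2)[OF division_subring_\<Delta>])
        show "\<kappa> ` F \<subseteq> center_of \<Delta>" by (rule \<kappa>_F_subset)
        show "algebraic_on (\<kappa> ` F) z" if "z \<in> center_of \<Delta>" for z
          using that center\<Delta> by (intro algebraic_over_F) auto
        show "\<forall>b\<in>B. \<forall>z\<in>center_of \<Delta>. b * z = z * b"
          using B(2) unfolding center_of_def by fastforce
        \<comment> \<open>Products are followed by applying them to 1, so 1 joins the generators;
          the enlarged set stays inside \<Delta>, whose products \<open>W\<close> already
          spans.\<close>
        show "\<forall>b\<in>B. \<forall>w\<in>insert 1 W. b * w \<in> lspan (center_of \<Delta>) (insert 1 W)"
        proof (intro ballI)
          fix b w assume "b \<in> B" "w \<in> insert 1 W"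
          then have "b \<in> \<Delta>" "w \<in> \<Delta>" using B(2) W(2) is_subring_1[OF sub\<Delta>] by auto
          then have "b * w \<in> \<Delta>" by (rule is_subring_mult[OF sub\<Delta>])
          then have "b * w \<in> lspan (center_of \<Delta>) W" using W(3) by blast
          then show "b * w \<in> lspan (center_of \<Delta>) (insert 1 W)" by (rule lspan_mono) auto
        qed
      qed (use B(1) W(1) in simp_all)
    qed
    then show ?thesis by (simp add: xs(3))
  qed
  show "trdeg ?j \<Delta> = trdeg \<iota> F" "Ld ?j \<Delta> = trdeg \<iota> F"
    using 1 2 3 4 by (auto intro: antisym order_trans)
qed

end

theorem theorem5p24:
  fixes \<iota> :: "'k::alg_closed_field \<Rightarrow> 'K::field"
    and \<kappa> :: "'K \<Rightarrow> 'd::division_ring"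
    and X :: "'K set set"
    and \<Lambda> :: "'K set set \<Rightarrow> 'd set"
    and D :: "('K set set \<times> 'K) set"
  assumes "algebra_map \<iota>" and "fg_field_over \<iota>"
    and "central_division_algebra \<kappa>"
    and "CHAR('k) > 0 \<longrightarrow> coprime (algebra_degree \<kappa>) CHAR('k)"
    and "proper_variety \<iota> X" and "normal_scheme X"
    and "maximal_order \<iota> X \<kappa> \<Lambda>"
    and "cartier_divisor X D"
    and "\<exists>l>0. divisor_sheaf (divisor_mult l D) X \<noteq> {0}"
  shows "GKdim (const_map \<iota>) (section_ring X D) - 1 = Ld (const_map \<iota>) (section_ring X D) - 1
    \<and> Ld (const_map \<iota>) (section_ring X D) - 1
        = trdeg \<iota> (degree_zero_fractions (section_ring X D))
    \<and> trdeg \<iota> (degree_zero_fractions (section_ring X D))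
        = trdeg (\<kappa> \<circ> \<iota>) (degree_zero_fractions (order_section_ring X \<kappa> \<Lambda> D))
    \<and> trdeg (\<kappa> \<circ> \<iota>) (degree_zero_fractions (order_section_ring X \<kappa> \<Lambda> D))
        = Ld (\<kappa> \<circ> \<iota>) (degree_zero_fractions (order_section_ring X \<kappa> \<Lambda> D))"
proof -
  interpret normal_order \<iota> \<kappa> X \<Lambda> D
    using assms by unfold_locales (auto simp: proper_variety_def maximal_order_def)
  interpret G: graded_domain "\<lambda>l. L l X" \<iota>
  proof (intro graded_domain.intro graded_domain_axioms.intro k_algebra.intro)
    show "graded_ring (\<lambda>l. L l X)" by (rule graded_ring_L) simp
    show "range \<iota> \<subseteq> L 0 X" using point(2) by (fastforce simp: divisor_sheaf_mult_iff)
  qed (use assms in auto)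
  have A: "section_ring X D = G.A"
    unfolding section_ring_def G.A_def ..
  \<comment> \<open>Both locales introduce the degree zero fractions of the section ring; the two
    sets agree by definition.\<close>
  have F: "degree_zero_fractions (section_ring X D) = F" "G.F = F"
    unfolding section_ring_def F_def G.F_def using R.zero
    by (simp_all add: degree_zero_fractions_graded)
  have \<Delta>: "degree_zero_fractions (order_section_ring X \<kappa> \<Lambda> D) = \<Delta>"
    unfolding order_section_ring_def \<Delta>_def using S.zero
    by (simp add: degree_zero_fractions_graded)
  have "trdeg (\<kappa> \<circ> \<iota>) \<Delta> = trdeg \<iota> F" "Ld (\<kappa> \<circ> \<iota>) \<Delta> = trdeg \<iota> F"
    using order_invariants[OF assms(1)] G.range_subset_F G.division_subring_F unfolding F(2) by blast+
  \<comment> \<open>In the extended reals the cancellation has to be checked at infinite values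
    too.\<close>
  moreover have "trdeg \<iota> F + 1 - 1 = trdeg \<iota> F"
    by (cases "trdeg \<iota> F") (simp_all add: one_ereal_def)
  ultimately show ?thesis
    unfolding A F(1)[unfolded A] \<Delta> G.GKdim_A G.Ld_A F(2) by simp
qed

end
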